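(* There is a constant $\kappa_1>0$, depending only on $\nu,f,\Omega$, such that for every $k\in(0,\kappa_1]$ there exists the global attractor $\mathcal{A}_k\subset H$ of the discrete multivalued semigroup $\{S_k^n\}_{n\in\mathbb{N}}$ on $H$ generated by the fully implicit Euler scheme with time-step $k$.
   Context: Let $\Omega\subset\mathbb{R}^2$ be a bounded domain with smooth boundary and $\nu>0$. Let $\mathcal{D}=\{u\in C_0^\infty(\Omega,\mathbb{R}^2):\operatorname{div}u=0\}$, let $H$ be the closure of $\mathcal{D}$ in $L^2(\Omega)^2$ with norm $|\cdot|$ and scalar product $(\cdot,\cdot)$, and let $V$ be the closure of $\mathcal{D}$ in $H^1(\Omega)^2$ with scalar product $((u,v))=(\nabla u,\nabla v)$ and norm $\|u\|=|\nabla u|$. Fix $f\in H$ and set $b(u,v,w)=\int_\Omega((u\cdot\nabla)v)\cdot w\,dx$ for $u,v,w\in V$. For $k>0$ and $w\in H$ let $$S_kw=\{u\in V:\ (u,v)+k\nu((u,v))+k\,b(u,u,v)=(w,v)+k(f,v)\ \ \forall v\in V\},$$ and $S_k\mathcal{B}=\bigcup_{w\in\mathcal{B}}S_kw$ for $\mathcal{B}\subset H$. $S_k^n$ denotes the $n$-th iterate, $S_k^0$ being the identity on $2^H$, $\mathbb{N}=\{0,1,2,\dots\}$. For nonempty $\mathcal{B},\mathcal{C}\subset H$, $\operatorname{dist}(\mathcal{B},\mathcal{C})=\sup_{b\in\mathcal{B}}\inf_{c\in\mathcal{C}}|b-c|$. The global attractor of $\{S_k^n\}_{n\in\mathbb{N}}$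 is the (necessarily unique) nonempty compact set $\mathcal{A}_k\subset H$ such that $S_k^n\mathcal{A}_k=\mathcal{A}_k$ for all $n\in\mathbb{N}$ and $\lim_{n\to\infty}\operatorname{dist}(S_k^n\mathcal{B},\mathcal{A}_k)=0$ for every (nonempty) bounded $\mathcal{B}\subset H$. *)

theory Defs
  imports "HOL-Analysis.Analysis"
begin

section \<open>The Hilbert space of square integrable functions\<close>

definition square_int :: "('a::euclidean_space \<Rightarrow> 'b::euclidean_space) \<Rightarrow> bool" where
  "square_int f \<longleftrightarrow> f \<in> borel_measurable lborel \<and> integrable lborel (\<lambda>x. (norm (f x))\<^sup>2)"

definition L2_eq :: "('a::euclidean_space \<Rightarrow> 'b::euclidean_space) \<Rightarrow> ('a \<Rightarrow> 'b) \<Rightarrow> bool" where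
  "L2_eq f g \<longleftrightarrow> square_int f \<and> square_int g \<and> (AE x in lborel. f x = g x)"

lemma square_int_zero: "square_int (\<lambda>x. 0)"
  by (simp add: square_int_def)

lemma square_int_scaleR: "square_int f \<Longrightarrow> square_int (\<lambda>x. c *\<^sub>R f x)"
  by (auto simp: square_int_def power_mult_distrib)

lemma square_int_add:
  assumes "square_int f" "square_int g"
  shows "square_int (\<lambda>x. f x + g x)"
proof -
  have [measurable]: "f \<in> borel_measurable lborel" "g \<in> borel_measurable lborel"
    using assms by (auto simp: square_int_def)
  have "integrable lborel (\<lambda>x. 2 * (norm (f x))\<^sup>2 + 2 * (norm (g x))\<^sup>2)"
    using assms by (auto simp: square_int_def)
  then have "integrable lborel (\<lambda>x. (norm (f x + g x))\<^sup>2)"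
  proof (rule Bochner_Integration.integrable_bound)
    have "(norm (f x + g x))\<^sup>2 \<le> 2 * (norm (f x))\<^sup>2 + 2 * (norm (g x))\<^sup>2" for x
    proof -
      have "(norm (f x + g x))\<^sup>2 \<le> (norm (f x) + norm (g x))\<^sup>2"
        by (simp add: norm_triangle_ineq power_mono)
      also have "\<dots> \<le> 2 * (norm (f x))\<^sup>2 + 2 * (norm (g x))\<^sup>2"
        using sum_squares_bound[of "norm (f x)" "norm (g x)"] by (simp add: power2_sum)
      finally show ?thesis .
    qed
    then show "AE x in lborel. norm ((norm (f x + g x))\<^sup>2)
        \<le> norm (2 * (norm (f x))\<^sup>2 + 2 * (norm (g x))\<^sup>2)"
      by (auto intro!: AE_I2 order_trans[OF _ abs_ge_self])
  qed measurable
  then show ?thesis by (simp add: square_int_def)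
qed

lemma square_int_uminus: "square_int f \<Longrightarrow> square_int (\<lambda>x. - f x)"
  using square_int_scaleR[of f "-1"] by simp

lemma square_int_diff: "square_int f \<Longrightarrow> square_int g \<Longrightarrow> square_int (\<lambda>x. f x - g x)"
  using square_int_add[of f "\<lambda>x. - g x"] by (simp add: square_int_uminus)

lemma square_int_inner:
  assumes "square_int f" "square_int g"
  shows "integrable lborel (\<lambda>x. f x \<bullet> g x)"
proof -
  have [measurable]: "f \<in> borel_measurable lborel" "g \<in> borel_measurable lborel"
    using assms by (auto simp: square_int_def)
  have "integrable lborel (\<lambda>x. (norm (f x))\<^sup>2 + (norm (g x))\<^sup>2)"
    using assms by (auto simp: square_int_def)
  then show ?thesis
  proof (rule Bochner_Integration.integrable_bound)
    have "\<bar>f x \<bullet> g x\<bar> \<le> (norm (f x))\<^sup>2 + (norm (g x))\<^sup>2" for x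
    proof -
      have "\<bar>f x \<bullet> g x\<bar> \<le> norm (f x) * norm (g x)"
        by (rule Cauchy_Schwarz_ineq2)
      also have "\<dots> \<le> (norm (f x))\<^sup>2 + (norm (g x))\<^sup>2"
        using sum_squares_bound[of "norm (f x)" "norm (g x)"]
          mult_nonneg_nonneg[OF norm_ge_zero[of "f x"] norm_ge_zero[of "g x"]] by linarith
      finally show ?thesis .
    qed
    then show "AE x in lborel. norm (f x \<bullet> g x)
        \<le> norm ((norm (f x))\<^sup>2 + (norm (g x))\<^sup>2)"
      by (auto intro!: AE_I2 order_trans[OF _ abs_ge_self])
  qed measurable
qed

quotient_type (overloaded) ('a, 'b) L2 =
  "'a::euclidean_space \<Rightarrow> 'b::euclidean_space" / partial: L2_eq
  morphisms L2_fun L2_class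
proof (rule part_equivpI)
  show "\<exists>f :: 'a \<Rightarrow> 'b. L2_eq f f"
    by (rule exI[of _ "\<lambda>x. 0"]) (simp add: L2_eq_def square_int_zero)
  show "symp (L2_eq :: ('a \<Rightarrow> 'b) \<Rightarrow> _)"
    by (rule sympI) (auto simp: L2_eq_def)
  show "transp (L2_eq :: ('a \<Rightarrow> 'b) \<Rightarrow> _)"
    by (rule transpI) (auto simp: L2_eq_def)
qed

instantiation L2 :: (euclidean_space, euclidean_space) real_vector
begin

lift_definition zero_L2 :: "('a, 'b) L2" is "\<lambda>x. 0"
  by (simp add: L2_eq_def square_int_zero)

lift_definition plus_L2 :: "('a, 'b) L2 \<Rightarrow> ('a, 'b) L2 \<Rightarrow> ('a, 'b) L2"
  is "\<lambda>f g x. f x + g x"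
  by (auto simp: L2_eq_def square_int_add)

lift_definition scaleR_L2 :: "real \<Rightarrow> ('a, 'b) L2 \<Rightarrow> ('a, 'b) L2"
  is "\<lambda>c f x. c *\<^sub>R f x"
  by (auto simp: L2_eq_def square_int_scaleR)

lift_definition uminus_L2 :: "('a, 'b) L2 \<Rightarrow> ('a, 'b) L2" is "\<lambda>f x. - f x"
  by (auto simp: L2_eq_def square_int_uminus)

lift_definition minus_L2 :: "('a, 'b) L2 \<Rightarrow> ('a, 'b) L2 \<Rightarrow> ('a, 'b) L2"
  is "\<lambda>f g x. f x - g x"
  by (auto simp: L2_eq_def square_int_diff)

instance
proof
  fix u v w :: "('a, 'b) L2" and r s :: real
  show "u + v + w = u + (v + w)"
    by transfer (auto simp: L2_eq_def square_int_add add.assoc)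
  show "u + v = v + u"
    by transfer (auto simp: L2_eq_def square_int_add add.commute)
  show "0 + u = u"
    by transfer (auto simp: L2_eq_def)
  show "- u + u = 0"
    by transfer (simp add: L2_eq_def square_int_zero)
  show "u - v = u + - v"
    by transfer (auto simp: L2_eq_def square_int_uminus square_int_add square_int_diff)
  show "r *\<^sub>R (u + v) = r *\<^sub>R u + r *\<^sub>R v"
    by transfer (auto simp: L2_eq_def square_int_add square_int_scaleR scaleR_add_right)
  show "(r + s) *\<^sub>R u = r *\<^sub>R u + s *\<^sub>R u"
    by transfer (auto simp: L2_eq_def square_int_add square_int_scaleR scaleR_add_left)
  show "r *\<^sub>R s *\<^sub>R u = (r * s) *\<^sub>R u"
    by transfer (auto simp: L2_eq_def square_int_scaleR)
  show "1 *\<^sub>R u = u"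
    by transfer (auto simp: L2_eq_def)
qed

end

instantiation L2 :: (euclidean_space, euclidean_space) real_inner
begin

lift_definition inner_L2 :: "('a, 'b) L2 \<Rightarrow> ('a, 'b) L2 \<Rightarrow> real"
  is "\<lambda>f g. LINT x|lborel. f x \<bullet> g x"
  by (rule integral_cong_AE) (auto simp: L2_eq_def square_int_def)

definition norm_L2 :: "('a, 'b) L2 \<Rightarrow> real" where
  "norm_L2 u = sqrt (u \<bullet> u)"

definition sgn_L2 :: "('a, 'b) L2 \<Rightarrow> ('a, 'b) L2" where
  "sgn_L2 u = u /\<^sub>R norm u"

definition dist_L2 :: "('a, 'b) L2 \<Rightarrow> ('a, 'b) L2 \<Rightarrow> real" where
  "dist_L2 u v = norm (u - v)"

definition uniformity_L2 :: "(('a, 'b) L2 \<times> ('a, 'b) L2) filter" where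
  "uniformity_L2 = (INF e\<in>{0 <..}. principal {(u, v). dist u v < e})"

definition open_L2 :: "('a, 'b) L2 set \<Rightarrow> bool" where
  "open_L2 U \<longleftrightarrow> (\<forall>u\<in>U. \<forall>\<^sub>F (u', v) in uniformity. u' = u \<longrightarrow> v \<in> U)"

instance
proof
  fix u v w :: "('a, 'b) L2" and r :: real
  show "sgn u = u /\<^sub>R norm u"
    by (rule sgn_L2_def)
  show "dist u v = norm (u - v)"
    by (rule dist_L2_def)
  show "uniformity = (INF e\<in>{0 <..}. principal {(u :: ('a, 'b) L2, v). dist u v < e})"
    by (rule uniformity_L2_def)
  show "open U \<longleftrightarrow> (\<forall>u\<in>U. \<forall>\<^sub>F (u', v) in uniformity. u' = u \<longrightarrow> v \<in> U)"
    for U :: "('a, 'b) L2 set"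
    by (rule open_L2_def)
  show "u \<bullet> v = v \<bullet> u"
    by transfer (simp add: inner_commute)
  show "(u + v) \<bullet> w = u \<bullet> w + v \<bullet> w"
    by transfer (auto simp: L2_eq_def inner_add_left square_int_inner)
  show "(r *\<^sub>R u) \<bullet> v = r * (u \<bullet> v)"
    by transfer simp
  show "0 \<le> u \<bullet> u"
    by transfer simp
  show "u \<bullet> u = 0 \<longleftrightarrow> u = 0"
  proof transfer
    fix f :: "'a \<Rightarrow> 'b"
    assume f: "L2_eq f f"
    then have "integrable lborel (\<lambda>x. f x \<bullet> f x)"
      by (auto simp: L2_eq_def square_int_inner)
    then have "(LINT x|lborel. f x \<bullet> f x) = 0 \<longleftrightarrow> (AE x in lborel. f x \<bullet> f x = 0)"
      by (rule integral_nonneg_eq_0_iff_AE) simp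
    with f show "(LINT x|lborel. f x \<bullet> f x) = 0 \<longleftrightarrow> L2_eq f (\<lambda>x. 0)"
      by (simp add: L2_eq_def square_int_zero)
  qed
  show "norm u = sqrt (u \<bullet> u)"
    by (rule norm_L2_def)
qed

end

text \<open>
  \<^term>\<open>L2_fun u\<close> is an unspecified square integrable representative of the class \<open>u\<close>.
  The space \<open>L\<^sup>2(\<Omega>)\<close> is identified with the subspace of those \<open>u\<close> that vanish almost
  everywhere outside \<open>\<Omega>\<close>, i.e. functions on \<open>\<Omega>\<close> are extended by zero.
\<close>

definition L2_on :: "'a::euclidean_space set \<Rightarrow> ('a, 'b::euclidean_space) L2 set" where
  "L2_on \<Omega> = {u. AE x in lborel. x \<notin> \<Omega> \<longrightarrow> L2_fun u x = 0}"


section \<open>Smooth functions and smooth domains\<close>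

primrec Ck :: "nat \<Rightarrow> ('a::euclidean_space \<Rightarrow> 'b::real_normed_vector) \<Rightarrow> bool" where
  "Ck 0 f \<longleftrightarrow> continuous_on UNIV f"
| "Ck (Suc n) f \<longleftrightarrow> f differentiable_on UNIV \<and>
     (\<forall>e\<in>Basis. Ck n (\<lambda>x. frechet_derivative f (at x) e))"

definition smooth :: "('a::euclidean_space \<Rightarrow> 'b::real_normed_vector) \<Rightarrow> bool" where
  "smooth f \<longleftrightarrow> (\<forall>n. Ck n f)"

text \<open>
  The usual definition of a \<open>C\<^sup>\<infinity>\<close> boundary: after a rigid motion, \<open>\<Omega>\<close> is locally the
  region above the graph of a smooth function.
\<close>

definition smooth_boundary :: "(real^2) set \<Rightarrow> bool" where
  "smooth_boundary \<Omega> \<longleftrightarrow>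
     (\<forall>p\<in>frontier \<Omega>. \<exists>r>0. \<exists>T :: real^2 \<Rightarrow> real^2. \<exists>\<gamma> :: real \<Rightarrow> real.
        orthogonal_transformation T \<and> smooth \<gamma> \<and>
        \<Omega> \<inter> ball p r = {x \<in> ball p r. T x $ 2 > \<gamma> (T x $ 1)})"

definition smooth_bounded_domain :: "(real^2) set \<Rightarrow> bool" where
  "smooth_bounded_domain \<Omega> \<longleftrightarrow>
     open \<Omega> \<and> connected \<Omega> \<and> \<Omega> \<noteq> {} \<and> bounded \<Omega> \<and> smooth_boundary \<Omega>"


section \<open>The function spaces of the Navier-Stokes equations\<close>

definition test_functions :: "'a::euclidean_space set \<Rightarrow> ('a \<Rightarrow> 'b::real_normed_vector) set" where
  "test_functions \<Omega> =
     {\<phi>. smooth \<phi> \<and> compact (closure {x. \<phi> x \<noteq> 0}) \<and> closure {x. \<phi> x \<noteq> 0} \<subseteq> \<Omega>}"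

text \<open>Hence \<^const>\<open>L2_class\<close> below is only applied to square integrable functions.\<close>

lemma test_functions_square_int:
  fixes \<phi> :: "'a::euclidean_space \<Rightarrow> 'b::euclidean_space"
  assumes "\<phi> \<in> test_functions \<Omega>"
  shows "square_int \<phi>"
proof -
  let ?K = "closure {x. \<phi> x \<noteq> 0}"
  have K: "compact ?K" and "Ck 0 \<phi>"
    using assms by (auto simp: test_functions_def smooth_def)
  then have cont: "continuous_on UNIV \<phi>" by simp
  then have [measurable]: "\<phi> \<in> borel_measurable lborel"
    by (simp add: borel_measurable_continuous_onI)
  have "continuous_on ?K (\<lambda>x. (norm (\<phi> x))\<^sup>2)"
    by (intro continuous_intros continuous_on_subset[OF cont]) simp
  then have "integrable lborel (\<lambda>x. indicator ?K x *\<^sub>R (norm (\<phi> x))\<^sup>2)"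
    by (rule borel_integrable_compact[OF K])
  also have "(\<lambda>x. indicator ?K x *\<^sub>R (norm (\<phi> x))\<^sup>2) = (\<lambda>x. (norm (\<phi> x))\<^sup>2)"
    using closure_subset[of "{x. \<phi> x \<noteq> 0}"] by (fastforce simp: indicator_def)
  finally show ?thesis by (simp add: square_int_def)
qed

definition divergence :: "(real^2 \<Rightarrow> real^2) \<Rightarrow> real^2 \<Rightarrow> real" where
  "divergence \<phi> x = trace (jacobian \<phi> (at x))"

definition Dsol :: "(real^2) set \<Rightarrow> (real^2, real^2) L2 set" where
  "Dsol \<Omega> = L2_class ` {\<phi> \<in> test_functions \<Omega>. \<forall>x\<in>\<Omega>. divergence \<phi> x = 0}"

text \<open>
  Matrix convention for gradients as in \<^const>\<open>jacobian\<close>: the entry \<open>G $ i $ j\<close> is the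
  weak partial derivative of \<open>u $ i\<close> in direction \<open>j\<close>. The scalar product of \<^typ>\<open>real^2^2\<close>
  is the Frobenius product, so \<open>grad \<Omega> u \<bullet> grad \<Omega> v\<close> is the scalar product \<open>((u,v))\<close>,
  and \<open>G *v u\<close> with \<open>G\<close> the gradient of \<open>v\<close> is \<open>(u \<cdot> \<nabla>) v\<close>. Weak gradients are unique because
  membership in \<^term>\<open>L2_on \<Omega>\<close> fixes them outside \<open>\<Omega>\<close>.
\<close>

definition is_weak_grad ::
  "(real^2) set \<Rightarrow> (real^2, real^2) L2 \<Rightarrow> (real^2, real^2^2) L2 \<Rightarrow> bool" where
  "is_weak_grad \<Omega> u G \<longleftrightarrow> G \<in> L2_on \<Omega> \<and>
     (\<forall>\<phi> \<in> test_functions \<Omega> :: (real^2 \<Rightarrow> real) set. \<forall>i j.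
        (LINT x:\<Omega>|lborel. L2_fun u x $ i * frechet_derivative \<phi> (at x) (axis j 1)) =
        - (LINT x:\<Omega>|lborel. L2_fun G x $ i $ j * \<phi> x))"

definition H1 :: "(real^2) set \<Rightarrow> (real^2, real^2) L2 set" where
  "H1 \<Omega> = {u \<in> L2_on \<Omega>. \<exists>G. is_weak_grad \<Omega> u G}"

definition grad :: "(real^2) set \<Rightarrow> (real^2, real^2) L2 \<Rightarrow> (real^2, real^2^2) L2" where
  "grad \<Omega> u = (THE G. is_weak_grad \<Omega> u G)"

definition H1_norm :: "(real^2) set \<Rightarrow> (real^2, real^2) L2 \<Rightarrow> real" where
  "H1_norm \<Omega> u = sqrt ((norm u)\<^sup>2 + (norm (grad \<Omega> u))\<^sup>2)"

definition H_space :: "(real^2) set \<Rightarrow> (real^2, real^2) L2 set" where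
  "H_space \<Omega> = closure (Dsol \<Omega>)"

definition V_space :: "(real^2) set \<Rightarrow> (real^2, real^2) L2 set" where
  "V_space \<Omega> = {u \<in> H1 \<Omega>. \<forall>\<epsilon>>0. \<exists>\<phi>\<in>Dsol \<Omega>. H1_norm \<Omega> (u - \<phi>) < \<epsilon>}"

definition trilinear ::
  "(real^2) set \<Rightarrow> (real^2, real^2) L2 \<Rightarrow> (real^2, real^2) L2 \<Rightarrow> (real^2, real^2) L2 \<Rightarrow> real" where
  "trilinear \<Omega> u v w =
     (LINT x:\<Omega>|lborel. (L2_fun (grad \<Omega> v) x *v L2_fun u x) \<bullet> L2_fun w x)"


section \<open>The implicit Euler scheme and global attractors\<close>

definition euler_step ::
  "(real^2) set \<Rightarrow> real \<Rightarrow> (real^2, real^2) L2 \<Rightarrow> real \<Rightarrow> (real^2, real^2) L2 \<Rightarrow> (real^2, real^2) L2 set"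
  where
  "euler_step \<Omega> \<nu> f k w =
     {u \<in> V_space \<Omega>. \<forall>v\<in>V_space \<Omega>.
        u \<bullet> v + k * \<nu> * (grad \<Omega> u \<bullet> grad \<Omega> v) + k * trilinear \<Omega> u u v = w \<bullet> v + k * (f \<bullet> v)}"

definition euler_map ::
  "(real^2) set \<Rightarrow> real \<Rightarrow> (real^2, real^2) L2 \<Rightarrow> real \<Rightarrow> (real^2, real^2) L2 set \<Rightarrow> (real^2, real^2) L2 set"
  where
  "euler_map \<Omega> \<nu> f k B = (\<Union>w\<in>B. euler_step \<Omega> \<nu> f k w)"

text \<open>
  The values are taken in \<^typ>\<open>ereal\<close>, so that suprema of unbounded sets are correct. Since the
  supremum of the empty set is \<open>-\<infinity>\<close>, the convergence to zero required below
  entails that the sets \<open>(S ^^ n) B\<close> are nonempty.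
\<close>

definition semidist :: "'a::metric_space set \<Rightarrow> 'a set \<Rightarrow> ereal" where
  "semidist B C = (SUP b\<in>B. INF c\<in>C. ereal (dist b c))"

definition global_attractor ::
  "'a::metric_space set \<Rightarrow> ('a set \<Rightarrow> 'a set) \<Rightarrow> 'a set \<Rightarrow> bool" where
  "global_attractor X S A \<longleftrightarrow>
     A \<noteq> {} \<and> A \<subseteq> X \<and> compact A \<and> (\<forall>n. (S ^^ n) A = A) \<and>
     (\<forall>B. B \<noteq> {} \<and> B \<subseteq> X \<and> bounded B \<longrightarrow> (\<lambda>n. semidist ((S ^^ n) B) A) \<longlonglongrightarrow> 0)"

end

theory Submission
  imports Defs
begin

text \<open>
  Why the attractor exists. Testing the equation for \<open>u \<in> S\<^sub>k w\<close> with \<open>u\<close> itself removes the inertial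
  term, since \<open>b(u,u,u) = 0\<close>, and leaves
  \<open>\<bar>u\<bar>\<^sup>2 + k\<nu> \<parallel>u\<parallel>\<^sup>2 = (w + k f, u)\<close>. With the Poincare inequality one step contracts the \<open>L\<^sup>2\<close> norm by a
  factor \<open>\<theta> < 1\<close> up to an additive constant, so every bounded set enters a fixed ball of \<open>H\<close>; the same
  identity bounds \<open>\<parallel>u\<parallel>\<close>, so one further step leads into a ball of \<open>V\<close>, which is compact in \<open>H\<close>. The
  map \<open>S\<^sub>k\<close> has nonempty values (\<open>solutions_nonempty\<close>) and a closed graph
  (\<open>solutions_closed_graph\<close>). For such a set-valued map the omega-limit set of a compact absorbing set is
  the global attractor (\<open>global_attractor_omega\<close>), and an invariant compact set attracting all bounded
  sets is unique.

  Only the following analytic facts about \<open>V\<close> enter; they are collected in the locale \<open>energy_space\<close>: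
  \<open>V\<close> with its gradient is a closed subspace of \<open>L\<^sup>2 \<times> L\<^sup>2\<close>, the form \<open>b\<close> is bounded and skew in its last
  two arguments, derivatives can be moved onto smooth fields, and Poincare's and Friedrichs' inequalities
  hold.

  The two-dimensional estimates all come from one-dimensional slices. A smooth field vanishing at
  one end of a segment satisfies \<open>\<bar>\<phi>(s,t)\<bar>\<^sup>2 \<le> 2M \<integral> \<bar>\<partial>\<^sub>1\<phi>(\<cdot>,t)\<bar>\<^sup>2\<close>, a function of \<open>t\<close> alone, and similarly in
  the other direction. Integrating over a square gives Poincare's inequality. Multiplying a bound
  in terms of \<open>t\<close> by a bound in terms of \<open>s\<close> gives \<open>\<integral> \<bar>\<phi>\<bar>\<^sup>2 \<bar>\<psi>\<bar>\<^sup>2 \<le> 4M\<^sup>2 \<parallel>\<phi>\<parallel>\<^sup>2 \<parallel>\<psi>\<parallel>\<^sup>2\<close>, hence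
  the boundedness of \<open>b\<close>. Comparing values within the cells of a grid gives Friedrichs' inequality: up to
  a small multiple of the Dirichlet norm, the \<open>L\<^sup>2\<close> norm is controlled by finitely many cell averages.
  This is the compactness of \<open>V\<close> in \<open>H\<close> (\<open>compact_ball_V\<close>).

  Existence for one step is Galerkin's method. The finite-dimensional systems are solved by a consequence of
  Kuhn's combinatorial lemma (\<open>zero_in_cube\<close>), which allows the dimension to be a variable. Passing
  to the limit is a finite intersection argument: for each test field and each tolerance the
  approximate solutions form a closed subset of one compact ball. Weak limits are avoided by
  moving all derivatives onto smooth test fields; the only trace of weak compactness is the lemma
  that nested bounded closed convex sets in a Hilbert space have a common point.
\<close>

section \<open>Attractors of set-valued maps\<close>

lemma semidist_le:
  fixes B C :: "'a::metric_space set"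
  assumes "\<And>b. b \<in> B \<Longrightarrow> \<exists>c\<in>C. dist b c \<le> e"
  shows "semidist B C \<le> ereal e"
  unfolding semidist_def
proof (rule SUP_least)
  fix b assume "b \<in> B"
  then obtain c where "c \<in> C" "dist b c \<le> e" using assms by blast
  then show "(INF c\<in>C. ereal (dist b c)) \<le> ereal e"
    by (intro INF_lower2[of c]) auto
qed

lemma semidist_nonneg:
  assumes "B \<noteq> {}" shows "0 \<le> semidist B C"
proof -
  obtain b where "b \<in> B" using assms by blast
  then show ?thesis
    unfolding semidist_def by (intro SUP_upper2[of b] INF_greatest) auto
qed

lemma semidist_lessD:
  assumes "semidist B C < ereal e" "b \<in> B"
  shows "\<exists>c\<in>C. dist b c < e"
proof -
  have "(INF c\<in>C. ereal (dist b c)) < ereal e"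
    using assms SUP_upper[of b B "\<lambda>b. INF c\<in>C. ereal (dist b c)"] unfolding semidist_def
    by (meson le_less_trans)
  then show ?thesis by (auto simp: INF_less_iff)
qed

text \<open>The nonemptiness matters: a supremum over the empty set is \<open>-\<infinity>\<close>, and such terms would destroy
  the convergence although the right-hand side holds for them vacuously.\<close>

lemma semidist_tendsto_0_iff:
  fixes B :: "nat \<Rightarrow> 'a::metric_space set"
  assumes "\<And>n. B n \<noteq> {}"
  shows "(\<lambda>n. semidist (B n) C) \<longlonglongrightarrow> 0 \<longleftrightarrow>
     (\<forall>e>0. \<forall>\<^sub>F n in sequentially. \<forall>b\<in>B n. \<exists>c\<in>C. dist b c < e)"
proof
  assume L: "(\<lambda>n. semidist (B n) C) \<longlonglongrightarrow> 0"
  show "\<forall>e>0. \<forall>\<^sub>F n in sequentially. \<forall>b\<in>B n. \<exists>c\<in>C. dist b c < e"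
  proof (intro allI impI)
    fix e :: real assume "e > 0"
    then have "\<forall>\<^sub>F n in sequentially. semidist (B n) C < ereal e"
      using order_tendstoD(2)[OF L, of "ereal e"] by simp
    then show "\<forall>\<^sub>F n in sequentially. \<forall>b\<in>B n. \<exists>c\<in>C. dist b c < e"
      by (rule eventually_mono) (blast dest: semidist_lessD)
  qed
next
  assume R: "\<forall>e>0. \<forall>\<^sub>F n in sequentially. \<forall>b\<in>B n. \<exists>c\<in>C. dist b c < e"
  show "(\<lambda>n. semidist (B n) C) \<longlonglongrightarrow> 0"
  proof (rule order_tendstoI)
    fix a :: ereal assume "a < 0"
    then show "\<forall>\<^sub>F n in sequentially. a < semidist (B n) C"
      using semidist_nonneg[OF assms] by (intro always_eventually) (meson less_le_trans)
  next
    fix a :: ereal assume "0 < a"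
    then obtain e where e: "0 < ereal e" "ereal e < a" using ereal_dense2 by blast
    then have "e > 0" by simp
    with R have "\<forall>\<^sub>F n in sequentially. \<forall>b\<in>B n. \<exists>c\<in>C. dist b c < e" by blast
    then show "\<forall>\<^sub>F n in sequentially. semidist (B n) C < a"
    proof (rule eventually_mono)
      fix n assume "\<forall>b\<in>B n. \<exists>c\<in>C. dist b c < e"
      then have "semidist (B n) C \<le> ereal e" by (intro semidist_le) (meson less_imp_le)
      with e show "semidist (B n) C < a" by simp
    qed
  qed
qed

text \<open>An attractor is invariant and bounded, so it is attracted by any other attractor without ever
  moving.\<close>

lemma global_attractor_subset:
  assumes A: "global_attractor X S A" and A': "global_attractor X S A'"
  shows "A \<subseteq> A'"
proof -
  have "A \<noteq> {}" "A \<subseteq> X" "bounded A" and inv: "\<And>n. (S ^^ n) A = A"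
    using A by (auto simp: global_attractor_def compact_imp_bounded)
  then have "(\<lambda>n. semidist ((S ^^ n) A) A') \<longlonglongrightarrow> 0"
    using A' unfolding global_attractor_def by blast
  then have "\<forall>e>0. \<forall>\<^sub>F n in sequentially. \<forall>b\<in>A. \<exists>c\<in>A'. dist b c < e"
    using semidist_tendsto_0_iff[of "\<lambda>_. A" A'] \<open>A \<noteq> {}\<close> by (simp only: inv) blast
  then have "\<forall>b\<in>A. \<forall>e>0. \<exists>c\<in>A'. dist c b < e"
    by (auto simp: dist_commute)
  then have "A \<subseteq> closure A'" by (auto simp: closure_approachable)
  moreover have "closed A'" using A' by (simp add: global_attractor_def compact_imp_closed)
  ultimately show ?thesis by simp
qed

lemma global_attractor_unique:
  "global_attractor X S A \<Longrightarrow> global_attractor X S A' \<Longrightarrow> A = A'"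
  by (meson global_attractor_subset subset_antisym)

text \<open>The closed graph is required only over the compact absorbing set \<open>K\<close>, where the late iterates live.\<close>

locale setvalued_map =
  fixes X :: "'a::metric_space set" and s :: "'a \<Rightarrow> 'a set" and S K
  assumes S_def: "S = (\<lambda>B. \<Union>w\<in>B. s w)"
    and nonempty: "\<And>w. w \<in> X \<Longrightarrow> s w \<noteq> {}"
    and closed_graph: "\<And>w u w0 u0. (\<And>n. w n \<in> K \<and> u n \<in> s (w n)) \<Longrightarrow> w \<longlonglongrightarrow> w0 \<Longrightarrow> u \<longlonglongrightarrow> u0 \<Longrightarrow> u0 \<in> s w0"
    and maps: "\<And>w. w \<in> X \<Longrightarrow> s w \<subseteq> X"
    and K: "compact K" "K \<subseteq> X" "K \<noteq> {}"
    and absorb: "\<And>B. bounded B \<Longrightarrow> B \<subseteq> X \<Longrightarrow> \<forall>\<^sub>F n in sequentially. (S ^^ n) B \<subseteq> K"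
begin

lemma iter_mono: "A \<subseteq> B \<Longrightarrow> (S ^^ n) A \<subseteq> (S ^^ n) B"
  by (induction n arbitrary: A B) (auto simp: S_def)

lemma iter_X: "B \<subseteq> X \<Longrightarrow> (S ^^ n) B \<subseteq> X"
  by (induction n arbitrary: B) (use maps in \<open>auto simp: S_def\<close>, blast)

lemma iter_nonempty: "B \<noteq> {} \<Longrightarrow> B \<subseteq> X \<Longrightarrow> (S ^^ n) B \<noteq> {}"
proof (induction n)
  case (Suc n)
  then obtain y where "y \<in> (S ^^ n) B" "y \<in> X" using iter_X by blast
  then show ?case using nonempty[of y] by (auto simp: S_def)
qed simp

definition tail :: "nat \<Rightarrow> 'a set" where "tail m = closure (\<Union>n\<in>{m..}. (S ^^ n) K)"

definition omega :: "'a set" where "omega = (\<Inter>m. tail m)"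

lemma tail_antimono: "m \<le> n \<Longrightarrow> tail n \<subseteq> tail m"
  unfolding tail_def by (intro closure_mono UN_mono) auto

lemma tail_subset_K: obtains N where "tail N \<subseteq> K" "\<And>n. N \<le> n \<Longrightarrow> (S ^^ n) K \<subseteq> K"
proof -
  obtain N where N: "\<And>n. n \<ge> N \<Longrightarrow> (S ^^ n) K \<subseteq> K"
    using absorb[of K] K by (auto simp: eventually_sequentially compact_imp_bounded)
  then have "tail N \<subseteq> K"
    unfolding tail_def by (intro closure_minimal) (auto simp: K compact_imp_closed)
  with N show ?thesis using that by blast
qed

lemma iter_subset_tail: "m \<le> n \<Longrightarrow> (S ^^ n) K \<subseteq> tail m"
  unfolding tail_def using closure_subset by fastforce

text \<open>If no tail lay in the neighbourhood \<open>U\<close>, the compact sets \<open>tail m - U\<close> would have a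
  common point, which would be a point of \<open>omega\<close> outside \<open>U\<close>.\<close>

lemma tail_in_nbhd:
  assumes "open U" "omega \<subseteq> U"
  obtains m where "tail m \<subseteq> U"
proof -
  obtain N where N: "tail N \<subseteq> K" using tail_subset_K by metis
  have "\<exists>m. tail m \<subseteq> U"
  proof (rule ccontr)
    assume no: "\<not> (\<exists>m. tail m \<subseteq> U)"
    have "K \<inter> (\<Inter>m. tail m - U) \<noteq> {}"
    proof (rule compact_imp_fip_image)
      show "compact K" by (rule K)
      show "closed (tail m - U)" for m using assms(1) by (auto simp: tail_def intro: closed_Diff)
      fix I' :: "nat set" assume "finite I'"
      define M where "M = Max (insert N I')"
      have M: "\<And>i. i \<in> I' \<Longrightarrow> i \<le> M" "N \<le> M" using \<open>finite I'\<close> by (auto simp: M_def)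
      obtain x where "x \<in> tail M" "x \<notin> U" using no by blast
      then have "x \<in> K \<inter> (\<Inter>m\<in>I'. tail m - U)"
        using M N tail_antimono by blast
      then show "K \<inter> (\<Inter>m\<in>I'. tail m - U) \<noteq> {}" by blast
    qed
    then show False using assms(2) by (auto simp: omega_def)
  qed
  then show ?thesis using that by blast
qed

lemma compact_omega: "compact omega" and omega_K: "omega \<subseteq> K"
proof -
  obtain N where N: "tail N \<subseteq> K" using tail_subset_K by metis
  then show "omega \<subseteq> K" by (auto simp: omega_def)
  moreover have "closed omega" by (auto simp: omega_def tail_def)
  ultimately show "compact omega" using K(1) compact_Int_closed[of K omega] by (simp add: inf.absorb2)
qed

lemma omega_nonempty: "omega \<noteq> {}"
proof
  assume "omega = {}"
  then obtain m where "tail m \<subseteq> {}" using tail_in_nbhd[of "{}"] by auto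
  moreover have "(S ^^ m) K \<noteq> {}" by (intro iter_nonempty) (auto simp: K)
  ultimately show False using iter_subset_tail[of m m] by blast
qed

lemma omega_attracts:
  assumes B: "B \<noteq> {}" "B \<subseteq> X" "bounded B"
  shows "(\<lambda>n. semidist ((S ^^ n) B) omega) \<longlonglongrightarrow> 0"
proof (subst semidist_tendsto_0_iff)
  show "(S ^^ n) B \<noteq> {}" for n using iter_nonempty B by blast
  show "\<forall>e>0. \<forall>\<^sub>F n in sequentially. \<forall>b\<in>(S ^^ n) B. \<exists>c\<in>omega. dist b c < e"
  proof (intro allI impI)
    fix e :: real assume "e > 0"
    have "omega \<subseteq> (\<Union>c\<in>omega. ball c e)" using \<open>e > 0\<close> by auto
    then obtain m where m: "tail m \<subseteq> (\<Union>c\<in>omega. ball c e)"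
      by (rule tail_in_nbhd[rotated]) auto
    obtain N where N: "(S ^^ N) B \<subseteq> K"
      using absorb[of B] B unfolding eventually_sequentially by blast
    have "(S ^^ n) B \<subseteq> tail m" if "n \<ge> N + m" for n
    proof -
      have "(S ^^ n) B = (S ^^ (n - N)) ((S ^^ N) B)"
        using that by (metis add.commute add_leD1 comp_apply funpow_add le_add_diff_inverse)
      also have "\<dots> \<subseteq> (S ^^ (n - N)) K" by (rule iter_mono[OF N])
      also have "\<dots> \<subseteq> tail m" using that by (intro iter_subset_tail) simp
      finally show ?thesis .
    qed
    then have "\<forall>n\<ge>N + m. \<forall>b\<in>(S ^^ n) B. \<exists>c\<in>omega. dist b c < e"
      using m by (fastforce simp: dist_commute)
    then show "\<forall>\<^sub>F n in sequentially. \<forall>b\<in>(S ^^ n) B. \<exists>c\<in>omega. dist b c < e"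
      unfolding eventually_sequentially by blast
  qed
qed

text \<open>A point of \<open>omega\<close> is a limit of \<open>x\<^sub>j \<in> s y\<^sub>j\<close> with \<open>y\<^sub>j\<close> in late iterates of \<open>K\<close>. By
  compactness the \<open>y\<^sub>j\<close> cluster at some \<open>y \<in> omega\<close>, and the closed graph gives \<open>x \<in> s y\<close>.\<close>

lemma omega_subset_S: "omega \<subseteq> S omega"
proof
  fix x assume x: "x \<in> omega"
  obtain N where N: "\<And>n. n \<ge> N \<Longrightarrow> (S ^^ n) K \<subseteq> K" using tail_subset_K by metis
  \<comment> \<open>The offset \<open>N\<close> keeps all \<open>y\<close> in \<open>K\<close>.\<close>
  have "\<exists>n y z. n \<ge> N + j \<and> y \<in> (S ^^ n) K \<and> z \<in> s y \<and> dist z x < inverse (Suc j)" for j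
  proof -
    have "x \<in> closure (\<Union>n\<in>{Suc (N + j)..}. (S ^^ n) K)"
      using x by (auto simp: omega_def tail_def)
    then obtain z n where "n \<ge> Suc (N + j)" "z \<in> (S ^^ n) K" "dist z x < inverse (Suc j)"
      by (auto simp: closure_approachable dest!: spec[of _ "inverse (real (Suc j))"])
    moreover then have "z \<in> S ((S ^^ (n - 1)) K)" by (cases n) auto
    ultimately show ?thesis
      by (intro exI[of _ "n - 1"]) (auto simp: S_def)
  qed
  then obtain n y z where nyz: "\<And>j. n j \<ge> N + j" "\<And>j. y j \<in> (S ^^ n j) K"
    "\<And>j. z j \<in> s (y j)" "\<And>j. dist (z j) x < inverse (Suc j)"
    by metis
  have yK: "y j \<in> K" for j using nyz(1,2)[of j] N[of "n j"] by auto
  then obtain y0 r where r: "strict_mono r" and y0: "(y \<circ> r) \<longlonglongrightarrow> y0"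
    using K(1) unfolding compact_def by blast
  have z: "z \<longlonglongrightarrow> x"
    by (rule metric_tendsto_imp_tendsto[OF LIMSEQ_inverse_real_of_nat])
       (use nyz(4) in \<open>auto intro!: always_eventually simp: less_imp_le\<close>)
  have "x \<in> s y0"
    by (rule closed_graph[of "y \<circ> r" "z \<circ> r"])
       (use yK nyz(3) y0 LIMSEQ_subseq_LIMSEQ[OF z r] in auto)
  moreover have "y0 \<in> tail m" for m
  proof (rule closed_sequentially[where f = "\<lambda>j. (y \<circ> r) (j + m)"])
    show "closed (tail m)" by (simp add: tail_def)
    show "(\<lambda>j. (y \<circ> r) (j + m)) \<longlonglongrightarrow> y0" by (rule LIMSEQ_ignore_initial_segment[OF y0])
    fix j
    have "m \<le> n (r (j + m))"
      using nyz(1)[of "r (j + m)"] seq_suble[OF r, of "j + m"] by linarith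
    then show "(y \<circ> r) (j + m) \<in> tail m"
      using nyz(2)[of "r (j + m)"] iter_subset_tail[of m "n (r (j + m))"] by auto
  qed
  ultimately have "y0 \<in> omega" "x \<in> s y0" by (auto simp: omega_def)
  then show "x \<in> S omega" unfolding S_def by blast
qed

text \<open>Since \<open>omega\<close> lies in each of its iterates, \<open>S omega\<close> lies in all later iterates, which
  approach \<open>omega\<close>. A closed graph alone would not give this inclusion.\<close>

lemma S_omega_subset: "S omega \<subseteq> omega"
proof -
  have sub: "omega \<subseteq> (S ^^ n) omega" for n
  proof (induction n)
    case (Suc n)
    have "omega \<subseteq> S omega" by (rule omega_subset_S)
    also have "\<dots> \<subseteq> S ((S ^^ n) omega)" using Suc iter_mono[of _ _ 1] by simp
    finally show ?case by simp
  qed simp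
  have X: "omega \<subseteq> X" using omega_K K by blast
  have "(\<lambda>n. semidist ((S ^^ n) omega) omega) \<longlonglongrightarrow> 0"
    by (intro omega_attracts omega_nonempty X compact_imp_bounded compact_omega)
  then have *: "\<forall>e>0. \<forall>\<^sub>F n in sequentially. \<forall>b\<in>(S ^^ n) omega. \<exists>c\<in>omega. dist b c < e"
    using semidist_tendsto_0_iff[of "\<lambda>n. (S ^^ n) omega" omega] iter_nonempty[OF omega_nonempty X]
    by blast
  have "\<exists>c\<in>omega. dist c b < e" if b: "b \<in> S omega" and "e > 0" for b e
  proof -
    obtain n where n: "\<And>m. m \<ge> n \<Longrightarrow> \<forall>b\<in>(S ^^ m) omega. \<exists>c\<in>omega. dist b c < e"
      using * \<open>e > 0\<close> unfolding eventually_sequentially by meson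
    have "S omega \<subseteq> S ((S ^^ n) omega)" using sub[of n] iter_mono[of _ _ 1] by simp
    then have "b \<in> (S ^^ Suc n) omega" using b by auto
    then show ?thesis using n[of "Suc n"] by (metis dist_commute le_SucI order_refl)
  qed
  then have "S omega \<subseteq> closure omega" by (auto simp: closure_approachable)
  then show ?thesis using compact_omega by (simp add: compact_imp_closed)
qed

theorem global_attractor_omega: "global_attractor X S omega"
proof -
  have "S omega = omega" using omega_subset_S S_omega_subset by blast
  then have "(S ^^ n) omega = omega" for n by (induction n) auto
  then show ?thesis
    using omega_nonempty omega_K K compact_omega omega_attracts by (auto simp: global_attractor_def)
qed

end

section \<open>Zeros of maps on cubes\<close>

text \<open>Tychonoff's theorem; the product topology on \<open>nat \<Rightarrow> real\<close> is metrizable, so compactness yields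
  subsequences.\<close>

lemma bounded_coordinates_subseq:
  fixes x :: "nat \<Rightarrow> nat \<Rightarrow> real"
  assumes "\<And>m i. \<bar>x m i\<bar> \<le> B i"
  obtains r l where "strict_mono (r :: nat \<Rightarrow> nat)" "\<And>i. (\<lambda>m. x (r m) i) \<longlonglongrightarrow> l i"
proof -
  let ?C = "PiE UNIV (\<lambda>i. {- B i..B i})"
  have "compactin (product_topology (\<lambda>i. euclidean) UNIV) ?C"
    by (simp add: compactin_PiE)
  then have "compact ?C" by (simp add: euclidean_product_topology)
  moreover have "x m \<in> ?C" for m
    using assms[of m] by (auto simp: abs_le_iff PiE_iff) (smt (verit) assms)
  ultimately obtain l r where r: "strict_mono r" "(x \<circ> r) \<longlonglongrightarrow> l"
    unfolding compact_def by metis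
  have "(\<lambda>m. x (r m) i) \<longlonglongrightarrow> l i" for i
  proof -
    have "isCont (\<lambda>f :: nat \<Rightarrow> real. f i) l"
      using continuous_on_product_coordinates[of i] continuous_on_eq_continuous_at[OF open_UNIV]
      by blast
    from isCont_tendsto_compose[OF this r(2)] show ?thesis by (simp add: o_def)
  qed
  with r show ?thesis using that by blast
qed

text \<open>A grid point is labelled by the sign of \<open>P i\<close>, except on the faces of the cube, where
  Kuhn's lemma prescribes the label. The two truncations by \<open>min\<close> and \<open>max\<close> express
  the labels by conditions that are closed under limits.\<close>

lemma kuhn_grid:
  fixes P :: "nat \<Rightarrow> (nat \<Rightarrow> real) \<Rightarrow> real" and R :: real
  assumes R: "R > 0" and p: "p > 0"
  shows "\<exists>c a b. (\<forall>i. \<bar>c i\<bar> \<le> R) \<and> (\<forall>i\<ge>n. c i = 0) \<and> (\<forall>i<n.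
     (\<forall>j. \<bar>a i j - c j\<bar> \<le> 2 * R / real p) \<and> (\<forall>j. \<bar>b i j - c j\<bar> \<le> 2 * R / real p) \<and>
     min (a i i + R) (P i (a i)) \<le> 0 \<and> max (b i i - R) (P i (b i)) \<ge> 0)"
proof -
  define g :: "(nat \<Rightarrow> nat) \<Rightarrow> nat \<Rightarrow> real"
    where "g x i = (if i < n then - R + 2 * R * x i / p else 0)" for x i
  define label :: "(nat \<Rightarrow> nat) \<Rightarrow> nat \<Rightarrow> nat"
    where "label x i = (if x i = 0 \<or> x i < p \<and> P i (g x) \<le> 0 then 0 else 1)" for x i
  obtain q where q: "\<forall>i<n. q i < p"
    and rs: "\<forall>i<n. \<exists>r s. (\<forall>j<n. q j \<le> r j \<and> r j \<le> q j + 1) \<and>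
        (\<forall>j<n. q j \<le> s j \<and> s j \<le> q j + 1) \<and> label r i \<noteq> label s i"
    by (rule kuhn_lemma[of p n label]) (use p in \<open>auto simp: label_def\<close>)
  have near: "\<bar>g r j - g q j\<bar> \<le> 2 * R / p" if cell: "\<forall>j<n. q j \<le> r j \<and> r j \<le> q j + 1" for r j
  proof -
    have "\<bar>2 * R * r j / p - 2 * R * q j / p\<bar> = 2 * R / p * (real (r j) - q j)" if "j < n"
      using cell that R p by (simp add: field_simps abs_of_nonneg)
    also have "\<dots> \<le> 2 * R / p * 1" if "j < n"
    proof (intro mult_left_mono)
      show "real (r j) - real (q j) \<le> 1" using cell that by force
    qed (use R in simp)
    finally show ?thesis using R by (simp add: g_def)
  qed
  have "\<exists>a b. (\<forall>j. \<bar>a j - g q j\<bar> \<le> 2 * R / p) \<and> (\<forall>j. \<bar>b j - g q j\<bar> \<le> 2 * R / p) \<and>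
     min (a i + R) (P i a) \<le> 0 \<and> max (b i - R) (P i b) \<ge> 0" if "i < n" for i
  proof -
    obtain r s where r: "\<forall>j<n. q j \<le> r j \<and> r j \<le> q j + 1" "label r i = 0"
      and s: "\<forall>j<n. q j \<le> s j \<and> s j \<le> q j + 1" "label s i \<noteq> 0"
    proof -
      obtain r s where *: "\<forall>j<n. q j \<le> r j \<and> r j \<le> q j + 1"
        "\<forall>j<n. q j \<le> s j \<and> s j \<le> q j + 1" "label r i \<noteq> label s i"
        using rs \<open>i < n\<close> by blast
      then have "label r i = 0 \<and> label s i \<noteq> 0 \<or> label s i = 0 \<and> label r i \<noteq> 0"
        by (auto simp: label_def split: if_splits)
      with * that show ?thesis by blast
    qed
    have "min (g r i + R) (P i (g r)) \<le> 0"
      using r(2) that by (auto simp: label_def g_def split: if_splits)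
    moreover have "max (g s i - R) (P i (g s)) \<ge> 0"
    proof (cases "s i < p")
      case True
      then show ?thesis using s(2) by (auto simp: label_def split: if_splits)
    next
      case False
      then have "2 * R * s i / p \<ge> 2 * R" using R p by (simp add: field_simps)
      then show ?thesis using that by (simp add: g_def)
    qed
    ultimately show ?thesis using near[OF r(1)] near[OF s(1)] by blast
  qed
  then obtain a b where ab: "\<And>i. i < n \<Longrightarrow> (\<forall>j. \<bar>a i j - g q j\<bar> \<le> 2 * R / p) \<and> (\<forall>j. \<bar>b i j - g q j\<bar> \<le> 2 * R / p) \<and>
     min (a i i + R) (P i (a i)) \<le> 0 \<and> max (b i i - R) (P i (b i)) \<ge> 0"
    by metis
  have "\<bar>g q i\<bar> \<le> R" for i
  proof -
    have "0 \<le> 2 * R * q i / p \<and> 2 * R * q i / p \<le> 2 * R" if "i < n"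
      using q that R p by (auto simp: field_simps less_imp_le)
    then show ?thesis using R by (auto simp: g_def abs_le_iff)
  qed
  then show ?thesis using ab
    by (intro exI[of _ "g q"] exI[of _ a] exI[of _ b]) (auto simp: g_def)
qed

text \<open>Refining the grid gives a point \<open>c\<close> such that each \<open>P i c\<close> vanishes or has, on a face,
  the sign opposite to \<open>c i\<close>; so \<open>\<Sum>i. P i c * c i \<le> 0\<close>, which excludes the faces.\<close>

lemma zero_in_cube:
  fixes P :: "nat \<Rightarrow> (nat \<Rightarrow> real) \<Rightarrow> real"
  assumes R: "R > 0"
    and cont: "\<And>i x l. (\<And>j. (\<lambda>m. x m j) \<longlonglongrightarrow> l j) \<Longrightarrow> (\<lambda>m. P i (x m)) \<longlonglongrightarrow> P i l"
    and pos: "\<And>c. (\<exists>i<n. \<bar>c i\<bar> = R) \<Longrightarrow> (\<Sum>i<n. P i c * c i) > 0"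
  obtains c where "\<And>i. i < n \<Longrightarrow> P i c = 0"
proof -
  have "\<forall>m. \<exists>c a b. (\<forall>i. \<bar>c i\<bar> \<le> R) \<and> (\<forall>i\<ge>n. c i = 0) \<and> (\<forall>i<n.
     (\<forall>j. \<bar>a i j - c j\<bar> \<le> 2 * R / real (Suc m)) \<and> (\<forall>j. \<bar>b i j - c j\<bar> \<le> 2 * R / real (Suc m)) \<and>
     min (a i i + R) (P i (a i)) \<le> 0 \<and> max (b i i - R) (P i (b i)) \<ge> 0)"
    using kuhn_grid[OF R] by blast
  then obtain c a b where c: "\<And>m i. \<bar>c m i\<bar> \<le> R"
    and a: "\<And>m i j. i < n \<Longrightarrow> \<bar>a m i j - c m j\<bar> \<le> 2 * R / real (Suc m)"
    and b: "\<And>m i j. i < n \<Longrightarrow> \<bar>b m i j - c m j\<bar> \<le> 2 * R / real (Suc m)"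
    and lab: "\<And>m i. i < n \<Longrightarrow> min (a m i i + R) (P i (a m i)) \<le> 0"
      "\<And>m i. i < n \<Longrightarrow> max (b m i i - R) (P i (b m i)) \<ge> 0"
    by metis
  obtain r l where r: "strict_mono r" and l: "\<And>i. (\<lambda>m. c (r m) i) \<longlonglongrightarrow> l i"
    using bounded_coordinates_subseq[of c "\<lambda>_. R"] c by blast
  have mesh: "(\<lambda>m. 2 * R / real (Suc (r m))) \<longlonglongrightarrow> 0"
    using LIMSEQ_subseq_LIMSEQ[OF tendsto_mult_right_zero[OF LIMSEQ_inverse_real_of_nat, of "2 * R"] r]
    by (simp add: o_def divide_inverse)
  have lim: "(\<lambda>m. y (r m) j) \<longlonglongrightarrow> l j" if "\<And>m. \<bar>y m j - c m j\<bar> \<le> 2 * R / real (Suc m)" for y j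
  proof -
    have "(\<lambda>m. y (r m) j - c (r m) j) \<longlonglongrightarrow> 0"
      by (rule Lim_null_comparison[OF _ mesh]) (use that in auto)
    from tendsto_add[OF this l[of j]] show ?thesis by simp
  qed
  have lim_a: "(\<lambda>m. a (r m) i j) \<longlonglongrightarrow> l j" if "i < n" for i j
    using lim[of "\<lambda>m. a m i"] a that by blast
  have lim_b: "(\<lambda>m. b (r m) i j) \<longlonglongrightarrow> l j" if "i < n" for i j
    using lim[of "\<lambda>m. b m i"] b that by blast
  have sign: "min (l i + R) (P i l) \<le> 0 \<and> max (l i - R) (P i l) \<ge> 0" if "i < n" for i
  proof
    have "(\<lambda>m. min (a (r m) i i + R) (P i (a (r m) i))) \<longlonglongrightarrow> min (l i + R) (P i l)"
      by (intro tendsto_intros cont lim_a that)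
    then show "min (l i + R) (P i l) \<le> 0" by (rule LIMSEQ_le_const2) (use lab that in auto)
    have "(\<lambda>m. max (b (r m) i i - R) (P i (b (r m) i))) \<longlonglongrightarrow> max (l i - R) (P i l)"
      by (intro tendsto_intros cont lim_b that)
    then show "max (l i - R) (P i l) \<ge> 0" by (rule LIMSEQ_le_const) (use lab that in auto)
  qed
  have lR: "\<bar>l i\<bar> \<le> R" for i
    using tendsto_rabs[OF l[of i]] by (rule LIMSEQ_le_const2) (use c in auto)
  have "P i l * l i \<le> 0" if "i < n" for i
    using sign[OF that] lR[of i] R by (auto simp: min_def max_def mult_le_0_iff split: if_splits)
  then have nonpos: "(\<Sum>i<n. P i l * l i) \<le> 0" by (intro sum_nonpos) auto
  have interior: "\<not> (\<exists>i<n. \<bar>l i\<bar> = R)"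
  proof
    assume "\<exists>i<n. \<bar>l i\<bar> = R"
    from pos[OF this] nonpos show False by simp
  qed
  have "P i l = 0" if "i < n" for i
  proof -
    have "\<bar>l i\<bar> < R" using interior that lR[of i] by force
    then show ?thesis using sign[OF that] by (auto simp: min_def max_def split: if_splits)
  qed
  then show ?thesis using that by blast
qed

section \<open>Closed convex sets in Hilbert spaces\<close>

text \<open>Points \<open>x\<^sub>m \<in> C m\<close> of almost minimal norm form a Cauchy sequence: the minimal norms
  increase to a limit, and midpoints cannot have much smaller norm (parallelogram law).\<close>

lemma nested_convex_nonempty:
  fixes C :: "nat \<Rightarrow> 'a::{real_inner, complete_space} set"
  assumes closed: "\<And>m. closed (C m)" and convex: "\<And>m. convex (C m)"
    and nonempty: "\<And>m. C m \<noteq> {}" and bounded: "bounded (C 0)"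
    and nested: "\<And>m n. m \<le> n \<Longrightarrow> C n \<subseteq> C m"
  shows "(\<Inter>m. C m) \<noteq> {}"
proof -
  define d where "d m = Inf (norm ` C m)" for m
  obtain B where B: "\<And>x. x \<in> C 0 \<Longrightarrow> norm x \<le> B"
    using bounded by (auto simp: bounded_iff)
  have bdd: "bdd_below (norm ` C m)" for m by (rule bdd_belowI[of _ 0]) auto
  have d_le: "d m \<le> norm x" if "x \<in> C m" for m x
    unfolding d_def using that bdd by (intro cInf_lower) auto
  have d_ge0: "0 \<le> d m" for m
    unfolding d_def using nonempty by (intro cInf_greatest) auto
  have d_mono: "d m \<le> d n" if "m \<le> n" for m n
    unfolding d_def using nested[OF that] nonempty bdd by (intro cInf_superset_mono) auto
  have d_le_B: "d m \<le> B" for m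
  proof -
    obtain x where "x \<in> C m" using nonempty by blast
    then show ?thesis using d_le[of x m] B[of x] nested[of 0 m] by auto
  qed
  have "\<exists>x. x \<in> C m \<and> norm x < d m + inverse (Suc m)" for m
  proof -
    have "Inf (norm ` C m) < d m + inverse (Suc m)" by (simp add: d_def)
    then show ?thesis using cInf_lessD[of "norm ` C m"] nonempty by blast
  qed
  then obtain x where x: "\<And>m. x m \<in> C m" "\<And>m. norm (x m) < d m + inverse (Suc m)" by metis
  have "incseq d" by (simp add: incseq_def d_mono)
  then obtain d0 where d0: "d \<longlonglongrightarrow> d0" using incseq_convergent[of d B] d_le_B by blast
  have d_le_d0: "d m \<le> d0" for m by (rule incseq_le[OF \<open>incseq d\<close> d0])
  define \<delta> where "\<delta> m = 4 * ((d0 + inverse (Suc m))\<^sup>2 - (d m)\<^sup>2)" for m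
  have "\<delta> \<longlonglongrightarrow> 4 * ((d0 + 0)\<^sup>2 - d0\<^sup>2)"
    unfolding \<delta>_def by (intro tendsto_intros LIMSEQ_inverse_real_of_nat d0)
  then have \<delta>: "\<delta> \<longlonglongrightarrow> 0" by simp
  have close: "(norm (x m - x n))\<^sup>2 \<le> \<delta> m" if "m \<le> n" for m n
  proof -
    have mid: "(1/2) *\<^sub>R x m + (1/2) *\<^sub>R x n \<in> C m"
      using x(1)[of n] nested[OF that] by (intro convexD[OF convex x(1)]) auto
    have "2 * d m \<le> norm (x m + x n)"
    proof -
      have "norm ((1/2) *\<^sub>R x m + (1/2) *\<^sub>R x n) = norm ((1/2) *\<^sub>R (x m + x n))"
        by (simp only: scaleR_add_right)
      then show ?thesis using d_le[OF mid] by simp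
    qed
    then have low: "(2 * d m)\<^sup>2 \<le> (norm (x m + x n))\<^sup>2"
      using d_ge0[of m] by (intro power_mono) auto
    have id: "(norm (x m - x n))\<^sup>2 = 2 * (norm (x m))\<^sup>2 + 2 * (norm (x n))\<^sup>2 - (norm (x m + x n))\<^sup>2"
      by (simp add: power2_norm_eq_inner inner_add_left inner_add_right inner_diff_left inner_diff_right
          inner_commute[of "x n" "x m"])
    have "(norm (x j))\<^sup>2 \<le> (d0 + inverse (Suc m))\<^sup>2" if "m \<le> j" for j
    proof (rule power_mono)
      have "inverse (Suc j) \<le> inverse (real (Suc m))" using that by simp
      then show "norm (x j) \<le> d0 + inverse (Suc m)" using x(2)[of j] d_le_d0[of j] by linarith
    qed simp
    from this[of m] this[of n] low id \<open>m \<le> n\<close> show ?thesis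
      by (simp add: \<delta>_def power_mult_distrib)
  qed
  have "Cauchy x"
  proof (rule metric_CauchyI)
    fix e :: real assume "0 < e"
    then have "\<forall>\<^sub>F m in sequentially. \<delta> m < (e/2)\<^sup>2" using order_tendstoD(2)[OF \<delta>, of "(e/2)\<^sup>2"] by simp
    then obtain M where M: "\<delta> M < (e/2)\<^sup>2" using eventually_happens'[OF sequentially_bot] by blast
    have *: "dist (x M) (x n) < e/2" if "M \<le> n" for n
    proof -
      have "(norm (x M - x n))\<^sup>2 < (e/2)\<^sup>2" using close[OF that] M by linarith
      then show ?thesis unfolding dist_norm by (rule power2_less_imp_less) (use \<open>0 < e\<close> in simp)
    qed
    have "dist (x i) (x j) < e" if "M \<le> i" "M \<le> j" for i j
      by (rule dist_triangle_half_r[OF *[OF that(1)] *[OF that(2)]])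
    then show "\<exists>M. \<forall>m\<ge>M. \<forall>n\<ge>M. dist (x m) (x n) < e" by blast
  qed
  then obtain l where l: "x \<longlonglongrightarrow> l" by (auto simp: Cauchy_convergent_iff convergent_def)
  have "l \<in> C m" for m
  proof (rule closed_sequentially[OF closed])
    show "x (n + m) \<in> C m" for n using x(1)[of "n + m"] nested[of m "n + m"] by auto
    show "(\<lambda>n. x (n + m)) \<longlonglongrightarrow> l" by (rule LIMSEQ_ignore_initial_segment[OF l])
  qed
  then show ?thesis by blast
qed

text \<open>This takes the role of weak compactness. The parts of \<open>C\<close> over small balls around a limit point
  of the projection are nested bounded closed convex sets, and a common point lies over that limit.\<close>

lemma closed_fst_image:
  fixes C :: "('a::{real_inner, complete_space} \<times> 'b::{real_inner, complete_space}) set"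
  assumes "closed C" "convex C" "bounded C"
  shows "closed (fst ` C)"
proof (rule closure_subset_eq[THEN iffD1], rule subsetI)
  fix y assume y: "y \<in> closure (fst ` C)"
  define F where "F m = C \<inter> cball y (inverse (Suc m)) \<times> UNIV" for m :: nat
  have "(\<Inter>m. F m) \<noteq> {}"
  proof (rule nested_convex_nonempty)
    show "closed (F m)" for m using assms by (auto simp: F_def intro!: closed_Int closed_Times)
    show "convex (F m)" for m using assms by (auto simp: F_def intro!: convex_Int convex_Times)
    show "F m \<noteq> {}" for m
    proof -
      obtain c where "c \<in> C" "dist (fst c) y < inverse (Suc m)"
        using y by (auto simp: closure_approachable dest!: spec[of _ "inverse (real (Suc m))"])
      then have "c \<in> F m" by (cases c) (auto simp: F_def dist_commute less_imp_le)
      then show ?thesis by blast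
    qed
    show "bounded (F 0)" using assms by (auto simp: F_def intro: bounded_subset)
    show "F n \<subseteq> F m" if "m \<le> n" for m n
    proof -
      have "inverse (real (Suc n)) \<le> inverse (real (Suc m))" using that by simp
      then show ?thesis unfolding F_def by (intro Int_mono Sigma_mono subset_cball) auto
    qed
  qed
  then obtain c where c: "\<And>m. c \<in> F m" by blast
  have "(\<lambda>m. inverse (real (Suc m))) \<longlonglongrightarrow> 0" by (rule LIMSEQ_inverse_real_of_nat)
  then have "dist y (fst c) \<le> 0"
    by (rule LIMSEQ_le_const) (use c in \<open>auto simp: F_def mem_Times_iff\<close>)
  then show "y \<in> fst ` C" using c[of 0] by (auto simp: F_def)
qed

section \<open>The abstract stationary problem\<close>

text \<open>\<open>V0\<close> is the set of smooth fields, \<open>V\<close> its closure in the energy norm, \<open>D\<close> the gradient and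
  \<open>b\<close> the inertial form. The inequality \<open>friedrichs\<close> carries the compactness of the embedding;
  \<open>adjoint\<close> and \<open>b_regular\<close> say that derivatives can be moved onto a smooth field.\<close>

locale energy_space =
  fixes V V0 :: "'a::{real_inner, complete_space} set"
    and D :: "'a \<Rightarrow> 'b::{real_inner, complete_space}"
    and b :: "'a \<Rightarrow> 'a \<Rightarrow> 'a \<Rightarrow> real" and cp L :: real
  assumes subspace: "subspace V"
    and D_add: "u \<in> V \<Longrightarrow> v \<in> V \<Longrightarrow> D (u + v) = D u + D v"
    and D_scale: "u \<in> V \<Longrightarrow> D (c *\<^sub>R u) = c *\<^sub>R D u"
    and closed_D: "closed ((\<lambda>u. (u, D u)) ` V)"
    and cp: "cp > 0"
    and poincare: "u \<in> V \<Longrightarrow> norm u \<le> cp * norm (D u)"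
    and friedrichs: "\<epsilon> > 0 \<Longrightarrow> \<exists>G. finite G \<and> (\<forall>u\<in>V. (norm u)\<^sup>2 \<le> \<epsilon> * (norm (D u))\<^sup>2 + (\<Sum>g\<in>G. (u \<bullet> g)\<^sup>2))"
    and V0: "V0 \<subseteq> V"
    and dense: "v \<in> V \<Longrightarrow> \<epsilon> > 0 \<Longrightarrow> \<exists>\<phi>\<in>V0. norm (D (v - \<phi>)) < \<epsilon>"
    and b_add1: "\<lbrakk>u \<in> V; u' \<in> V; v \<in> V; w \<in> V\<rbrakk> \<Longrightarrow> b (u + u') v w = b u v w + b u' v w"
    and b_add2: "\<lbrakk>u \<in> V; v \<in> V; v' \<in> V; w \<in> V\<rbrakk> \<Longrightarrow> b u (v + v') w = b u v w + b u v' w"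
    and b_add3: "\<lbrakk>u \<in> V; v \<in> V; w \<in> V; w' \<in> V\<rbrakk> \<Longrightarrow> b u v (w + w') = b u v w + b u v w'"
    and b_scale1: "\<lbrakk>u \<in> V; v \<in> V; w \<in> V\<rbrakk> \<Longrightarrow> b (c *\<^sub>R u) v w = c * b u v w"
    and b_scale2: "\<lbrakk>u \<in> V; v \<in> V; w \<in> V\<rbrakk> \<Longrightarrow> b u (c *\<^sub>R v) w = c * b u v w"
    and b_scale3: "\<lbrakk>u \<in> V; v \<in> V; w \<in> V\<rbrakk> \<Longrightarrow> b u v (c *\<^sub>R w) = c * b u v w"
    and b_bound: "\<lbrakk>u \<in> V; v \<in> V; w \<in> V\<rbrakk> \<Longrightarrow> \<bar>b u v w\<bar> \<le> L * norm (D u) * norm (D v) * norm (D w)"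
    and b_skew0: "\<lbrakk>u \<in> V0; v \<in> V0; w \<in> V0\<rbrakk> \<Longrightarrow> b u v w = - b u w v"
    and adjoint: "\<phi> \<in> V0 \<Longrightarrow> \<exists>g. \<forall>u\<in>V. D u \<bullet> D \<phi> = u \<bullet> g"
    and b_regular: "\<phi> \<in> V0 \<Longrightarrow> \<exists>M. \<forall>u\<in>V. \<forall>w\<in>V. \<bar>b u \<phi> w\<bar> \<le> M * norm u * norm w"
begin

lemmas V_add = subspace_add[OF subspace] and V_diff = subspace_diff[OF subspace]
  and V_scale = subspace_scale[OF subspace] and V_0 = subspace_0[OF subspace]
  and V_sum = subspace_sum[OF subspace]

lemma D_diff: "u \<in> V \<Longrightarrow> v \<in> V \<Longrightarrow> D (u - v) = D u - D v"
  using D_add[of u "-1 *\<^sub>R v"] D_scale[of v "-1"] V_scale[of v "-1"] by simp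

lemma D_0: "D 0 = 0" using D_scale[of 0 0] V_0 by simp

lemma b_diff1: "\<lbrakk>u \<in> V; u' \<in> V; v \<in> V; w \<in> V\<rbrakk> \<Longrightarrow> b (u - u') v w = b u v w - b u' v w"
  using b_add1[of "u - u'" u' v w] V_diff by simp
lemma b_diff2: "\<lbrakk>u \<in> V; v \<in> V; v' \<in> V; w \<in> V\<rbrakk> \<Longrightarrow> b u (v - v') w = b u v w - b u v' w"
  using b_add2[of u "v - v'" v' w] V_diff by simp
lemma b_diff3: "\<lbrakk>u \<in> V; v \<in> V; w \<in> V; w' \<in> V\<rbrakk> \<Longrightarrow> b u v (w - w') = b u v w - b u v w'"
  using b_add3[of u v "w - w'" w'] V_diff by simp

lemma D_sum: "(\<And>i. i \<in> I \<Longrightarrow> u i \<in> V) \<Longrightarrow> D (\<Sum>i\<in>I. u i) = (\<Sum>i\<in>I. D (u i))"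
  by (induction I rule: infinite_finite_induct) (auto simp: D_0 D_add V_sum)

lemma b_0: "u \<in> V \<Longrightarrow> v \<in> V \<Longrightarrow> b 0 u v = 0 \<and> b u 0 v = 0 \<and> b u v 0 = 0"
  using b_scale1[of u u v 0] b_scale2[of u u v 0] b_scale3[of u v u 0] by auto

lemma b_sum1: "(\<And>i. i \<in> I \<Longrightarrow> u i \<in> V) \<Longrightarrow> v \<in> V \<Longrightarrow> w \<in> V \<Longrightarrow> b (\<Sum>i\<in>I. u i) v w = (\<Sum>i\<in>I. b (u i) v w)"
  by (induction I rule: infinite_finite_induct) (auto simp: b_0 b_add1 V_sum)
lemma b_sum2: "(\<And>i. i \<in> I \<Longrightarrow> v i \<in> V) \<Longrightarrow> u \<in> V \<Longrightarrow> w \<in> V \<Longrightarrow> b u (\<Sum>i\<in>I. v i) w = (\<Sum>i\<in>I. b u (v i) w)"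
  by (induction I rule: infinite_finite_induct) (auto simp: b_0 b_add2 V_sum)
lemma b_sum3: "(\<And>i. i \<in> I \<Longrightarrow> w i \<in> V) \<Longrightarrow> u \<in> V \<Longrightarrow> v \<in> V \<Longrightarrow> b u v (\<Sum>i\<in>I. w i) = (\<Sum>i\<in>I. b u v (w i))"
  by (induction I rule: infinite_finite_induct) (auto simp: b_0 b_add3 V_sum)

text \<open>Convergence of gradients is the convergence that matters, since Poincare's inequality and the
  bounds on \<open>b\<close> are stated in terms of them.\<close>

lemma smooth_sequence:
  assumes "v \<in> V"
  obtains \<phi> where "\<And>n. \<phi> n \<in> V0" "(\<lambda>n. D (\<phi> n)) \<longlonglongrightarrow> D v"
proof -
  have "\<forall>n. \<exists>\<phi>\<in>V0. norm (D (v - \<phi>)) < inverse (real (Suc n))" using dense[OF assms] by simp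
  then obtain \<phi> where \<phi>: "\<And>n. \<phi> n \<in> V0" "\<And>n. norm (D (v - \<phi> n)) < inverse (real (Suc n))" by metis
  have "(\<lambda>n. D (\<phi> n) - D v) \<longlonglongrightarrow> 0"
  proof (rule Lim_null_comparison[OF _ LIMSEQ_inverse_real_of_nat], intro always_eventually allI)
    fix n show "norm (D (\<phi> n) - D v) \<le> inverse (real (Suc n))"
    proof -
      have "\<phi> n \<in> V" using \<phi>(1)[of n] V0 by blast
      then show ?thesis using \<phi>(2)[of n] by (simp only: D_diff[OF assms] norm_minus_commute[of "D (\<phi> n)"])
    qed
  qed
  from that[OF \<phi>(1) LIM_zero_cancel[OF this]] show ?thesis .
qed

lemma b_tendsto:
  assumes V: "\<And>n. u n \<in> V" "\<And>n. v n \<in> V" "\<And>n. w n \<in> V" "u0 \<in> V" "v0 \<in> V" "w0 \<in> V"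
    and lim: "(\<lambda>n. D (u n)) \<longlonglongrightarrow> D u0" "(\<lambda>n. D (v n)) \<longlonglongrightarrow> D v0" "(\<lambda>n. D (w n)) \<longlonglongrightarrow> D w0"
  shows "(\<lambda>n. b (u n) (v n) (w n)) \<longlonglongrightarrow> b u0 v0 w0"
proof -
  let ?e = "\<lambda>n. L * norm (D (u n) - D u0) * norm (D (v n)) * norm (D (w n))
     + L * norm (D u0) * norm (D (v n) - D v0) * norm (D (w n))
     + L * norm (D u0) * norm (D v0) * norm (D (w n) - D w0)"
  have "?e \<longlonglongrightarrow> L * norm (D u0 - D u0) * norm (D v0) * norm (D w0)
     + L * norm (D u0) * norm (D v0 - D v0) * norm (D w0)
     + L * norm (D u0) * norm (D v0) * norm (D w0 - D w0)"
    by (intro tendsto_intros lim)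
  then have e: "?e \<longlonglongrightarrow> 0" by simp
  have "norm (b (u n) (v n) (w n) - b u0 v0 w0) \<le> ?e n" for n
  proof -
    have eq: "b (u n) (v n) (w n) - b u0 v0 w0 = b (u n - u0) (v n) (w n) + b u0 (v n - v0) (w n)
        + b u0 v0 (w n - w0)"
      using V by (simp add: b_diff1 b_diff2 b_diff3)
    show ?thesis
      unfolding eq
      using b_bound[of "u n - u0" "v n" "w n"] b_bound[of u0 "v n - v0" "w n"]
        b_bound[of u0 v0 "w n - w0"] V V_diff
      by (simp add: D_diff)
  qed
  then have "(\<lambda>n. b (u n) (v n) (w n) - b u0 v0 w0) \<longlonglongrightarrow> 0"
    by (intro Lim_null_comparison[OF _ e]) auto
  then show ?thesis by (rule LIM_zero_cancel)
qed

lemma b_skew: assumes "u \<in> V" "v \<in> V" "w \<in> V" shows "b u v w = - b u w v"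
proof -
  obtain \<phi> \<psi> \<eta> where s: "\<And>n. \<phi> n \<in> V0" "(\<lambda>n. D (\<phi> n)) \<longlonglongrightarrow> D u"
    "\<And>n. \<psi> n \<in> V0" "(\<lambda>n. D (\<psi> n)) \<longlonglongrightarrow> D v" "\<And>n. \<eta> n \<in> V0" "(\<lambda>n. D (\<eta> n)) \<longlonglongrightarrow> D w"
    using smooth_sequence[OF assms(1)] smooth_sequence[OF assms(2)] smooth_sequence[OF assms(3)]
    by metis
  have inV: "\<phi> n \<in> V" "\<psi> n \<in> V" "\<eta> n \<in> V" for n using s V0 by auto
  have lim: "(\<lambda>n. b (\<phi> n) (\<psi> n) (\<eta> n)) \<longlonglongrightarrow> b u v w"
    by (intro b_tendsto inV assms s)
  have "(\<lambda>n. - b (\<phi> n) (\<eta> n) (\<psi> n)) \<longlonglongrightarrow> - b u w v"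
    by (intro tendsto_minus b_tendsto inV assms s)
  also have "(\<lambda>n. - b (\<phi> n) (\<eta> n) (\<psi> n)) = (\<lambda>n. b (\<phi> n) (\<psi> n) (\<eta> n))"
    using b_skew0[OF s(1,3,5)] by presburger
  finally show ?thesis by (rule LIMSEQ_unique[OF lim])
qed

lemma b_same: assumes "u \<in> V" "v \<in> V" shows "b u v v = 0"
  using b_skew[OF assms assms(2)] by linarith

definition ball_V :: "real \<Rightarrow> 'a set" where "ball_V R = {u \<in> V. norm (D u) \<le> R}"

text \<open>The graph of \<open>D\<close> over the ball is a bounded closed convex subset of the product space, and the ball is its
  first projection.\<close>

lemma closed_ball_V: "closed (ball_V R)"
proof -
  let ?C = "(\<lambda>u. (u, D u)) ` V \<inter> UNIV \<times> cball 0 R"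
  have "subspace ((\<lambda>u. (u, D u)) ` V)"
  proof (rule subspaceI)
    show "0 \<in> (\<lambda>u. (u, D u)) ` V"
      by (rule image_eqI[of _ _ 0]) (simp_all add: D_0 zero_prod_def V_0)
    fix x y :: "'a \<times> 'b" and c :: real
    assume "x \<in> (\<lambda>u. (u, D u)) ` V"
    then obtain u where u: "u \<in> V" "x = (u, D u)" by blast
    show "c *\<^sub>R x \<in> (\<lambda>u. (u, D u)) ` V"
      by (rule image_eqI[of _ _ "c *\<^sub>R u"]) (simp_all add: u D_scale V_scale)
    assume "y \<in> (\<lambda>u. (u, D u)) ` V"
    then obtain w where w: "w \<in> V" "y = (w, D w)" by blast
    show "x + y \<in> (\<lambda>u. (u, D u)) ` V"
      by (rule image_eqI[of _ _ "u + w"]) (simp_all add: u w D_add V_add)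
  qed
  note sub = subspace_imp_convex[OF this]
  have "convex ?C" by (intro convex_Int convex_Times sub convex_UNIV convex_cball)
  moreover have "closed ?C" by (intro closed_Int closed_D closed_Times closed_UNIV closed_cball)
  moreover have "bounded ?C"
  proof (rule bounded_subset)
    show "bounded (cball (0::'a) (cp * R) \<times> cball (0::'b) R)" by (intro bounded_Times bounded_cball)
    have "norm u \<le> cp * R" if "u \<in> V" "norm (D u) \<le> R" for u
      using poincare[OF that(1)] mult_left_mono[OF that(2), of cp] cp by linarith
    then show "?C \<subseteq> cball (0::'a) (cp * R) \<times> cball (0::'b) R" by auto
  qed
  ultimately have "closed (fst ` ?C)" by (intro closed_fst_image)
  also have "fst ` ?C = ball_V R"
  proof
    show "fst ` ?C \<subseteq> ball_V R" by (auto simp: ball_V_def)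
    show "ball_V R \<subseteq> fst ` ?C"
    proof
      fix u assume "u \<in> ball_V R"
      then have "(u, D u) \<in> ?C" by (auto simp: ball_V_def)
      then show "u \<in> fst ` ?C" by (metis fst_conv image_eqI)
    qed
  qed
  finally show ?thesis .
qed

text \<open>Along a subsequence the inner products with all vectors occurring in \<open>friedrichs\<close>
  converge; that inequality turns this into the Cauchy property.\<close>

lemma compact_ball_V: "compact (ball_V R)"
  unfolding compact_def
proof (intro allI impI)
  fix u :: "nat \<Rightarrow> 'a" assume u: "\<forall>n. u n \<in> ball_V R"
  then have uV: "u n \<in> V" and uR: "norm (D (u n)) \<le> R" for n by (auto simp: ball_V_def)
  have "\<forall>m. \<exists>G. finite G \<and> (\<forall>u\<in>V. (norm u)\<^sup>2 \<le> inverse (real (Suc m)) * (norm (D u))\<^sup>2 + (\<Sum>g\<in>G. (u \<bullet> g)\<^sup>2))"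
    using friedrichs by simp
  then obtain G where G: "\<And>m. finite (G m)"
    "\<And>m u. u \<in> V \<Longrightarrow> (norm u)\<^sup>2 \<le> inverse (real (Suc m)) * (norm (D u))\<^sup>2 + (\<Sum>g\<in>G m. (u \<bullet> g)\<^sup>2)"
    by metis
  define g where "g = from_nat_into (insert 0 (\<Union>m. G m))"
  have "countable (insert 0 (\<Union>m. G m))" using G(1) by (auto intro: countable_finite)
  then have range_g: "range g = insert 0 (\<Union>m. G m)" unfolding g_def by (intro range_from_nat_into) auto
  have "\<bar>u n \<bullet> g i\<bar> \<le> cp * R * norm (g i)" for n i
  proof -
    have "\<bar>u n \<bullet> g i\<bar> \<le> norm (u n) * norm (g i)" by (rule Cauchy_Schwarz_ineq2)
    also have "norm (u n) \<le> cp * R"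
      using poincare[OF uV[of n]] uR[of n] cp by (smt (verit) mult_left_mono)
    finally show ?thesis by (simp add: mult_right_mono)
  qed
  then obtain r l where r: "strict_mono r" and l: "\<And>i. (\<lambda>n. u (r n) \<bullet> g i) \<longlonglongrightarrow> l i"
    using bounded_coordinates_subseq[of "\<lambda>n i. u n \<bullet> g i" "\<lambda>i. cp * R * norm (g i)"] by blast
  have "Cauchy (u \<circ> r)"
  proof (rule metric_CauchyI)
    fix e :: real assume "0 < e"
    \<comment> \<open>Differences of elements of the ball have gradients of norm at most \<open>2 * R\<close>.\<close>
    obtain m where m: "inverse (real (Suc m)) < e\<^sup>2 / (2 * ((2 * R)\<^sup>2 + 1))"
      using reals_Archimedean[of "e\<^sup>2 / (2 * ((2 * R)\<^sup>2 + 1))"] \<open>0 < e\<close> by (auto simp: add_nonneg_pos)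
    have first: "inverse (real (Suc m)) * (2 * R)\<^sup>2 \<le> e\<^sup>2 / 2"
    proof -
      have "inverse (real (Suc m)) * (2 * R)\<^sup>2 \<le> e\<^sup>2 / (2 * ((2 * R)\<^sup>2 + 1)) * ((2 * R)\<^sup>2 + 1)"
        using m by (intro mult_mono) auto
      also have "\<dots> = e\<^sup>2 / 2"
      proof -
        have "(2 * R)\<^sup>2 + 1 > 0" by (simp add: add_nonneg_pos)
        then show ?thesis by (simp add: field_simps)
      qed
      finally show ?thesis .
    qed
    have "\<forall>h\<in>G m. \<exists>L. (\<lambda>n. u (r n) \<bullet> h) \<longlonglongrightarrow> L"
    proof
      fix h assume "h \<in> G m"
      then have "h \<in> range g" using range_g by blast
      then show "\<exists>L. (\<lambda>n. u (r n) \<bullet> h) \<longlonglongrightarrow> L" using l by blast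
    qed
    then obtain L where L: "\<And>h. h \<in> G m \<Longrightarrow> (\<lambda>n. u (r n) \<bullet> h) \<longlonglongrightarrow> L h" by metis
    define a where "a n = (\<Sum>h\<in>G m. (u (r n) \<bullet> h - L h)\<^sup>2)" for n
    have "a \<longlonglongrightarrow> (\<Sum>h\<in>G m. (L h - L h)\<^sup>2)" unfolding a_def by (intro tendsto_intros L)
    then have "\<forall>\<^sub>F n in sequentially. a n < e\<^sup>2 / 8" using \<open>0 < e\<close> by (intro order_tendstoD) auto
    then obtain N where N: "\<And>n. n \<ge> N \<Longrightarrow> a n < e\<^sup>2 / 8" by (auto simp: eventually_sequentially)
    have "dist ((u \<circ> r) i) ((u \<circ> r) j) < e" if ij: "i \<ge> N" "j \<ge> N" for i j
    proof -
      let ?w = "u (r i) - u (r j)"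
      have "?w \<in> V" using uV V_diff by blast
      have "norm (D ?w) \<le> 2 * R"
        using uV uR[of "r i"] uR[of "r j"] norm_triangle_ineq4[of "D (u (r i))" "D (u (r j))"] by (simp add: D_diff)
      then have "inverse (real (Suc m)) * (norm (D ?w))\<^sup>2 \<le> inverse (real (Suc m)) * (2 * R)\<^sup>2"
        by (intro mult_left_mono power_mono) auto
      moreover have "(\<Sum>h\<in>G m. (?w \<bullet> h)\<^sup>2) \<le> (\<Sum>h\<in>G m. 2 * (u (r i) \<bullet> h - L h)\<^sup>2 + 2 * (u (r j) \<bullet> h - L h)\<^sup>2)"
      proof (rule sum_mono)
        fix h
        have "(?w \<bullet> h)\<^sup>2 = ((u (r i) \<bullet> h - L h) - (u (r j) \<bullet> h - L h))\<^sup>2" by (simp add: inner_diff_left)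
        also have "\<dots> \<le> 2 * (u (r i) \<bullet> h - L h)\<^sup>2 + 2 * (u (r j) \<bullet> h - L h)\<^sup>2"
          using sum_squares_ge_zero[of "(u (r i) \<bullet> h - L h) + (u (r j) \<bullet> h - L h)" 0]
          by (simp add: power2_eq_square algebra_simps)
        finally show "(?w \<bullet> h)\<^sup>2 \<le> 2 * (u (r i) \<bullet> h - L h)\<^sup>2 + 2 * (u (r j) \<bullet> h - L h)\<^sup>2" .
      qed
      moreover have "\<dots> = 2 * a i + 2 * a j" by (simp add: a_def sum.distrib sum_distrib_left)
      ultimately have "(norm ?w)\<^sup>2 < e\<^sup>2"
        using G(2)[OF \<open>?w \<in> V\<close>, of m] first N[OF ij(1)] N[OF ij(2)] by linarith
      then show ?thesis using \<open>0 < e\<close> power2_less_imp_less[of "norm ?w" e] by (simp add: dist_norm)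
    qed
    then show "\<exists>M. \<forall>i\<ge>M. \<forall>j\<ge>M. dist ((u \<circ> r) i) ((u \<circ> r) j) < e" by blast
  qed
  then obtain u0 where u0: "(u \<circ> r) \<longlonglongrightarrow> u0" by (auto simp: Cauchy_convergent_iff convergent_def)
  have "u0 \<in> ball_V R" by (rule closed_sequentially[OF closed_ball_V _ u0]) (use u in auto)
  with r u0 show "\<exists>l\<in>ball_V R. \<exists>r. strict_mono r \<and> (u \<circ> r) \<longlonglongrightarrow> l" by blast
qed

text \<open>On bounded sets of \<open>V\<close> the forms are continuous for the weaker norm of the ambient space:
  for smooth \<open>v\<close> all derivatives can be moved onto \<open>v\<close>, and the approximation of \<open>v\<close> by smooth
  fields is uniform on such sets.\<close>

lemma continuous_on_forms_smooth:
  assumes "\<phi> \<in> V0"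
  shows "continuous_on (ball_V R) (\<lambda>u. D u \<bullet> D \<phi>)" "continuous_on (ball_V R) (\<lambda>u. b u u \<phi>)"
proof -
  obtain g where g: "\<forall>u\<in>V. D u \<bullet> D \<phi> = u \<bullet> g" using adjoint[OF assms] by blast
  have "continuous_on (ball_V R) (\<lambda>u. u \<bullet> g)" by (intro continuous_intros)
  then show "continuous_on (ball_V R) (\<lambda>u. D u \<bullet> D \<phi>)"
    by (rule continuous_on_eq) (use g in \<open>auto simp: ball_V_def\<close>)
  obtain M where M: "\<And>u w. u \<in> V \<Longrightarrow> w \<in> V \<Longrightarrow> \<bar>b u \<phi> w\<bar> \<le> M * norm u * norm w"
    using b_regular[OF assms] by blast
  have "\<phi> \<in> V" using assms V0 by blast
  show "continuous_on (ball_V R) (\<lambda>u. b u u \<phi>)"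
    unfolding continuous_on_sequentially
  proof (intro allI ballI impI)
    fix u u0 assume u0: "u0 \<in> ball_V R" and u: "(\<forall>n. u n \<in> ball_V R) \<and> u \<longlonglongrightarrow> u0"
    have V: "u0 \<in> V" "\<And>n. u n \<in> V" using u0 u by (auto simp: ball_V_def)
    have lim: "u \<longlonglongrightarrow> u0" using u by simp
    let ?e = "\<lambda>n. M * norm (u n - u0) * norm (u n) + M * norm u0 * norm (u n - u0)"
    have "?e \<longlonglongrightarrow> M * norm (u0 - u0) * norm u0 + M * norm u0 * norm (u0 - u0)"
      by (intro tendsto_intros lim)
    then have e: "?e \<longlonglongrightarrow> 0" by simp
    have "norm (b (u n) \<phi> (u n) - b u0 \<phi> u0) \<le> ?e n" for n
    proof -
      have eq: "b (u n) \<phi> (u n) - b u0 \<phi> u0 = b (u n - u0) \<phi> (u n) + b u0 \<phi> (u n - u0)"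
        using V \<open>\<phi> \<in> V\<close> by (simp add: b_diff1 b_diff3 V_diff)
      show ?thesis
        unfolding eq using M[of "u n - u0" "u n"] M[of u0 "u n - u0"] V V_diff by simp
    qed
    then have "(\<lambda>n. b (u n) \<phi> (u n) - b u0 \<phi> u0) \<longlonglongrightarrow> 0"
      by (intro Lim_null_comparison[OF _ e] always_eventually) simp
    then have "(\<lambda>n. - b (u n) \<phi> (u n)) \<longlonglongrightarrow> - b u0 \<phi> u0"
      by (intro tendsto_minus) (rule LIM_zero_cancel)
    then show "((\<lambda>u. b u u \<phi>) \<circ> u) \<longlonglongrightarrow> b u0 u0 \<phi>"
      using b_skew[OF V(1) V(1) \<open>\<phi> \<in> V\<close>] b_skew[OF V(2) V(2) \<open>\<phi> \<in> V\<close>] by (simp add: o_def)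
  qed
qed

lemma continuous_on_forms:
  assumes "v \<in> V"
  shows "continuous_on (ball_V R) (\<lambda>u. D u \<bullet> D v)" "continuous_on (ball_V R) (\<lambda>u. b u u v)"
proof -
  obtain \<phi> where \<phi>: "\<And>n. \<phi> n \<in> V0" "(\<lambda>n. D (\<phi> n)) \<longlonglongrightarrow> D v"
    using smooth_sequence[OF assms] by blast
  have "(\<lambda>n. norm (D (\<phi> n) - D v)) \<longlonglongrightarrow> 0"
    using tendsto_norm[OF LIM_zero[OF \<phi>(2)]] by simp
  note small = tendsto_mult_right_zero[OF this]
  have \<phi>V: "\<phi> n \<in> V" for n using \<phi>(1) V0 by blast
  have "uniform_limit (ball_V R) (\<lambda>n u. D u \<bullet> D (\<phi> n)) (\<lambda>u. D u \<bullet> D v) sequentially"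
  proof (rule uniform_limitI)
    fix e :: real assume "0 < e"
    have "\<forall>\<^sub>F n in sequentially. R * norm (D (\<phi> n) - D v) < e"
      by (rule order_tendstoD(2)[OF small \<open>0 < e\<close>])
    then show "\<forall>\<^sub>F n in sequentially. \<forall>u\<in>ball_V R. dist (D u \<bullet> D (\<phi> n)) (D u \<bullet> D v) < e"
    proof (rule eventually_mono, intro ballI)
      fix n u assume n: "R * norm (D (\<phi> n) - D v) < e" and u: "u \<in> ball_V R"
      have "\<bar>D u \<bullet> (D (\<phi> n) - D v)\<bar> \<le> norm (D u) * norm (D (\<phi> n) - D v)" by (rule Cauchy_Schwarz_ineq2)
      also have "\<dots> \<le> R * norm (D (\<phi> n) - D v)" using u by (intro mult_right_mono) (auto simp: ball_V_def)
      finally show "dist (D u \<bullet> D (\<phi> n)) (D u \<bullet> D v) < e" using n by (simp add: dist_real_def inner_diff_right)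
    qed
  qed
  then show "continuous_on (ball_V R) (\<lambda>u. D u \<bullet> D v)"
    by (rule uniform_limit_theorem[rotated]) (use \<phi> in \<open>auto intro!: always_eventually continuous_on_forms_smooth\<close>)
  have "uniform_limit (ball_V R) (\<lambda>n u. b u u (\<phi> n)) (\<lambda>u. b u u v) sequentially"
  proof (rule uniform_limitI)
    fix e :: real assume "0 < e"
    have "\<forall>\<^sub>F n in sequentially. \<bar>L\<bar> * R * R * norm (D (\<phi> n) - D v) < e"
      by (rule order_tendstoD(2)[OF small \<open>0 < e\<close>])
    then show "\<forall>\<^sub>F n in sequentially. \<forall>u\<in>ball_V R. dist (b u u (\<phi> n)) (b u u v) < e"
    proof (rule eventually_mono, intro ballI)
      fix n u assume n: "\<bar>L\<bar> * R * R * norm (D (\<phi> n) - D v) < e" and u: "u \<in> ball_V R"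
      then have V: "u \<in> V" and uR: "norm (D u) \<le> R" by (auto simp: ball_V_def)
      have "\<bar>b u u (\<phi> n - v)\<bar> \<le> L * norm (D u) * norm (D u) * norm (D (\<phi> n - v))"
        using V \<phi>V assms V_diff by (intro b_bound) auto
      also have "\<dots> \<le> \<bar>L\<bar> * R * R * norm (D (\<phi> n - v))"
        using uR order_trans[OF norm_ge_zero uR] by (intro mult_mono mult_nonneg_nonneg) auto
      also have "\<dots> < e" using n \<phi>V assms by (simp add: D_diff)
      finally show "dist (b u u (\<phi> n)) (b u u v) < e"
        using V \<phi>V assms by (simp add: dist_real_def b_diff3)
    qed
  qed
  then show "continuous_on (ball_V R) (\<lambda>u. b u u v)"
    by (rule uniform_limit_theorem[rotated]) (use \<phi> in \<open>auto intro!: always_eventually continuous_on_forms_smooth\<close>)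
qed

end

section \<open>Solutions of the stationary problem\<close>

context energy_space
begin

definition residual :: "real \<Rightarrow> real \<Rightarrow> 'a \<Rightarrow> 'a \<Rightarrow> 'a \<Rightarrow> real" where
  "residual a k g u v = u \<bullet> v + a * (D u \<bullet> D v) + k * b u u v - g \<bullet> v"

definition solutions :: "real \<Rightarrow> real \<Rightarrow> 'a \<Rightarrow> 'a set" where
  "solutions a k g = {u \<in> V. \<forall>v\<in>V. residual a k g u v = 0}"

lemma residual_sum:
  assumes "\<And>i. i \<in> I \<Longrightarrow> v i \<in> V" "u \<in> V"
  shows "residual a k g u (\<Sum>i\<in>I. c i *\<^sub>R v i) = (\<Sum>i\<in>I. c i * residual a k g u (v i))"
proof -
  have "D (\<Sum>i\<in>I. c i *\<^sub>R v i) = (\<Sum>i\<in>I. c i *\<^sub>R D (v i))"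
    using assms by (subst D_sum) (auto simp: V_scale D_scale)
  moreover have "b u u (\<Sum>i\<in>I. c i *\<^sub>R v i) = (\<Sum>i\<in>I. c i * b u u (v i))"
    using assms by (subst b_sum3) (auto simp: V_scale b_scale3)
  ultimately show ?thesis
    by (simp add: residual_def inner_sum_right sum_distrib_left sum.distrib sum_subtractf algebra_simps)
qed

lemma residual_self: "u \<in> V \<Longrightarrow> residual a k g u u = (norm u)\<^sup>2 + a * (norm (D u))\<^sup>2 - g \<bullet> u"
  by (simp add: residual_def b_same power2_norm_eq_inner)

lemma continuous_on_residual:
  assumes "v \<in> V"
  shows "continuous_on (ball_V R) (\<lambda>u. residual a k g u v)"
  unfolding residual_def by (intro continuous_intros continuous_on_forms assms)

text \<open>The penalty \<open>\<epsilon> * c j\<close> makes the Galerkin system coercive in the coefficients even if the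
  \<open>\<phi> j\<close> are linearly dependent. Testing the penalised system with its own solution bounds
  \<open>\<epsilon> * (\<Sum>j. (c j)\<^sup>2)\<close> by \<open>(norm g)\<^sup>2\<close>, so the penalty itself is of size \<open>sqrt \<epsilon>\<close>.\<close>

lemma galerkin:
  fixes \<phi> :: "nat \<Rightarrow> 'a"
  assumes a: "a > 0" and \<eta>: "\<eta> > 0" and \<phi>: "\<And>j. j < n \<Longrightarrow> \<phi> j \<in> V"
  obtains u where "u \<in> V" "a * (norm (D u))\<^sup>2 \<le> (norm g)\<^sup>2"
    "\<And>j. j < n \<Longrightarrow> \<bar>residual a k g u (\<phi> j)\<bar> \<le> \<eta>"
proof -
  \<comment> \<open>\<open>R\<close> makes \<open>\<epsilon> * R\<^sup>2\<close> exceed \<open>(norm g)\<^sup>2\<close>, which dominates the negative part of the quadratic form on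
    the faces of the cube; \<open>\<epsilon>\<close> then makes the penalty at most \<open>\<eta>\<close>.\<close>
  define \<epsilon> where "\<epsilon> = \<eta>\<^sup>2 / ((norm g)\<^sup>2 + 1)"
  have ge1: "(norm g)\<^sup>2 + 1 > 0" by (simp add: add_nonneg_pos)
  have \<epsilon>: "\<epsilon> > 0" using \<eta> ge1 by (simp add: \<epsilon>_def)
  define R where "R = (norm g + 1) / sqrt \<epsilon>"
  have R: "R > 0" using \<epsilon> by (simp add: R_def add_nonneg_pos)
  have R2: "\<epsilon> * R\<^sup>2 = (norm g + 1)\<^sup>2" using \<epsilon> by (simp add: R_def power_divide)
  define U where "U c = (\<Sum>i<n. c i *\<^sub>R \<phi> i)" for c :: "nat \<Rightarrow> real"
  have UV: "U c \<in> V" for c unfolding U_def using \<phi> by (intro V_sum) (auto simp: V_scale)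
  have DU: "D (U c) = (\<Sum>i<n. c i *\<^sub>R D (\<phi> i))" for c
    unfolding U_def using \<phi> by (subst D_sum) (auto simp: V_scale D_scale)
  have bU: "b (U c) (U c) v = (\<Sum>i<n. \<Sum>l<n. c i * (c l * b (\<phi> i) (\<phi> l) v))" if "v \<in> V" for c v
  proof -
    have "b (U c) (U c) v = (\<Sum>i<n. b (c i *\<^sub>R \<phi> i) (U c) v)"
      using UV[of c] that \<phi> unfolding U_def[of c] by (intro b_sum1) (auto simp: V_scale)
    also have "\<dots> = (\<Sum>i<n. \<Sum>l<n. b (c i *\<^sub>R \<phi> i) (c l *\<^sub>R \<phi> l) v)"
      unfolding U_def[of c] using that \<phi> by (intro sum.cong refl b_sum2) (auto simp: V_scale)
    also have "\<dots> = (\<Sum>i<n. \<Sum>l<n. c i * (c l * b (\<phi> i) (\<phi> l) v))"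
      using that \<phi> by (intro sum.cong refl) (simp add: b_scale1 b_scale2 V_scale)
    finally show ?thesis .
  qed
  define P where "P j c = (if j < n then residual a k g (U c) (\<phi> j) + \<epsilon> * c j else 0)" for j c
  have P_sum: "(\<Sum>j<n. P j c * c j)
      = (norm (U c))\<^sup>2 + a * (norm (D (U c)))\<^sup>2 - g \<bullet> U c + \<epsilon> * (\<Sum>j<n. (c j)\<^sup>2)" for c
  proof -
    have "residual a k g (U c) (U c) = (\<Sum>j<n. c j * residual a k g (U c) (\<phi> j))"
      using residual_sum[of "{..<n}" \<phi> "U c" a k g c] \<phi> UV[of c] by (simp add: U_def)
    then have "(\<Sum>j<n. P j c * c j) = residual a k g (U c) (U c) + \<epsilon> * (\<Sum>j<n. (c j)\<^sup>2)"
      by (simp add: P_def sum_distrib_left power2_eq_square algebra_simps sum.distrib)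
    then show ?thesis by (simp add: residual_self UV)
  qed
  have g_le: "g \<bullet> u \<le> norm g * norm u" for u by (rule norm_cauchy_schwarz)
  obtain c where c: "\<And>j. j < n \<Longrightarrow> P j c = 0"
  proof (rule zero_in_cube[of R P n])
    show "R > 0" by (rule R)
    show "(\<lambda>m. P j (x m)) \<longlonglongrightarrow> P j l" if lim: "\<And>i. (\<lambda>m. x m i) \<longlonglongrightarrow> l i" for j x l
    proof (cases "j < n")
      case True
      show ?thesis
        unfolding P_def residual_def DU bU[OF \<phi>[OF True]]
        unfolding U_def using True by (auto intro!: tendsto_intros lim)
    qed (simp add: P_def)
    show "(\<Sum>j<n. P j c * c j) > 0" if face: "\<exists>i<n. \<bar>c i\<bar> = R" for c
    proof -
      obtain i where i: "i < n" "\<bar>c i\<bar> = R" using face by blast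
      have "R\<^sup>2 = (c i)\<^sup>2" using i(2) by auto
      also have "\<dots> \<le> (\<Sum>j<n. (c j)\<^sup>2)" using i(1) by (intro member_le_sum) auto
      finally have "(norm g + 1)\<^sup>2 \<le> \<epsilon> * (\<Sum>j<n. (c j)\<^sup>2)"
        using \<epsilon> unfolding R2[symmetric] by (intro mult_left_mono) auto
      moreover have "g \<bullet> U c \<le> (norm (U c))\<^sup>2 + (norm g)\<^sup>2"
        using g_le[of "U c"] sum_squares_bound[of "norm g" "norm (U c)"]
          mult_nonneg_nonneg[OF norm_ge_zero[of g] norm_ge_zero[of "U c"]] by linarith
      moreover have "(norm g)\<^sup>2 < (norm g + 1)\<^sup>2" by (intro power_strict_mono) auto
      moreover have "0 \<le> a * (norm (D (U c)))\<^sup>2" using a by simp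
      ultimately show ?thesis unfolding P_sum by linarith
    qed
  qed (blast intro: that)
  let ?S = "\<Sum>j<n. (c j)\<^sup>2"
  have zero: "(norm (U c))\<^sup>2 + a * (norm (D (U c)))\<^sup>2 + \<epsilon> * ?S = g \<bullet> U c"
    using P_sum[of c] c by simp
  have nonneg: "0 \<le> a * (norm (D (U c)))\<^sup>2" "0 \<le> \<epsilon> * ?S" using a \<epsilon> by (auto intro!: mult_nonneg_nonneg sum_nonneg)
  have "g \<bullet> U c \<le> (norm (U c))\<^sup>2 + (norm g)\<^sup>2"
    using g_le[of "U c"] sum_squares_bound[of "norm g" "norm (U c)"]
      mult_nonneg_nonneg[OF norm_ge_zero[of g] norm_ge_zero[of "U c"]] by linarith
  with zero nonneg have bounds: "a * (norm (D (U c)))\<^sup>2 \<le> (norm g)\<^sup>2" "\<epsilon> * ?S \<le> (norm g)\<^sup>2" by linarith+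
  have "\<bar>residual a k g (U c) (\<phi> j)\<bar> \<le> \<eta>" if "j < n" for j
  proof -
    have "residual a k g (U c) (\<phi> j) = - (\<epsilon> * c j)" using c[OF that] that by (simp add: P_def)
    then have "(residual a k g (U c) (\<phi> j))\<^sup>2 = \<epsilon> * (\<epsilon> * (c j)\<^sup>2)" by (simp add: power2_eq_square)
    also have "\<dots> \<le> \<epsilon> * (\<epsilon> * ?S)"
      using \<epsilon> that by (intro mult_left_mono member_le_sum) auto
    also have "\<dots> \<le> \<epsilon> * ((norm g)\<^sup>2 + 1)" using bounds(2) \<epsilon> by (intro mult_left_mono) auto
    also have "\<dots> = \<eta>\<^sup>2" using ge1 by (simp add: \<epsilon>_def)
    finally show ?thesis using abs_le_square_iff[of "residual a k g (U c) (\<phi> j)" \<eta>] \<eta> by simp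
  qed
  then show ?thesis using that[of "U c"] UV bounds by blast
qed

text \<open>The Galerkin approximations show that any finitely many of the closed conditions
  \<open>\<bar>residual a k g u v\<bar> \<le> \<eta>\<close> are compatible on a fixed compact ball; hence all of them are.\<close>

lemma solutions_nonempty:
  assumes a: "a > 0"
  shows "solutions a k g \<noteq> {}"
proof -
  define R where "R = norm g / sqrt a"
  define T where "T = (\<lambda>(v, \<eta>). {u \<in> ball_V R. \<bar>residual a k g u v\<bar> \<le> \<eta>})"
  have R_bound: "norm (D u) \<le> R" if "a * (norm (D u))\<^sup>2 \<le> (norm g)\<^sup>2" for u
  proof (rule power2_le_imp_le)
    show "(norm (D u))\<^sup>2 \<le> R\<^sup>2" using that a by (simp add: R_def power_divide field_simps)
  qed (use a in \<open>simp add: R_def\<close>)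
  have "ball_V R \<inter> (\<Inter>i\<in>V \<times> {0<..}. T i) \<noteq> {}"
  proof (rule compact_imp_fip_image[OF compact_ball_V])
    fix i assume "i \<in> V \<times> {0::real<..}"
    then obtain v \<eta> where i: "i = (v, \<eta>)" "v \<in> V" by auto
    have "closed (ball_V R \<inter> (\<lambda>u. residual a k g u v) -` {-\<eta>..\<eta>})"
      by (intro continuous_closed_preimage continuous_on_residual i closed_ball_V) simp
    also have "ball_V R \<inter> (\<lambda>u. residual a k g u v) -` {-\<eta>..\<eta>} = T i"
      by (auto simp: T_def i abs_le_iff)
    finally show "closed (T i)" .
  next
    fix I' assume I': "finite I'" "I' \<subseteq> V \<times> {0::real<..}"
    obtain n :: nat and h where h: "I' = h ` {i. i < n}"
      using finite_imp_nat_seg_image_inj_on[OF I'(1)] by blast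
    define \<eta> where "\<eta> = Min (insert 1 (snd ` I'))"
    have "\<eta> > 0" using I' by (auto simp: \<eta>_def)
    have hV: "fst (h j) \<in> V" if "j < n" for j using I'(2) h that by (auto simp: mem_Times_iff)
    obtain u where u: "u \<in> V" "a * (norm (D u))\<^sup>2 \<le> (norm g)\<^sup>2"
      "\<And>j. j < n \<Longrightarrow> \<bar>residual a k g u (fst (h j))\<bar> \<le> \<eta>"
      using galerkin[OF a \<open>\<eta> > 0\<close>, of n "\<lambda>j. fst (h j)" g k] hV by blast
    have "u \<in> ball_V R" using u R_bound by (simp add: ball_V_def)
    moreover have "u \<in> T i" if "i \<in> I'" for i
    proof -
      have "i \<in> h ` {i. i < n}" using that by (simp add: h)
      then obtain j where j: "j < n" "i = h j" by blast
      have "\<eta> \<le> snd i" using that I'(1) by (auto simp: \<eta>_def)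
      then have "\<bar>residual a k g u (fst i)\<bar> \<le> snd i" using u(3)[OF j(1)] unfolding j(2) by linarith
      then show ?thesis using \<open>u \<in> ball_V R\<close> by (simp add: T_def split_beta)
    qed
    ultimately show "ball_V R \<inter> (\<Inter>i\<in>I'. T i) \<noteq> {}" by blast
  qed
  then obtain u where u: "u \<in> ball_V R" "\<And>v \<eta>. v \<in> V \<Longrightarrow> \<eta> > 0 \<Longrightarrow> u \<in> T (v, \<eta>)" by auto
  have "residual a k g u v = 0" if "v \<in> V" for v
  proof -
    have "\<bar>residual a k g u v\<bar> \<le> 0"
      by (rule field_le_epsilon) (use u(2)[OF that] in \<open>simp add: T_def\<close>)
    then show ?thesis by simp
  qed
  then show ?thesis using u(1) by (auto simp: solutions_def ball_V_def)
qed

lemma solutions_energy: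
  assumes "u \<in> solutions a k g"
  shows "(norm u)\<^sup>2 + a * (norm (D u))\<^sup>2 = g \<bullet> u"
  using assms residual_self[of u a k g] by (auto simp: solutions_def)

text \<open>In the energy identity Poincare's inequality absorbs the viscous term into the norm of \<open>u\<close>.\<close>

lemma solutions_contract:
  assumes a: "a > 0" and u: "u \<in> solutions a k g"
  shows "norm u \<le> norm g / (1 + a / cp\<^sup>2)"
proof -
  have "u \<in> V" using u by (simp add: solutions_def)
  have pos: "1 + a / cp\<^sup>2 > 0" using a cp by (simp add: add_pos_nonneg)
  have "(norm u)\<^sup>2 \<le> (cp * norm (D u))\<^sup>2" using poincare[OF \<open>u \<in> V\<close>] by (intro power_mono) auto
  then have "a / cp\<^sup>2 * (norm u)\<^sup>2 \<le> a / cp\<^sup>2 * (cp * norm (D u))\<^sup>2"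
    using a by (intro mult_left_mono) auto
  also have "\<dots> = a * (norm (D u))\<^sup>2" using cp by (simp add: power_mult_distrib)
  finally have "(1 + a / cp\<^sup>2) * (norm u)\<^sup>2 \<le> norm g * norm u"
    using solutions_energy[OF u] norm_cauchy_schwarz[of g u] by (simp add: algebra_simps)
  then have "norm u * ((1 + a / cp\<^sup>2) * norm u) \<le> norm u * norm g"
    by (simp add: power2_eq_square mult_ac)
  then have "u \<noteq> 0 \<Longrightarrow> (1 + a / cp\<^sup>2) * norm u \<le> norm g" by simp
  then have "(1 + a / cp\<^sup>2) * norm u \<le> norm g" by (cases "u = 0") auto
  then show ?thesis using pos by (simp add: pos_le_divide_eq mult.commute)
qed

lemma solutions_in_ball_V:
  assumes a: "a > 0" and u: "u \<in> solutions a k g" and g: "norm g \<le> r"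
  shows "u \<in> ball_V (r / sqrt a)"
proof -
  have "u \<in> V" using u by (simp add: solutions_def)
  have "g \<bullet> u \<le> (norm u)\<^sup>2 + (norm g)\<^sup>2"
    using norm_cauchy_schwarz[of g u] sum_squares_bound[of "norm g" "norm u"]
      mult_nonneg_nonneg[OF norm_ge_zero[of g] norm_ge_zero[of u]] by linarith
  moreover have "(norm g)\<^sup>2 \<le> r\<^sup>2" using g by (intro power_mono) auto
  ultimately have *: "a * (norm (D u))\<^sup>2 \<le> r\<^sup>2" using solutions_energy[OF u] by linarith
  have "norm (D u) \<le> r / sqrt a"
  proof (rule power2_le_imp_le)
    show "(norm (D u))\<^sup>2 \<le> (r / sqrt a)\<^sup>2" using * a by (simp add: power_divide field_simps)
  qed (use a order_trans[OF norm_ge_zero g] in simp)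
  then show ?thesis using \<open>u \<in> V\<close> by (simp add: ball_V_def)
qed

text \<open>Bounded data keep the solutions in one ball of \<open>V\<close>, on which the residual is continuous for the norm
  of the ambient space.\<close>

lemma solutions_closed_graph:
  assumes a: "a > 0" and u: "\<And>n. u n \<in> solutions a k (g n)"
    and lim: "g \<longlonglongrightarrow> g0" "u \<longlonglongrightarrow> u0"
  shows "u0 \<in> solutions a k g0"
proof -
  obtain r where r: "\<And>n. norm (g n) \<le> r"
    using convergent_imp_bounded[OF lim(1)] by (auto simp: bounded_iff)
  let ?B = "ball_V (r / sqrt a)"
  have uB: "u n \<in> ?B" for n by (rule solutions_in_ball_V[OF a u r])
  have u0: "u0 \<in> ?B" by (rule closed_sequentially[OF closed_ball_V uB lim(2)])
  have "residual a k g0 u0 v = 0" if "v \<in> V" for v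
  proof -
    have "(\<lambda>n. residual a k 0 (u n) v) \<longlonglongrightarrow> residual a k 0 u0 v"
      by (rule continuous_on_tendsto_compose[OF continuous_on_residual[OF that] lim(2) u0])
         (simp add: uB)
    moreover have "(\<lambda>n. g n \<bullet> v) \<longlonglongrightarrow> g0 \<bullet> v" by (intro tendsto_intros lim)
    moreover have "residual a k 0 (u n) v = g n \<bullet> v" for n
      using u[of n] that by (auto simp: solutions_def residual_def)
    ultimately have "residual a k 0 u0 v = g0 \<bullet> v" using LIMSEQ_unique by simp
    then show ?thesis by (simp add: residual_def)
  qed
  then show ?thesis using u0 by (auto simp: solutions_def ball_V_def)
qed

section \<open>The implicit Euler scheme\<close>

definition euler :: "real \<Rightarrow> real \<Rightarrow> 'a \<Rightarrow> 'a set \<Rightarrow> 'a set" where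
  "euler a k f B = (\<Union>w\<in>B. solutions a k (w + k *\<^sub>R f))"

text \<open>One step contracts norms by the factor \<open>\<theta> < 1\<close> up to a constant, so bounded sets enter a
  fixed ball, and one more step maps this ball into a compact one.\<close>

theorem euler_attractor:
  assumes a: "a > 0" and X: "V \<subseteq> X"
  shows "\<exists>A. global_attractor X (euler a k f) A"
proof -
  define \<theta> where "\<theta> = 1 / (1 + a / cp\<^sup>2)"
  have "a / cp\<^sup>2 > 0" using a cp by simp
  then have \<theta>: "0 < \<theta>" "\<theta> < 1" by (auto simp: \<theta>_def)
  define q where "q = \<bar>k\<bar> * norm f"
  \<comment> \<open>\<open>\<rho>\<close> bounds the geometric series \<open>\<theta> q + \<theta>\<^sup>2 q + \<dots>\<close> of the accumulated forcing.\<close>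
  define \<rho> where "\<rho> = q / (1 - \<theta>)"
  have q: "0 \<le> q" by (simp add: q_def)
  have \<rho>: "0 \<le> \<rho>" "\<theta> * (\<rho> + q) \<le> \<rho>"
  proof -
    show "0 \<le> \<rho>" using \<theta> q by (simp add: \<rho>_def)
    have "\<rho> * (1 - \<theta>) = q" using \<theta> by (simp add: \<rho>_def)
    moreover have "\<theta> * q \<le> q" using \<theta> q by (simp add: mult_left_le_one_le)
    ultimately show "\<theta> * (\<rho> + q) \<le> \<rho>" by (simp add: algebra_simps)
  qed
  have data: "norm (w + k *\<^sub>R f) \<le> norm w + q" for w
    using norm_triangle_ineq[of w "k *\<^sub>R f"] by (simp add: q_def)
  have step: "norm u \<le> \<theta> * (norm w + q)" if "u \<in> solutions a k (w + k *\<^sub>R f)" for u w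
  proof -
    have "norm u \<le> \<theta> * norm (w + k *\<^sub>R f)" using solutions_contract[OF a that] by (simp add: \<theta>_def)
    also have "\<dots> \<le> \<theta> * (norm w + q)" using \<theta> data by (intro mult_left_mono) auto
    finally show ?thesis .
  qed
  have iter: "norm u \<le> \<theta> ^ n * r + \<rho>" if "B \<subseteq> cball 0 r" "u \<in> (euler a k f ^^ n) B" for B r n u
    using that(2)
  proof (induction n arbitrary: u)
    case 0
    then show ?case using that(1) \<rho>(1) by auto
  next
    case (Suc n)
    then have "u \<in> euler a k f ((euler a k f ^^ n) B)" by simp
    then obtain w where w: "w \<in> (euler a k f ^^ n) B" "u \<in> solutions a k (w + k *\<^sub>R f)"
      unfolding euler_def[of a k f "(euler a k f ^^ n) B"] by blast
    have "norm u \<le> \<theta> * (norm w + q)" by (rule step[OF w(2)])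
    also have "\<dots> \<le> \<theta> * (\<theta> ^ n * r + \<rho> + q)" using Suc.IH[OF w(1)] \<theta> by (intro mult_left_mono) auto
    also have "\<dots> = \<theta> ^ Suc n * r + \<theta> * (\<rho> + q)" by (simp add: algebra_simps)
    finally show ?case using \<rho>(2) by linarith
  qed
  define K where "K = ball_V ((\<rho> + 1 + q) / sqrt a)"
  interpret setvalued_map X "\<lambda>w. solutions a k (w + k *\<^sub>R f)" "euler a k f" K
  proof
    show "euler a k f = (\<lambda>B. \<Union>w\<in>B. solutions a k (w + k *\<^sub>R f))" by (rule ext) (simp add: euler_def)
    show "solutions a k (w + k *\<^sub>R f) \<noteq> {}" for w by (rule solutions_nonempty[OF a])
    show "solutions a k (w + k *\<^sub>R f) \<subseteq> X" for w using X by (auto simp: solutions_def)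
    show "compact K" unfolding K_def by (rule compact_ball_V)
    show "K \<subseteq> X" using X by (auto simp: K_def ball_V_def)
    have "0 \<in> K" using a \<rho> q by (simp add: K_def ball_V_def V_0 D_0)
    then show "K \<noteq> {}" by blast
    show "u0 \<in> solutions a k (w0 + k *\<^sub>R f)"
      if "\<And>n. w n \<in> K \<and> u n \<in> solutions a k (w n + k *\<^sub>R f)" "w \<longlonglongrightarrow> w0" "u \<longlonglongrightarrow> u0" for w u w0 u0
    proof (rule solutions_closed_graph[OF a])
      show "u n \<in> solutions a k (w n + k *\<^sub>R f)" for n using that(1) by blast
      show "(\<lambda>n. w n + k *\<^sub>R f) \<longlonglongrightarrow> w0 + k *\<^sub>R f" by (intro tendsto_add that(2) tendsto_const)
    qed (rule that(3))
    fix B :: "'a set" assume "bounded B"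
    then obtain r where "\<forall>x\<in>B. norm x \<le> r" unfolding bounded_iff by blast
    then have r: "B \<subseteq> cball 0 r" by auto
    have "(\<lambda>n. \<theta> ^ n * r) \<longlonglongrightarrow> 0" by (rule tendsto_mult_left_zero[OF LIMSEQ_realpow_zero]) (use \<theta> in auto)
    then have "\<forall>\<^sub>F n in sequentially. \<theta> ^ n * r < 1" by (rule order_tendstoD) simp
    then obtain N where N: "\<And>n. n \<ge> N \<Longrightarrow> \<theta> ^ n * r < 1" unfolding eventually_sequentially by blast
    have "(euler a k f ^^ n) B \<subseteq> K" if n: "n \<ge> Suc N" for n
    proof
      fix u assume "u \<in> (euler a k f ^^ n) B"
      moreover obtain m where m: "n = Suc m" "m \<ge> N" using n Suc_le_D by blast
      ultimately have "u \<in> euler a k f ((euler a k f ^^ m) B)" by simp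
      then obtain w where w: "w \<in> (euler a k f ^^ m) B" "u \<in> solutions a k (w + k *\<^sub>R f)"
        unfolding euler_def[of a k f "(euler a k f ^^ m) B"] by blast
      have "norm (w + k *\<^sub>R f) \<le> \<rho> + 1 + q"
        using data[of w] iter[OF r w(1)] N[OF m(2)] by linarith
      then show "u \<in> K" unfolding K_def by (rule solutions_in_ball_V[OF a w(2)])
    qed
    then show "\<forall>\<^sub>F n in sequentially. (euler a k f ^^ n) B \<subseteq> K"
      unfolding eventually_sequentially by blast
  qed
  show ?thesis using global_attractor_omega by blast
qed

end

section \<open>Representatives and completeness of \<open>L\<^sup>2\<close>\<close>

lemma square_int_L2_fun: "square_int (L2_fun u)"
  using Quotient3_rep_reflp[OF Quotient3_L2, of u] by (simp add: L2_eq_def)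

lemma measurable_L2_fun [measurable]: "L2_fun u \<in> borel_measurable borel"
  using square_int_L2_fun[of u] by (simp add: square_int_def)

lemma L2_class_L2_fun: "L2_class (L2_fun u) = u"
  by (rule Quotient3_abs_rep[OF Quotient3_L2])

lemma L2_fun_L2_class:
  assumes "square_int f"
  shows "AE x in lborel. L2_fun (L2_class f) x = f x"
  using Quotient3_rep_abs[OF Quotient3_L2, of f] assms by (simp add: L2_eq_def)

lemma L2_class_eqI:
  assumes "square_int f" "square_int g" "AE x in lborel. f x = g x"
  shows "L2_class f = L2_class g"
  using Quotient3_rel_abs[OF Quotient3_L2, of f g] assms by (simp add: L2_eq_def)

lemma L2_eqI: "AE x in lborel. L2_fun u x = L2_fun v x \<Longrightarrow> u = v"
  using L2_class_eqI[of "L2_fun u" "L2_fun v"] by (simp add: square_int_L2_fun L2_class_L2_fun)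

lemma L2_eq_refl: "square_int f \<Longrightarrow> L2_eq f f"
  by (simp add: L2_eq_def)

lemma L2_class_add: "square_int f \<Longrightarrow> square_int g \<Longrightarrow> L2_class f + L2_class g = L2_class (\<lambda>x. f x + g x)"
  by (simp add: plus_L2.abs_eq L2_eq_refl)

lemma L2_class_diff: "square_int f \<Longrightarrow> square_int g \<Longrightarrow> L2_class f - L2_class g = L2_class (\<lambda>x. f x - g x)"
  by (simp add: minus_L2.abs_eq L2_eq_refl)

lemma L2_class_scaleR: "square_int f \<Longrightarrow> c *\<^sub>R L2_class f = L2_class (\<lambda>x. c *\<^sub>R f x)"
  by (simp add: scaleR_L2.abs_eq L2_eq_refl)

lemma L2_class_zero: "0 = L2_class (\<lambda>x. 0)"
  by (rule zero_L2.abs_eq)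

lemma L2_fun_add: "AE x in lborel. L2_fun (u + v) x = L2_fun u x + L2_fun v x"
  using L2_fun_L2_class[OF square_int_add[OF square_int_L2_fun[of u] square_int_L2_fun[of v]]]
  by (simp add: L2_class_add[symmetric] square_int_L2_fun L2_class_L2_fun)

lemma L2_fun_diff: "AE x in lborel. L2_fun (u - v) x = L2_fun u x - L2_fun v x"
  using L2_fun_L2_class[OF square_int_diff[OF square_int_L2_fun[of u] square_int_L2_fun[of v]]]
  by (simp add: L2_class_diff[symmetric] square_int_L2_fun L2_class_L2_fun)

lemma L2_fun_scaleR: "AE x in lborel. L2_fun (c *\<^sub>R u) x = c *\<^sub>R L2_fun u x"
  using L2_fun_L2_class[OF square_int_scaleR[OF square_int_L2_fun[of u], of c]]
  by (simp add: L2_class_scaleR[symmetric] square_int_L2_fun L2_class_L2_fun)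

lemma L2_fun_zero: "AE x in lborel. L2_fun 0 x = 0"
  using L2_fun_L2_class[OF square_int_zero] by (simp add: L2_class_zero)

lemma inner_L2_class:
  assumes "square_int f" "square_int g"
  shows "L2_class f \<bullet> L2_class g = (LINT x|lborel. f x \<bullet> g x)"
  using assms by (simp add: inner_L2.abs_eq L2_eq_refl)

lemma inner_L2: "u \<bullet> v = (LINT x|lborel. L2_fun u x \<bullet> L2_fun v x)"
  using inner_L2_class[OF square_int_L2_fun[of u] square_int_L2_fun[of v]]
  by (simp add: L2_class_L2_fun)

lemma inner_L2_class_right:
  assumes "square_int g"
  shows "u \<bullet> L2_class g = (LINT x|lborel. L2_fun u x \<bullet> g x)"
  using inner_L2_class[OF square_int_L2_fun[of u] assms] by (simp add: L2_class_L2_fun)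

lemma norm_L2_power2: "(norm u)\<^sup>2 = (LINT x|lborel. (norm (L2_fun u x))\<^sup>2)"
  by (simp add: power2_norm_eq_inner inner_L2)

lemma integrable_norm_L2_fun: "integrable lborel (\<lambda>x. (norm (L2_fun u x))\<^sup>2)"
  using square_int_L2_fun[of u] by (simp add: square_int_def)

lemma nn_norm_L2: "(\<integral>\<^sup>+x. ennreal ((norm (L2_fun u x))\<^sup>2) \<partial>lborel) = ennreal ((norm u)\<^sup>2)"
  unfolding norm_L2_power2 by (rule nn_integral_eq_integral[OF integrable_norm_L2_fun]) simp

lemma nn_norm_L2_class:
  assumes "square_int f"
  shows "(\<integral>\<^sup>+x. ennreal ((norm (f x))\<^sup>2) \<partial>lborel) = ennreal ((norm (L2_class f))\<^sup>2)"
  unfolding nn_norm_L2[symmetric]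
  by (rule nn_integral_cong_AE) (use L2_fun_L2_class[OF assms] in auto)

lemma square_intI:
  assumes "f \<in> borel_measurable borel" "(\<integral>\<^sup>+x. ennreal ((norm (f x))\<^sup>2) \<partial>lborel) < \<infinity>"
  shows "square_int f"
  unfolding square_int_def using assms by (auto intro!: integrableI_bounded)

lemma L2_subseq_AE:
  fixes u :: "nat \<Rightarrow> ('a::euclidean_space, 'b::euclidean_space) L2"
  assumes "u \<longlonglongrightarrow> u0"
  obtains r where "strict_mono r" "AE x in lborel. (\<lambda>n. L2_fun (u (r n)) x) \<longlonglongrightarrow> L2_fun u0 x"
proof -
  have "(\<lambda>n. (norm (u n - u0))\<^sup>2) \<longlonglongrightarrow> 0\<^sup>2"
    by (intro tendsto_power) (rule tendsto_norm_zero[OF LIM_zero[OF assms]])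
  then have "(\<lambda>n. LINT x|lborel. norm ((norm (L2_fun (u n - u0) x))\<^sup>2)) \<longlonglongrightarrow> 0"
    by (simp add: norm_L2_power2)
  from tendsto_L1_AE_subseq[OF integrable_norm_L2_fun this]
  obtain r where r: "strict_mono r"
    "AE x in lborel. (\<lambda>n. (norm (L2_fun (u (r n) - u0) x))\<^sup>2) \<longlonglongrightarrow> 0" by blast
  have "AE x in lborel. \<forall>n. L2_fun (u (r n) - u0) x = L2_fun (u (r n)) x - L2_fun u0 x"
    unfolding AE_all_countable by (intro allI L2_fun_diff)
  with r(2) have "AE x in lborel. (\<lambda>n. L2_fun (u (r n)) x) \<longlonglongrightarrow> L2_fun u0 x"
  proof eventually_elim
    case (elim x)
    then have "(\<lambda>n. sqrt ((norm (L2_fun (u (r n)) x - L2_fun u0 x))\<^sup>2)) \<longlonglongrightarrow> sqrt 0"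
      by (intro tendsto_real_sqrt) simp
    then have "(\<lambda>n. norm (L2_fun (u (r n)) x - L2_fun u0 x)) \<longlonglongrightarrow> 0" by simp
    then show ?case by (rule LIM_zero_cancel[OF tendsto_norm_zero_cancel])
  qed
  with r(1) show ?thesis using that by blast
qed

text \<open>Along a subsequence with \<open>norm (u (Suc j) - u j) \<le> (1/2) ^ j\<close> the weighted sum of the squared increments
  is integrable, and \<open>t \<le> (1/2) ^ j + 2 ^ j * t\<^sup>2\<close> turns this into absolute convergence almost everywhere.\<close>

lemma L2_fast_Cauchy_AE:
  fixes u :: "nat \<Rightarrow> ('a::euclidean_space, 'b::euclidean_space) L2"
  assumes "\<And>j. norm (u (Suc j) - u j) \<le> (1/2) ^ j"
  shows "AE x in lborel. convergent (\<lambda>n. L2_fun (u n) x)"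
proof -
  define d where "d j x = norm (L2_fun (u (Suc j) - u j) x)" for j x
  have [measurable]: "d j \<in> borel_measurable borel" for j unfolding d_def by measurable
  have "(\<integral>\<^sup>+x. (\<Sum>j. ennreal (2 ^ j * (d j x)\<^sup>2)) \<partial>lborel) = (\<Sum>j. \<integral>\<^sup>+x. ennreal (2 ^ j * (d j x)\<^sup>2) \<partial>lborel)"
    by (rule nn_integral_suminf) measurable
  also have "\<dots> \<le> (\<Sum>j. ennreal ((1/2) ^ j))"
  proof (rule suminf_le)
    fix j
    have "(\<integral>\<^sup>+x. ennreal (2 ^ j * (d j x)\<^sup>2) \<partial>lborel) = ennreal (2 ^ j) * ennreal ((norm (u (Suc j) - u j))\<^sup>2)"
      unfolding nn_norm_L2[symmetric] d_def by (simp add: ennreal_mult nn_integral_cmult)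
    also have "\<dots> \<le> ennreal (2 ^ j * ((1/2) ^ j)\<^sup>2)"
      using assms[of j] by (simp add: ennreal_mult[symmetric] mult_left_mono power_mono)
    also have "2 ^ j * ((1/2) ^ j)\<^sup>2 = ((1/2) ^ j :: real)"
      by (simp add: power2_eq_square power_mult_distrib[symmetric] mult.assoc[symmetric])
    finally show "(\<integral>\<^sup>+x. ennreal (2 ^ j * (d j x)\<^sup>2) \<partial>lborel) \<le> ennreal ((1/2) ^ j)" .
  qed auto
  also have "\<dots> = ennreal (\<Sum>j. (1/2) ^ j)"
    by (rule suminf_ennreal2) (auto intro: summable_geometric)
  finally have "(\<integral>\<^sup>+x. (\<Sum>j. ennreal (2 ^ j * (d j x)\<^sup>2)) \<partial>lborel) \<noteq> \<infinity>"
    by (auto simp: top_unique)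
  then have "AE x in lborel. (\<Sum>j. ennreal (2 ^ j * (d j x)\<^sup>2)) \<noteq> \<infinity>"
    by (intro nn_integral_PInf_AE) auto
  moreover have "AE x in lborel. \<forall>j. L2_fun (u (Suc j) - u j) x = L2_fun (u (Suc j)) x - L2_fun (u j) x"
    unfolding AE_all_countable by (intro allI L2_fun_diff)
  ultimately show ?thesis
  proof eventually_elim
    case (elim x)
    have "summable (\<lambda>j. 2 ^ j * (d j x)\<^sup>2)"
      using elim(1) by (intro summable_suminf_not_top) auto
    then have "summable (\<lambda>j. (1/2) ^ j + 2 ^ j * (d j x)\<^sup>2)"
      by (intro summable_add summable_geometric) auto
    then have "summable (\<lambda>j. L2_fun (u (Suc j)) x - L2_fun (u j) x)"
    proof (rule summable_comparison_test[rotated], intro exI allI impI)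
      fix j
      have "d j x \<le> (1/2) ^ j + 2 ^ j * (d j x)\<^sup>2"
      proof (cases "2 ^ j * d j x \<le> 1")
        case True
        then have "d j x \<le> (1/2) ^ j" by (simp add: field_simps)
        moreover have "0 \<le> 2 ^ j * (d j x)\<^sup>2" by simp
        ultimately show ?thesis by linarith
      next
        case False
        then have "1 * d j x \<le> (2 ^ j * d j x) * d j x"
          by (intro mult_right_mono) (auto simp: d_def)
        moreover have "0 \<le> (1/2 :: real) ^ j" by simp
        ultimately show ?thesis unfolding power2_eq_square mult.assoc by linarith
      qed
      then show "norm (L2_fun (u (Suc j)) x - L2_fun (u j) x) \<le> (1/2) ^ j + 2 ^ j * (d j x)\<^sup>2"
        using elim(2) by (simp add: d_def)
    qed
    then have "convergent (\<lambda>n. \<Sum>j<n. L2_fun (u (Suc j)) x - L2_fun (u j) x)"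
      by (simp add: summable_iff_convergent)
    then have "convergent (\<lambda>n. L2_fun (u n) x - L2_fun (u 0) x)"
      by (simp only: sum_lessThan_telescope[of "\<lambda>j. L2_fun (u j) x"])
    then have "convergent (\<lambda>n. (L2_fun (u n) x - L2_fun (u 0) x) + L2_fun (u 0) x)"
      by (rule convergent_add[OF _ convergent_const])
    then show ?case by simp
  qed
qed

text \<open>The Riesz-Fischer theorem: a fast subsequence converges almost everywhere, and Fatou's lemma shows that its
  limit is also the limit in norm.\<close>

instance L2 :: (euclidean_space, euclidean_space) complete_space
proof
  fix X :: "nat \<Rightarrow> ('a, 'b) L2"
  assume X: "Cauchy X"
  obtain r where r: "strict_mono r" "\<And>j. norm (X (r (Suc j)) - X (r j)) \<le> (1/2) ^ j"
  proof -
    have "\<forall>j. \<exists>N. \<forall>m\<ge>N. \<forall>n\<ge>N. dist (X m) (X n) < (1/2) ^ j"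
      using metric_CauchyD[OF X] by simp
    then obtain N where N: "\<And>j m n. m \<ge> N j \<Longrightarrow> n \<ge> N j \<Longrightarrow> dist (X m) (X n) < (1/2) ^ j" by metis
    define r where "r = rec_nat (N 0) (\<lambda>j k. Suc (max k (N (Suc j))))"
    have r_Suc: "r (Suc j) = Suc (max (r j) (N (Suc j)))" for j by (simp add: r_def)
    have r_N: "r j \<ge> N j" for j by (cases j) (auto simp: r_def)
    have mono: "strict_mono r" by (rule strict_monoI_Suc) (simp add: r_Suc)
    have "norm (X (r (Suc j)) - X (r j)) \<le> (1/2) ^ j" for j
    proof -
      have "r (Suc j) \<ge> N j" using r_N[of j] by (simp add: r_Suc)
      then show ?thesis using N[of j "r (Suc j)" "r j"] r_N[of j] by (simp add: dist_norm less_imp_le)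
    qed
    with mono show ?thesis using that by blast
  qed
  define u where "u j = X (r j)" for j
  have "Cauchy u" using Cauchy_subseq_Cauchy[OF X r(1)] by (simp add: u_def[abs_def] o_def)
  define g where "g x = lim (\<lambda>n. L2_fun (u n) x)" for x
  have [measurable]: "g \<in> borel_measurable borel" unfolding g_def by measurable
  have g: "AE x in lborel. (\<lambda>n. L2_fun (u n) x) \<longlonglongrightarrow> g x"
    using L2_fast_Cauchy_AE[of u] r(2) unfolding u_def g_def by (auto simp: convergent_LIMSEQ_iff)
  have fatou: "(\<integral>\<^sup>+x. ennreal ((norm (L2_fun (u n) x - g x))\<^sup>2) \<partial>lborel) \<le> ennreal (e\<^sup>2)"
    if "\<And>m. m \<ge> n \<Longrightarrow> dist (u n) (u m) \<le> e" for n e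
  proof -
    have "(\<integral>\<^sup>+x. ennreal ((norm (L2_fun (u n) x - g x))\<^sup>2) \<partial>lborel)
       = (\<integral>\<^sup>+x. liminf (\<lambda>m. ennreal ((norm (L2_fun (u n - u m) x))\<^sup>2)) \<partial>lborel)"
    proof (rule nn_integral_cong_AE)
      have "AE x in lborel. \<forall>m. L2_fun (u n - u m) x = L2_fun (u n) x - L2_fun (u m) x"
        unfolding AE_all_countable by (intro allI L2_fun_diff)
      with g show "AE x in lborel. ennreal ((norm (L2_fun (u n) x - g x))\<^sup>2)
          = liminf (\<lambda>m. ennreal ((norm (L2_fun (u n - u m) x))\<^sup>2))"
      proof eventually_elim
        case (elim x)
        have "(\<lambda>m. ennreal ((norm (L2_fun (u n) x - L2_fun (u m) x))\<^sup>2))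
            \<longlonglongrightarrow> ennreal ((norm (L2_fun (u n) x - g x))\<^sup>2)"
          by (intro tendsto_ennrealI tendsto_intros elim(1))
        from lim_imp_Liminf[OF sequentially_bot this] show ?case using elim(2) by simp
      qed
    qed
    also have "\<dots> \<le> liminf (\<lambda>m. \<integral>\<^sup>+x. ennreal ((norm (L2_fun (u n - u m) x))\<^sup>2) \<partial>lborel)"
      by (rule nn_integral_liminf) measurable
    also have "\<dots> = liminf (\<lambda>m. ennreal ((norm (u n - u m))\<^sup>2))" by (simp add: nn_norm_L2)
    also have "\<dots> \<le> ennreal (e\<^sup>2)"
    proof (rule Liminf_le)
      show "\<forall>\<^sub>F m in sequentially. ennreal ((norm (u n - u m))\<^sup>2) \<le> ennreal (e\<^sup>2)"
        unfolding eventually_sequentially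
        by (intro exI[of _ n] allI impI ennreal_leI power_mono) (use that in \<open>auto simp: dist_norm\<close>)
    qed simp
    finally show ?thesis .
  qed
  have sq: "square_int (\<lambda>x. L2_fun (u n) x - g x)" for n
  proof -
    obtain N where N: "\<forall>m\<ge>N. dist (u N) (u m) < 1"
      using metric_CauchyD[OF \<open>Cauchy u\<close>, of 1] by (auto intro: order_refl)
    have "square_int (\<lambda>x. L2_fun (u N) x - g x)"
      by (rule square_intI) (use N fatou[of N 1] in \<open>auto simp: less_imp_le intro: le_less_trans\<close>)
    from square_int_add[OF this square_int_diff[OF square_int_L2_fun[of "u n"] square_int_L2_fun[of "u N"]]]
    show ?thesis by (simp add: algebra_simps)
  qed
  have sq_g: "square_int g"
    using square_int_diff[OF square_int_L2_fun[of "u 0"] sq[of 0]] by simp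
  have "u \<longlonglongrightarrow> L2_class g"
  proof (rule metric_LIMSEQ_I)
    fix e :: real assume "0 < e"
    then obtain N where N: "\<And>m n. m \<ge> N \<Longrightarrow> n \<ge> N \<Longrightarrow> dist (u m) (u n) < e / 2"
      using metric_CauchyD[OF \<open>Cauchy u\<close>, of "e / 2"] by auto
    have "dist (u n) (L2_class g) < e" if "n \<ge> N" for n
    proof -
      have "u n - L2_class g = L2_class (\<lambda>x. L2_fun (u n) x - g x)"
        using L2_class_diff[OF square_int_L2_fun[of "u n"] sq_g] by (simp add: L2_class_L2_fun)
      then have "ennreal ((norm (u n - L2_class g))\<^sup>2) \<le> ennreal ((e / 2)\<^sup>2)"
        using fatou[of n "e / 2"] N that by (simp add: nn_norm_L2_class[OF sq] less_imp_le del: power_divide)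
      then have "(norm (u n - L2_class g))\<^sup>2 \<le> (e / 2)\<^sup>2" by (subst (asm) ennreal_le_iff) auto
      then have "norm (u n - L2_class g) \<le> e / 2"
        by (rule power2_le_imp_le) (use \<open>0 < e\<close> in simp)
      then show ?thesis using \<open>0 < e\<close> by (simp add: dist_norm)
    qed
    then show "\<exists>N. \<forall>n\<ge>N. dist (u n) (L2_class g) < e" by blast
  qed
  moreover have "u = X \<circ> r" by (simp add: u_def[abs_def] o_def)
  ultimately have "X \<longlonglongrightarrow> L2_class g" using Cauchy_converges_subseq[OF X r(1)] by simp
  then show "convergent X" by (rule convergentI)
qed

section \<open>Smooth functions\<close>

lemma frechet_derivative_eqI: "(f has_derivative f') (at x) \<Longrightarrow> frechet_derivative f (at x) = f'"
  by (rule frechet_derivative_at[symmetric])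

lemma Ck_SucI:
  assumes "\<And>x. (f has_derivative f' x) (at x)" "\<And>e. e \<in> Basis \<Longrightarrow> Ck n (\<lambda>x. f' x e)"
  shows "Ck (Suc n) f"
proof -
  have "frechet_derivative f (at x) = f' x" for x by (rule frechet_derivative_eqI[OF assms(1)])
  then show ?thesis using assms by (auto simp: differentiable_on_def differentiable_def intro: has_derivative_at_withinI)
qed

lemma Ck_SucD:
  assumes "Ck (Suc n) f"
  shows "(f has_derivative frechet_derivative f (at x)) (at x)"
    "e \<in> Basis \<Longrightarrow> Ck n (\<lambda>x. frechet_derivative f (at x) e)"
  using assms by (auto simp: differentiable_on_def frechet_derivative_works)

lemma Ck_cong: assumes "Ck n f" "\<And>x. f x = g x" shows "Ck n g"
proof -
  have "f = g" by (rule ext) (rule assms(2))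
  then show ?thesis using assms(1) by simp
qed

lemma Ck_const: "Ck n (\<lambda>x. c)"
proof (induction n arbitrary: c)
  case (Suc n)
  show ?case by (rule Ck_SucI[where f' = "\<lambda>_ _. 0"]) (auto intro: Suc)
qed simp

lemma Ck_bounded_linear:
  assumes "bounded_linear h"
  shows "Ck n f \<Longrightarrow> Ck n (\<lambda>x. h (f x))"
proof (induction n arbitrary: f)
  case 0
  then have "continuous_on UNIV f" by simp
  from bounded_linear.continuous_on[OF assms this] show ?case by simp
next
  case (Suc n)
  show ?case
  proof (rule Ck_SucI)
    show "((\<lambda>x. h (f x)) has_derivative (\<lambda>e. h (frechet_derivative f (at x) e))) (at x)" for x
      by (rule bounded_linear.has_derivative[OF assms Ck_SucD(1)[OF Suc.prems]])
    show "Ck n (\<lambda>x. h (frechet_derivative f (at x) e))" if "e \<in> Basis" for e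
      by (rule Suc.IH[OF Ck_SucD(2)[OF Suc.prems that]])
  qed
qed

lemma Ck_add: "Ck n f \<Longrightarrow> Ck n g \<Longrightarrow> Ck n (\<lambda>x. f x + g x)"
proof (induction n arbitrary: f g)
  case 0
  then show ?case by (auto intro: continuous_on_add)
next
  case (Suc n)
  show ?case
    by (rule Ck_SucI[OF has_derivative_add[OF Ck_SucD(1)[OF Suc.prems(1)] Ck_SucD(1)[OF Suc.prems(2)]]])
       (rule Suc.IH[OF Ck_SucD(2)[OF Suc.prems(1)] Ck_SucD(2)[OF Suc.prems(2)]])
qed

lemma Ck_Suc_imp: "Ck (Suc n) f \<Longrightarrow> Ck n f"
proof (induction n arbitrary: f)
  case 0
  then have "f differentiable_on UNIV" by simp
  then show ?case by (auto intro: differentiable_imp_continuous_on)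
next
  case (Suc n)
  show ?case by (rule Ck_SucI[OF Ck_SucD(1)[OF Suc.prems]]) (rule Suc.IH[OF Ck_SucD(2)[OF Suc.prems]])
qed

lemma Ck_mult:
  fixes f g :: "'a::euclidean_space \<Rightarrow> real"
  shows "Ck n f \<Longrightarrow> Ck n g \<Longrightarrow> Ck n (\<lambda>x. f x * g x)"
proof (induction n arbitrary: f g)
  case 0
  then show ?case by (auto intro: continuous_on_mult)
next
  case (Suc n)
  show ?case
  proof (rule Ck_SucI[OF has_derivative_mult[OF Ck_SucD(1)[OF Suc.prems(1)] Ck_SucD(1)[OF Suc.prems(2)]]])
    fix e :: 'a assume e: "e \<in> Basis"
    show "Ck n (\<lambda>x. f x * frechet_derivative g (at x) e + frechet_derivative f (at x) e * g x)"
      by (rule Ck_add[OF Suc.IH[OF Ck_Suc_imp[OF Suc.prems(1)] Ck_SucD(2)[OF Suc.prems(2) e]]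
            Suc.IH[OF Ck_SucD(2)[OF Suc.prems(1) e] Ck_Suc_imp[OF Suc.prems(2)]]])
  qed
qed

lemma Ck_prod:
  fixes f :: "'i \<Rightarrow> 'a::euclidean_space \<Rightarrow> real"
  shows "(\<And>i. i \<in> I \<Longrightarrow> Ck n (f i)) \<Longrightarrow> Ck n (\<lambda>x. \<Prod>i\<in>I. f i x)"
  by (induction I rule: infinite_finite_induct) (auto intro: Ck_const Ck_mult)

lemma smooth_add: "smooth f \<Longrightarrow> smooth g \<Longrightarrow> smooth (\<lambda>x. f x + g x)"
  by (simp add: smooth_def Ck_add)

lemma smooth_bounded_linear: "bounded_linear h \<Longrightarrow> smooth f \<Longrightarrow> smooth (\<lambda>x. h (f x))"
  by (simp add: smooth_def Ck_bounded_linear)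

lemma smooth_Ck: "smooth f \<Longrightarrow> Ck n f"
  by (simp add: smooth_def)

lemma smooth_deriv:
  assumes "smooth f" "e \<in> Basis" shows "smooth (\<lambda>x. frechet_derivative f (at x) e)"
  unfolding smooth_def by (intro allI Ck_SucD(2)[OF smooth_Ck[OF assms(1)] assms(2)])

lemma smooth_has_derivative: "smooth f \<Longrightarrow> (f has_derivative frechet_derivative f (at x)) (at x)"
  by (rule Ck_SucD(1)[OF smooth_Ck[of f "Suc 0"]])

lemma smooth_continuous: "smooth f \<Longrightarrow> continuous_on S f"
  using smooth_Ck[of f 0] by (auto intro: continuous_on_subset)

section \<open>Bump functions\<close>

text \<open>The family is closed under differentiation up to linear combinations:
  \<open>(flat m)' = flat (m + 2) - m * flat (m + 1)\<close>.\<close>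

definition flat :: "nat \<Rightarrow> real \<Rightarrow> real" where
  "flat m t = (if t > 0 then inverse t ^ m * exp (- inverse t) else 0)"

lemma flat_tendsto_0: "(flat m \<longlongrightarrow> 0) (at_right 0)"
proof -
  have "((\<lambda>y::real. y ^ m / exp y) \<longlongrightarrow> 0) at_top" by (rule tendsto_power_div_exp_0)
  then have "((\<lambda>t. inverse t ^ m / exp (inverse t)) \<longlongrightarrow> 0) (at_right (0::real))"
    by (rule filterlim_compose) (rule filterlim_inverse_at_top_right)
  moreover have "\<forall>\<^sub>F t in at_right (0::real). inverse t ^ m / exp (inverse t) = flat m t"
    using eventually_at_right_less
    by eventually_elim (simp add: flat_def exp_minus divide_inverse)
  ultimately show ?thesis by (rule Lim_transform_eventually)
qed

lemma flat_has_derivative: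
  "(flat m has_real_derivative (flat (m + 2) t - m * flat (m + 1) t)) (at t)"
proof -
  consider "t > 0" | "t < 0" | "t = 0" by linarith
  then show ?thesis
  proof cases
    case 1
    define s where "s = inverse t"
    have d: "(inverse has_real_derivative - (s\<^sup>2)) (at t)"
      using DERIV_inverse[of t] 1 by (simp add: s_def numeral_2_eq_2)
    have "((\<lambda>t. inverse t ^ m * exp (- inverse t)) has_real_derivative
        (real m * (- (s\<^sup>2) * s ^ (m - Suc 0))) * exp (- s) + (exp (- s) * (- (- (s\<^sup>2)))) * s ^ m) (at t)"
      using DERIV_mult[OF DERIV_power[OF d, of m] DERIV_fun_exp[OF DERIV_minus[OF d]]]
      by (simp only: s_def)
    also have "(real m * (- (s\<^sup>2) * s ^ (m - Suc 0))) * exp (- s) + (exp (- s) * (- (- (s\<^sup>2)))) * s ^ m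
        = flat (m + 2) t - m * flat (m + 1) t"
    proof (cases m)
      case 0
      then show ?thesis using 1 by (simp add: flat_def s_def power2_eq_square)
    next
      case (Suc k)
      then show ?thesis using 1 by (simp add: flat_def s_def[symmetric] power2_eq_square algebra_simps)
    qed
    finally have "((\<lambda>t. inverse t ^ m * exp (- inverse t)) has_real_derivative
        (flat (m + 2) t - m * flat (m + 1) t)) (at t)" .
    then show ?thesis
      by (rule has_field_derivative_transform_within_open[of _ _ _ "{0<..}"])
         (use 1 in \<open>auto simp: flat_def\<close>)
  next
    case 2
    have "((\<lambda>_. 0) has_real_derivative 0) (at t)" by simp
    then have "(flat m has_real_derivative 0) (at t)"
      by (rule has_field_derivative_transform_within_open[of _ _ _ "{..<0}"])
         (use 2 in \<open>auto simp: flat_def\<close>)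
    then show ?thesis using 2 by (simp add: flat_def)
  next
    case 3
    have "\<forall>\<^sub>F h in at_right (0::real). flat (Suc m) h = (flat m h - flat m 0) / h"
      using eventually_at_right_less
      by eventually_elim (simp add: flat_def divide_inverse mult_ac)
    with flat_tendsto_0[of "Suc m"]
    have "((\<lambda>h. (flat m h - flat m 0) / h) \<longlongrightarrow> 0) (at_right 0)"
      by (rule Lim_transform_eventually)
    moreover have "\<forall>\<^sub>F h in at_left (0::real). 0 = (flat m h - flat m 0) / h"
      using eventually_at_leftI[of "-1" "0::real" "\<lambda>h. h < 0"]
      by (auto simp: flat_def elim!: eventually_mono)
    with tendsto_const have "((\<lambda>h. (flat m h - flat m 0) / h) \<longlongrightarrow> 0) (at_left 0)"
      by (rule Lim_transform_eventually)
    ultimately have "((\<lambda>h. (flat m h - flat m 0) / h) \<longlongrightarrow> 0) (at 0)"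
      using filterlim_split_at by blast
    then show ?thesis unfolding 3 by (simp add: has_field_derivative_iff flat_def)
  qed
qed

lemma flat_eq_0: "t \<le> 0 \<Longrightarrow> flat m t = 0"
  and flat_nonneg: "flat 0 t \<ge> 0" and flat_le_1: "flat 0 t \<le> 1"
  by (auto simp: flat_def)

text \<open>All members of the family are treated at once, because differentiation leads from one to others.\<close>

lemma Ck_flat_affine: "Ck n (\<lambda>x. flat m (x \<bullet> e + c))"
proof (induction n arbitrary: m)
  case 0
  have "continuous_on UNIV (flat m)"
    by (intro continuous_at_imp_continuous_on ballI DERIV_isCont[OF flat_has_derivative])
  moreover have "continuous_on UNIV (\<lambda>x. x \<bullet> e + c)" by (intro continuous_intros)
  ultimately show ?case unfolding Ck.simps by (rule continuous_on_compose2) simp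
next
  case (Suc n)
  show ?case
  proof (rule Ck_SucI)
    fix x
    have "((\<lambda>x. x \<bullet> e + c) has_derivative (\<lambda>h. h \<bullet> e)) (at x)"
      by (auto intro!: derivative_eq_intros)
    from has_derivative_compose[OF this flat_has_derivative[of m "x \<bullet> e + c", unfolded has_field_derivative_def]]
    show "((\<lambda>x. flat m (x \<bullet> e + c)) has_derivative
      (\<lambda>h. (flat (m + 2) (x \<bullet> e + c) - m * flat (m + 1) (x \<bullet> e + c)) * (h \<bullet> e))) (at x)" .
  next
    fix i
    have "Ck n (\<lambda>x. (flat (m + 2) (x \<bullet> e + c) + (- real m) * flat (m + 1) (x \<bullet> e + c)) * (i \<bullet> e))"
      by (intro Ck_mult Ck_add Ck_const Suc)
    then show "Ck n (\<lambda>x. (flat (m + 2) (x \<bullet> e + c) - m * flat (m + 1) (x \<bullet> e + c)) * (i \<bullet> e))"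
      by (rule Ck_cong) simp
  qed
qed

text \<open>The shift by one keeps the supports inside slightly smaller closed boxes.\<close>

definition bump :: "'a::euclidean_space \<Rightarrow> 'a \<Rightarrow> nat \<Rightarrow> 'a \<Rightarrow> real" where
  "bump a b n x = (\<Prod>i\<in>Basis. flat 0 (n * (x \<bullet> i - a \<bullet> i) - 1) * flat 0 (n * (b \<bullet> i - x \<bullet> i) - 1))"

lemma smooth_bump: "smooth (bump a b n)"
  unfolding smooth_def
proof
  fix k
  have "Ck k (\<lambda>x. \<Prod>i\<in>Basis. flat 0 (x \<bullet> (n *\<^sub>R i) + (- (n * (a \<bullet> i)) - 1))
      * flat 0 (x \<bullet> (- n *\<^sub>R i) + (n * (b \<bullet> i) - 1)))"
    by (intro Ck_prod Ck_mult Ck_flat_affine)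
  then show "Ck k (bump a b n)"
    by (rule Ck_cong) (simp add: bump_def algebra_simps)
qed

lemma bump_bounds: "0 \<le> bump a b n x" "bump a b n x \<le> 1"
  unfolding bump_def by (auto intro!: prod_nonneg prod_le_1 mult_nonneg_nonneg mult_le_one flat_nonneg flat_le_1)

lemma bump_support:
  assumes "bump a b n x \<noteq> 0"
  shows "n > 0" "x \<in> cbox (a + (inverse n) *\<^sub>R One) (b - (inverse n) *\<^sub>R One)"
proof -
  have nz: "flat 0 (n * (x \<bullet> i - a \<bullet> i) - 1) \<noteq> 0 \<and> flat 0 (n * (b \<bullet> i - x \<bullet> i) - 1) \<noteq> 0" if "i \<in> Basis" for i
    using assms that by (auto simp: bump_def)
  then have *: "n * (x \<bullet> i - a \<bullet> i) > 1 \<and> n * (b \<bullet> i - x \<bullet> i) > 1" if "i \<in> Basis" for i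
    using that flat_eq_0 by (smt (verit))
  obtain i :: 'a where "i \<in> Basis" using nonempty_Basis by blast
  then show n: "n > 0" using *[of i] by (cases n) auto
  show "x \<in> cbox (a + (inverse n) *\<^sub>R One) (b - (inverse n) *\<^sub>R One)"
    using * n by (auto simp: mem_box inner_simps field_simps less_imp_le)
qed

lemma bump_test_function:
  assumes "box a b \<subseteq> \<Omega>"
  shows "bump a b n \<in> test_functions \<Omega>"
proof -
  let ?C = "cbox (a + (inverse n) *\<^sub>R One) (b - (inverse n) *\<^sub>R One)"
  have sub: "closure {x. bump a b n x \<noteq> 0} \<subseteq> ?C"
    by (rule closure_minimal) (use bump_support in auto)
  have "closure {x. bump a b n x \<noteq> 0} \<subseteq> \<Omega>"
  proof (cases "n > 0")
    case True
    then have "?C \<subseteq> box a b" by (auto simp: mem_box inner_simps) (smt (verit) inverse_positive_iff_positive of_nat_0_less_iff)+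
    then show ?thesis using sub assms by blast
  next
    case False
    then have "{x. bump a b n x \<noteq> 0} = {}" using bump_support(1) by blast
    then show ?thesis by simp
  qed
  moreover have "compact (closure {x. bump a b n x \<noteq> 0})"
    using sub bounded_subset[OF bounded_cbox] by (meson closed_closure compact_eq_bounded_closed)
  ultimately show ?thesis by (simp add: test_functions_def smooth_bump)
qed

lemma flat_scaled_tendsto:
  assumes "t > 0" shows "(\<lambda>n. flat 0 (real n * t - 1)) \<longlonglongrightarrow> 1"
proof -
  have top: "filterlim (\<lambda>n. real n * t - 1) at_top sequentially"
  proof -
    have "filterlim (\<lambda>n. real n * t) at_top sequentially"
      by (rule filterlim_at_top_mult_tendsto_pos[OF tendsto_const[of t] assms filterlim_real_sequentially])
    from filterlim_tendsto_add_at_top[OF tendsto_const[of "-1 :: real"] this] show ?thesis by simp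
  qed
  from top have "((\<lambda>n. inverse (real n * t - 1)) \<longlongrightarrow> 0) sequentially"
    by (rule tendsto_inverse_0_at_top)
  then have "(\<lambda>n. exp (- inverse (real n * t - 1))) \<longlonglongrightarrow> exp (- 0)"
    by (intro tendsto_intros)
  then have "(\<lambda>n. exp (- inverse (real n * t - 1))) \<longlonglongrightarrow> 1" by simp
  moreover have "\<forall>\<^sub>F n in sequentially. exp (- inverse (real n * t - 1)) = flat 0 (real n * t - 1)"
    using top[unfolded filterlim_at_top_dense, rule_format, of 0]
    by eventually_elim (simp add: flat_def)
  ultimately show ?thesis by (rule Lim_transform_eventually)
qed

lemma bump_tendsto: "(\<lambda>n. bump a b n x) \<longlonglongrightarrow> indicator (box a b) x"
proof (cases "x \<in> box a b")
  case True
  have "(\<lambda>n. bump a b n x) \<longlonglongrightarrow> (\<Prod>i\<in>(Basis::'a set). 1 * 1)"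
    unfolding bump_def
    by (intro tendsto_prod tendsto_mult flat_scaled_tendsto) (use True in \<open>auto simp: mem_box\<close>)
  then show ?thesis using True by simp
next
  case False
  then obtain i where i: "i \<in> Basis" "x \<bullet> i \<le> a \<bullet> i \<or> b \<bullet> i \<le> x \<bullet> i" by (force simp: mem_box)
  have "flat 0 (n * (x \<bullet> i - a \<bullet> i) - 1) * flat 0 (n * (b \<bullet> i - x \<bullet> i) - 1) = 0" for n :: nat
  proof -
    have "n * (x \<bullet> i - a \<bullet> i) - 1 \<le> 0 \<or> n * (b \<bullet> i - x \<bullet> i) - 1 \<le> 0"
      using i(2) by (smt (verit) mult_nonneg_nonpos of_nat_0_le_iff)
    then show ?thesis using flat_eq_0 by auto
  qed
  then have "bump a b n x = 0" for n unfolding bump_def using i(1) by (intro prod_zero) auto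
  then show ?thesis using False by simp
qed

section \<open>Integration in the plane\<close>

definition pt :: "real \<Rightarrow> real \<Rightarrow> real^2" where "pt s t = s *\<^sub>R axis 1 1 + t *\<^sub>R axis 2 1"

lemma pt_nth [simp]: "pt s t $ 1 = s" "pt s t $ 2 = t"
  by (simp_all add: pt_def axis_def)

lemma measurable_pt [measurable]: "(\<lambda>p. pt (fst p) (snd p)) \<in> borel_measurable borel"
  unfolding pt_def by (intro borel_measurable_continuous_onI continuous_intros)

lemma measurable_pt' [measurable (raw)]:
  assumes [measurable]: "f \<in> borel_measurable M" "g \<in> borel_measurable M"
  shows "(\<lambda>x. pt (f x) (g x)) \<in> borel_measurable M"
  unfolding pt_def by measurable

text \<open>Transfers Fubini's theorem from pairs to vectors with two components.\<close>

lemma lborel_plane: "distr (lborel :: (real \<times> real) measure) borel (\<lambda>p. pt (fst p) (snd p)) = lborel"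
proof (rule lborel_eqI[symmetric])
  fix l u :: "real^2"
  assume le: "\<And>b. b \<in> Basis \<Longrightarrow> l \<bullet> b \<le> u \<bullet> b"
  have B: "(Basis :: (real^2) set) = {axis 1 1, axis 2 1}"
    by (auto simp: Basis_vec_def UNIV_2)
  have ne: "axis 1 1 \<noteq> (axis 2 1 :: real^2)" by (simp add: axis_eq_axis)
  have "(\<lambda>p. pt (fst p) (snd p)) -` box l u = box (l $ 1, l $ 2) (u $ 1, u $ 2)"
    by (auto simp: mem_box B Basis_prod_def inner_axis)
  then have "emeasure (distr lborel borel (\<lambda>p. pt (fst p) (snd p))) (box l u)
      = emeasure lborel (box (l $ 1, l $ 2) (u $ 1, u $ 2))"
    by (subst emeasure_distr) auto
  also have "\<dots> = ennreal ((u $ 1 - l $ 1) * (u $ 2 - l $ 2))"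
  proof -
    have "l $ 1 \<le> u $ 1" "l $ 2 \<le> u $ 2" using le[of "axis 1 1"] le[of "axis 2 1"] B by (auto simp: inner_axis)
    moreover have "box (l $ 1, l $ 2) (u $ 1, u $ 2) = box (l $ 1) (u $ 1) \<times> box (l $ 2) (u $ 2)"
      by (auto simp: mem_box Basis_prod_def)
    ultimately show ?thesis
      by (simp add: lborel_prod[symmetric] lborel.emeasure_pair_measure_Times ennreal_mult)
  qed
  also have "(u $ 1 - l $ 1) * (u $ 2 - l $ 2) = (\<Prod>b\<in>Basis. (u - l) \<bullet> b)"
    unfolding B using ne by (simp add: inner_axis)
  finally show "emeasure (distr lborel borel (\<lambda>p. pt (fst p) (snd p))) (box l u)
      = ennreal (\<Prod>b\<in>Basis. (u - l) \<bullet> b)" .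
qed simp

lemma nn_integral_plane:
  assumes [measurable]: "f \<in> borel_measurable borel"
  shows "(\<integral>\<^sup>+x. f x \<partial>lborel) = (\<integral>\<^sup>+s. \<integral>\<^sup>+t. f (pt s t) \<partial>lborel \<partial>lborel)"
    "(\<integral>\<^sup>+x. f x \<partial>lborel) = (\<integral>\<^sup>+t. \<integral>\<^sup>+s. f (pt s t) \<partial>lborel \<partial>lborel)"
proof -
  have "(\<integral>\<^sup>+x. f x \<partial>lborel) = (\<integral>\<^sup>+p. f (pt (fst p) (snd p)) \<partial>(lborel \<Otimes>\<^sub>M lborel))"
    unfolding lborel_prod by (subst lborel_plane[symmetric]) (simp add: nn_integral_distr)
  moreover have "(\<lambda>p. f (pt (fst p) (snd p))) \<in> borel_measurable (lborel \<Otimes>\<^sub>M lborel)"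
    unfolding lborel_prod by measurable
  from lborel.nn_integral_fst[OF this] lborel_pair.nn_integral_snd[OF this]
  have "(\<integral>\<^sup>+p. f (pt (fst p) (snd p)) \<partial>(lborel \<Otimes>\<^sub>M lborel)) = (\<integral>\<^sup>+s. \<integral>\<^sup>+t. f (pt s t) \<partial>lborel \<partial>lborel)"
    "(\<integral>\<^sup>+p. f (pt (fst p) (snd p)) \<partial>(lborel \<Otimes>\<^sub>M lborel)) = (\<integral>\<^sup>+t. \<integral>\<^sup>+s. f (pt s t) \<partial>lborel \<partial>lborel)"
    by simp_all
  ultimately show "(\<integral>\<^sup>+x. f x \<partial>lborel) = (\<integral>\<^sup>+s. \<integral>\<^sup>+t. f (pt s t) \<partial>lborel \<partial>lborel)"
    "(\<integral>\<^sup>+x. f x \<partial>lborel) = (\<integral>\<^sup>+t. \<integral>\<^sup>+s. f (pt s t) \<partial>lborel \<partial>lborel)"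
    by simp_all
qed

text \<open>The Cauchy-Schwarz inequality in \<open>L\<^sup>2\<close> for the field and a constant on \<open>A\<close>.\<close>

lemma norm_integral_power2_le:
  fixes f :: "'a::euclidean_space \<Rightarrow> 'b::euclidean_space"
  assumes A [measurable]: "A \<in> sets borel" "emeasure lborel A = ennreal m" "m \<ge> 0"
    and f: "square_int (\<lambda>x. indicator A x *\<^sub>R f x)"
  shows "integrable lborel (\<lambda>x. indicator A x *\<^sub>R f x)"
    "ennreal ((norm (LINT x|lborel. indicator A x *\<^sub>R f x))\<^sup>2)
      \<le> ennreal m * (\<integral>\<^sup>+x. indicator A x * ennreal ((norm (f x))\<^sup>2) \<partial>lborel)"
proof -
  let ?f = "\<lambda>x. indicator A x *\<^sub>R f x"
  have [measurable]: "?f \<in> borel_measurable borel" using f by (simp add: square_int_def)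
  have const: "square_int (\<lambda>x. indicator A x *\<^sub>R v)" for v :: 'b
  proof (rule square_intI)
    have "(\<integral>\<^sup>+x. ennreal ((norm (indicator A x *\<^sub>R v))\<^sup>2) \<partial>lborel) = (\<integral>\<^sup>+x. ennreal ((norm v)\<^sup>2) * indicator A x \<partial>lborel)"
      by (intro nn_integral_cong) (auto split: split_indicator)
    then show "(\<integral>\<^sup>+x. ennreal ((norm (indicator A x *\<^sub>R v))\<^sup>2) \<partial>lborel) < \<infinity>"
      by (simp add: nn_integral_cmult_indicator A ennreal_mult[symmetric])
  qed measurable
  show int: "integrable lborel ?f"
  proof (rule Bochner_Integration.integrable_bound)
    have "integrable lborel (indicator A :: 'a \<Rightarrow> real)" using A by (simp add: integrable_indicator_iff)
    then show "integrable lborel (\<lambda>x. indicator A x + (norm (?f x))\<^sup>2)"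
      using f by (intro Bochner_Integration.integrable_add) (auto simp: square_int_def)
    have "t \<le> 1 + t\<^sup>2" for t :: real
      using sum_squares_ge_zero[of "t - 1/2" 0]
      by (simp add: power2_eq_square algebra_simps)
    then show "AE x in lborel. norm (?f x) \<le> norm (indicator A x + (norm (?f x))\<^sup>2)"
      by (intro AE_I2) (auto split: split_indicator)
  qed measurable
  define v where "v = (LINT x|lborel. ?f x)"
  have "(norm v)\<^sup>2 = (LINT x|lborel. v \<bullet> ?f x)"
    unfolding v_def by (subst integral_inner_right) (use int in \<open>auto simp: power2_norm_eq_inner\<close>)
  also have "\<dots> = (LINT x|lborel. ?f x \<bullet> (indicator A x *\<^sub>R v))"
    by (intro Bochner_Integration.integral_cong) (auto split: split_indicator simp: inner_commute)
  also have "\<dots> = L2_class ?f \<bullet> L2_class (\<lambda>x. indicator A x *\<^sub>R v)"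
    by (simp add: inner_L2_class f const)
  also have "\<dots> \<le> norm (L2_class ?f) * norm (L2_class (\<lambda>x. indicator A x *\<^sub>R v))"
    by (rule norm_cauchy_schwarz)
  finally have cs: "(norm v)\<^sup>2 \<le> norm (L2_class ?f) * norm (L2_class (\<lambda>x. indicator A x *\<^sub>R v))" .
  have "ennreal ((norm (L2_class (\<lambda>x. indicator A x *\<^sub>R v)))\<^sup>2) = (\<integral>\<^sup>+x. ennreal ((norm v)\<^sup>2) * indicator A x \<partial>lborel)"
    unfolding nn_norm_L2_class[OF const, symmetric]
    by (intro nn_integral_cong) (auto split: split_indicator)
  also have "\<dots> = ennreal ((norm v)\<^sup>2) * emeasure lborel A"
    by (rule nn_integral_cmult_indicator) simp
  also have "\<dots> = ennreal (m * (norm v)\<^sup>2)"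
    using A(2,3) by (simp add: ennreal_mult mult.commute)
  finally have nv: "(norm (L2_class (\<lambda>x. indicator A x *\<^sub>R v)))\<^sup>2 = m * (norm v)\<^sup>2"
    using A(3) by (simp add: ennreal_inj)
  have "((norm v)\<^sup>2)\<^sup>2 \<le> (norm (L2_class ?f))\<^sup>2 * (m * (norm v)\<^sup>2)"
    using power_mono[OF cs, of 2] by (simp add: power_mult_distrib nv)
  then have sq: "(norm v)\<^sup>2 * (norm v)\<^sup>2 \<le> (norm v)\<^sup>2 * (m * (norm (L2_class ?f))\<^sup>2)"
    by (simp add: power2_eq_square mult_ac)
  have "(norm v)\<^sup>2 \<le> m * (norm (L2_class ?f))\<^sup>2"
  proof (cases "v = 0")
    case False
    then have "(norm v)\<^sup>2 > 0" by simp
    from mult_le_cancel_left_pos[OF this] sq show ?thesis by blast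
  qed (use A(3) in simp)
  then have "ennreal ((norm v)\<^sup>2) \<le> ennreal m * ennreal ((norm (L2_class ?f))\<^sup>2)"
    using A(3) by (simp add: ennreal_mult[symmetric] ennreal_leI)
  also have "ennreal ((norm (L2_class ?f))\<^sup>2) = (\<integral>\<^sup>+x. indicator A x * ennreal ((norm (f x))\<^sup>2) \<partial>lborel)"
    unfolding nn_norm_L2_class[OF f, symmetric]
    by (intro nn_integral_cong) (auto split: split_indicator)
  finally show "ennreal ((norm (LINT x|lborel. ?f x))\<^sup>2)
      \<le> ennreal m * (\<integral>\<^sup>+x. indicator A x * ennreal ((norm (f x))\<^sup>2) \<partial>lborel)"
    by (simp add: v_def)
qed

lemma square_int_indicator_continuous:
  fixes f :: "'a::euclidean_space \<Rightarrow> 'b::euclidean_space"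
  assumes "continuous_on UNIV f" "bounded A" "A \<in> sets borel"
  shows "square_int (\<lambda>x. indicator A x *\<^sub>R f x)"
proof (rule square_intI)
  have [measurable]: "f \<in> borel_measurable borel" by (rule borel_measurable_continuous_onI[OF assms(1)])
  have [measurable]: "A \<in> sets borel" by fact
  show "(\<lambda>x. indicator A x *\<^sub>R f x) \<in> borel_measurable borel" by measurable
  have K: "compact (closure A)" using assms(2) by simp
  have "integrable lborel (\<lambda>x. indicator (closure A) x *\<^sub>R (norm (f x))\<^sup>2)"
    by (rule borel_integrable_compact[OF K]) (intro continuous_intros continuous_on_subset[OF assms(1)] subset_UNIV)
  then have fin: "(\<integral>\<^sup>+x. ennreal (norm (indicator (closure A) x *\<^sub>R (norm (f x))\<^sup>2)) \<partial>lborel) < \<infinity>"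
    by (simp add: integrable_iff_bounded)
  have "(\<integral>\<^sup>+x. ennreal ((norm (indicator A x *\<^sub>R f x))\<^sup>2) \<partial>lborel)
      \<le> (\<integral>\<^sup>+x. ennreal (norm (indicator (closure A) x *\<^sub>R (norm (f x))\<^sup>2)) \<partial>lborel)"
    by (intro nn_integral_mono) (use closure_subset[of A] in \<open>auto split: split_indicator\<close>)
  then show "(\<integral>\<^sup>+x. ennreal ((norm (indicator A x *\<^sub>R f x))\<^sup>2) \<partial>lborel) < \<infinity>"
    using fin by (rule le_less_trans)
qed

text \<open>The fundamental theorem of calculus combined with the Cauchy-Schwarz inequality.\<close>

lemma norm_increment_le:
  fixes g g' :: "real \<Rightarrow> 'b::euclidean_space"
  assumes g: "\<And>s. (g has_vector_derivative g' s) (at s)" and g': "continuous_on UNIV g'"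
    and I: "{min x y..max x y} \<subseteq> I" "I \<in> sets borel" and h: "\<bar>x - y\<bar> \<le> h"
  shows "ennreal ((norm (g x - g y))\<^sup>2) \<le> ennreal h * (\<integral>\<^sup>+s. indicator I s * ennreal ((norm (g' s))\<^sup>2) \<partial>lborel)"
proof -
  let ?a = "min x y" and ?b = "max x y"
  have [measurable]: "g' \<in> borel_measurable borel" by (rule borel_measurable_continuous_onI[OF g'])
  have "(LINT s|lborel. indicator {?a..?b} s *\<^sub>R g' s) = g ?b - g ?a"
    by (rule integral_FTC_Icc) (auto intro: has_vector_derivative_at_within g continuous_on_subset[OF g'])
  then have "ennreal ((norm (g ?b - g ?a))\<^sup>2)
      \<le> ennreal (?b - ?a) * (\<integral>\<^sup>+s. indicator {?a..?b} s * ennreal ((norm (g' s))\<^sup>2) \<partial>lborel)"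
    using norm_integral_power2_le(2)[OF _ _ _ square_int_indicator_continuous[OF g'], of "{?a..?b}" "?b - ?a"]
    by simp
  also have "\<dots> \<le> ennreal h * (\<integral>\<^sup>+s. indicator I s * ennreal ((norm (g' s))\<^sup>2) \<partial>lborel)"
    by (intro mult_mono ennreal_leI nn_integral_mono mult_right_mono)
       (use I h in \<open>auto split: split_indicator simp: min_def max_def split: if_splits\<close>)
  also have "norm (g ?b - g ?a) = norm (g x - g y)"
    by (auto simp: min_def max_def norm_minus_commute)
  finally show ?thesis .
qed


section \<open>Inequalities for smooth fields of bounded support\<close>

definition pdiff :: "2 \<Rightarrow> (real^2 \<Rightarrow> 'b::euclidean_space) \<Rightarrow> real^2 \<Rightarrow> 'b" where
  "pdiff j \<phi> x = frechet_derivative \<phi> (at x) (axis j 1)"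

lemma continuous_pdiff: "smooth \<phi> \<Longrightarrow> continuous_on S (pdiff j \<phi>)"
  unfolding pdiff_def[abs_def] by (intro smooth_continuous smooth_deriv) auto

lemma measurable_pdiff: "smooth \<phi> \<Longrightarrow> pdiff j \<phi> \<in> borel_measurable borel"
  by (intro borel_measurable_continuous_onI continuous_pdiff)

lemma measurable_smooth: "smooth \<phi> \<Longrightarrow> \<phi> \<in> borel_measurable borel"
  by (intro borel_measurable_continuous_onI smooth_continuous)

lemma slice_derivatives:
  assumes "smooth \<phi>"
  shows "((\<lambda>s. \<phi> (pt s t)) has_vector_derivative pdiff 1 \<phi> (pt s t)) (at s)"
    "((\<lambda>t. \<phi> (pt s t)) has_vector_derivative pdiff 2 \<phi> (pt s t)) (at t)"
proof -
  have "((\<lambda>s. pt s t) has_derivative (\<lambda>h. h *\<^sub>R axis 1 1)) (at s)"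
    unfolding pt_def by (auto intro!: derivative_eq_intros)
  from has_derivative_compose[OF this smooth_has_derivative[OF assms]]
  show "((\<lambda>s. \<phi> (pt s t)) has_vector_derivative pdiff 1 \<phi> (pt s t)) (at s)"
    by (simp add: has_vector_derivative_def pdiff_def linear_scale[OF has_derivative_linear[OF smooth_has_derivative[OF assms]]])
  have "((\<lambda>t. pt s t) has_derivative (\<lambda>h. h *\<^sub>R axis 2 1)) (at t)"
    unfolding pt_def by (auto intro!: derivative_eq_intros)
  from has_derivative_compose[OF this smooth_has_derivative[OF assms]]
  show "((\<lambda>t. \<phi> (pt s t)) has_vector_derivative pdiff 2 \<phi> (pt s t)) (at t)"
    by (simp add: has_vector_derivative_def pdiff_def linear_scale[OF has_derivative_linear[OF smooth_has_derivative[OF assms]]])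
qed

lemma slice_continuous:
  assumes "smooth \<phi>"
  shows "continuous_on UNIV (\<lambda>s. pdiff j \<phi> (pt s t))" "continuous_on UNIV (\<lambda>t. pdiff j \<phi> (pt s t))"
  unfolding pt_def
  by (rule continuous_on_compose2[OF continuous_pdiff[OF assms, of UNIV]]; intro continuous_intros subset_UNIV)+

lemma slice_increment:
  fixes \<phi> :: "real^2 \<Rightarrow> 'b::euclidean_space"
  assumes \<phi>: "smooth \<phi>" and I: "{min x y..max x y} \<subseteq> I" "I \<in> sets borel" and h: "\<bar>x - y\<bar> \<le> h"
  shows "ennreal ((norm (\<phi> (pt x t) - \<phi> (pt y t)))\<^sup>2)
      \<le> ennreal h * (\<integral>\<^sup>+s. indicator I s * ennreal ((norm (pdiff 1 \<phi> (pt s t)))\<^sup>2) \<partial>lborel)"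
    "ennreal ((norm (\<phi> (pt s x) - \<phi> (pt s y)))\<^sup>2)
      \<le> ennreal h * (\<integral>\<^sup>+t. indicator I t * ennreal ((norm (pdiff 2 \<phi> (pt s t)))\<^sup>2) \<partial>lborel)"
  by (rule norm_increment_le[OF slice_derivatives(1)[OF \<phi>] slice_continuous(1)[OF \<phi>] I h],
      rule norm_increment_le[OF slice_derivatives(2)[OF \<phi>] slice_continuous(2)[OF \<phi>] I h])

text \<open>A field vanishing at one end of a segment is bounded along it by the energy of its slice.\<close>

lemma slice_bound:
  fixes \<phi> :: "real^2 \<Rightarrow> 'b::euclidean_space"
  assumes \<phi>: "smooth \<phi>" and M: "\<And>x i. \<phi> x \<noteq> 0 \<Longrightarrow> \<bar>x $ i\<bar> < M"
  shows "ennreal ((norm (\<phi> (pt s t)))\<^sup>2)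
      \<le> indicator {-M..M} s * (ennreal (2 * M) * (\<integral>\<^sup>+s. ennreal ((norm (pdiff 1 \<phi> (pt s t)))\<^sup>2) \<partial>lborel))"
    "ennreal ((norm (\<phi> (pt s t)))\<^sup>2)
      \<le> indicator {-M..M} t * (ennreal (2 * M) * (\<integral>\<^sup>+t. ennreal ((norm (pdiff 2 \<phi> (pt s t)))\<^sup>2) \<partial>lborel))"
proof -
  have z1: "\<phi> (pt (- M) t) = 0" and z2: "\<phi> (pt s (- M)) = 0"
    using M[of "pt (- M) t" 1] M[of "pt s (- M)" 2] abs_ge_self[of M] by (force simp: not_less)+
  have b: "\<bar>s\<bar> < M" "\<bar>t\<bar> < M" if "\<phi> (pt s t) \<noteq> 0"
    using M[OF that, of 1] M[OF that, of 2] by auto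
  show "ennreal ((norm (\<phi> (pt s t)))\<^sup>2)
      \<le> indicator {-M..M} s * (ennreal (2 * M) * (\<integral>\<^sup>+s. ennreal ((norm (pdiff 1 \<phi> (pt s t)))\<^sup>2) \<partial>lborel))"
  proof (cases "\<phi> (pt s t) = 0")
    case False
    have "ennreal ((norm (\<phi> (pt s t) - \<phi> (pt (- M) t)))\<^sup>2)
      \<le> ennreal (2 * M) * (\<integral>\<^sup>+s. indicator UNIV s * ennreal ((norm (pdiff 1 \<phi> (pt s t)))\<^sup>2) \<partial>lborel)"
      by (rule slice_increment(1)[OF \<phi>]) (use b False in auto)
    moreover have "s \<in> {-M..M}" using b(1)[OF False] by auto
    ultimately show ?thesis using z1 by simp
  qed simp
  show "ennreal ((norm (\<phi> (pt s t)))\<^sup>2)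
      \<le> indicator {-M..M} t * (ennreal (2 * M) * (\<integral>\<^sup>+t. ennreal ((norm (pdiff 2 \<phi> (pt s t)))\<^sup>2) \<partial>lborel))"
  proof (cases "\<phi> (pt s t) = 0")
    case False
    have "ennreal ((norm (\<phi> (pt s t) - \<phi> (pt s (- M))))\<^sup>2)
      \<le> ennreal (2 * M) * (\<integral>\<^sup>+t. indicator UNIV t * ennreal ((norm (pdiff 2 \<phi> (pt s t)))\<^sup>2) \<partial>lborel)"
      by (rule slice_increment(2)[OF \<phi>]) (use b False in auto)
    moreover have "t \<in> {-M..M}" using b(2)[OF False] by auto
    ultimately show ?thesis using z2 by simp
  qed simp
qed

definition energy :: "2 \<Rightarrow> (real^2 \<Rightarrow> 'b::euclidean_space) \<Rightarrow> ennreal" where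
  "energy j \<phi> = (\<integral>\<^sup>+x. ennreal ((norm (pdiff j \<phi> x))\<^sup>2) \<partial>lborel)"

lemma smooth_poincare:
  fixes \<phi> :: "real^2 \<Rightarrow> 'b::euclidean_space"
  assumes \<phi>: "smooth \<phi>" and M: "M \<ge> 0" "\<And>x i. \<phi> x \<noteq> 0 \<Longrightarrow> \<bar>x $ i\<bar> < M"
  shows "(\<integral>\<^sup>+x. ennreal ((norm (\<phi> x))\<^sup>2) \<partial>lborel) \<le> ennreal (4 * M\<^sup>2) * energy 1 \<phi>"
proof -
  note [measurable] = measurable_smooth[OF \<phi>] measurable_pdiff[OF \<phi>]
  let ?\<alpha> = "\<lambda>t. \<integral>\<^sup>+s. ennreal ((norm (pdiff 1 \<phi> (pt s t)))\<^sup>2) \<partial>lborel"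
  have "(\<integral>\<^sup>+x. ennreal ((norm (\<phi> x))\<^sup>2) \<partial>lborel) = (\<integral>\<^sup>+t. \<integral>\<^sup>+s. ennreal ((norm (\<phi> (pt s t)))\<^sup>2) \<partial>lborel \<partial>lborel)"
    by (rule nn_integral_plane(2)) measurable
  also have "\<dots> \<le> (\<integral>\<^sup>+t. \<integral>\<^sup>+s. indicator {-M..M} s * (ennreal (2 * M) * ?\<alpha> t) \<partial>lborel \<partial>lborel)"
    by (intro nn_integral_mono slice_bound(1) \<phi> M)
  also have "\<dots> = (\<integral>\<^sup>+t. ennreal (2 * M) * (ennreal (2 * M) * ?\<alpha> t) \<partial>lborel)"
    using M(1) by (intro nn_integral_cong) (simp add: nn_integral_multc)
  also have "\<dots> = ennreal (2 * M) * (ennreal (2 * M) * energy 1 \<phi>)"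
    unfolding energy_def by (subst nn_integral_plane(2)) (simp_all add: nn_integral_cmult)
  also have "\<dots> = ennreal (4 * M\<^sup>2) * energy 1 \<phi>"
    using M(1) by (simp add: mult.assoc[symmetric] ennreal_mult[symmetric] power2_eq_square)
  finally show ?thesis .
qed

text \<open>One factor is bounded by a function of \<open>t\<close> and the other by a function of \<open>s\<close>, so the
  integral of the product splits. This is what replaces Ladyzhenskaya's inequality here.\<close>

lemma smooth_product_bound:
  fixes \<phi> :: "real^2 \<Rightarrow> 'b::euclidean_space" and \<psi> :: "real^2 \<Rightarrow> 'c::euclidean_space"
  assumes \<phi>: "smooth \<phi>" "\<And>x i. \<phi> x \<noteq> 0 \<Longrightarrow> \<bar>x $ i\<bar> < M"
    and \<psi>: "smooth \<psi>" "\<And>x i. \<psi> x \<noteq> 0 \<Longrightarrow> \<bar>x $ i\<bar> < M" and M: "M \<ge> 0"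
  shows "(\<integral>\<^sup>+x. ennreal ((norm (\<phi> x))\<^sup>2) * ennreal ((norm (\<psi> x))\<^sup>2) \<partial>lborel)
      \<le> ennreal (4 * M\<^sup>2) * (energy 1 \<phi> * energy 2 \<psi>)"
proof -
  note [measurable] = measurable_smooth[OF \<phi>(1)] measurable_pdiff[OF \<phi>(1)]
    measurable_smooth[OF \<psi>(1)] measurable_pdiff[OF \<psi>(1)]
  let ?\<alpha> = "\<lambda>t. \<integral>\<^sup>+s. ennreal ((norm (pdiff 1 \<phi> (pt s t)))\<^sup>2) \<partial>lborel"
  let ?\<beta> = "\<lambda>s. \<integral>\<^sup>+t. ennreal ((norm (pdiff 2 \<psi> (pt s t)))\<^sup>2) \<partial>lborel"
  have ind: "indicator A x * c \<le> (c :: ennreal)" for A :: "real set" and x c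
    by (auto split: split_indicator)
  have b1: "ennreal ((norm (\<phi> (pt s t)))\<^sup>2) \<le> ennreal (2 * M) * ?\<alpha> t" for s t
    using slice_bound(1)[OF \<phi>, of s t] ind by (rule order_trans)
  have b2: "ennreal ((norm (\<psi> (pt s t)))\<^sup>2) \<le> ennreal (2 * M) * ?\<beta> s" for s t
    using slice_bound(2)[OF \<psi>, of s t] ind by (rule order_trans)
  have "(\<integral>\<^sup>+x. ennreal ((norm (\<phi> x))\<^sup>2) * ennreal ((norm (\<psi> x))\<^sup>2) \<partial>lborel)
      = (\<integral>\<^sup>+t. \<integral>\<^sup>+s. ennreal ((norm (\<phi> (pt s t)))\<^sup>2) * ennreal ((norm (\<psi> (pt s t)))\<^sup>2) \<partial>lborel \<partial>lborel)"
    by (rule nn_integral_plane(2)) measurable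
  also have "\<dots> \<le> (\<integral>\<^sup>+t. \<integral>\<^sup>+s. (ennreal (2 * M) * ?\<alpha> t) * (ennreal (2 * M) * ?\<beta> s) \<partial>lborel \<partial>lborel)"
    by (intro nn_integral_mono mult_mono b1 b2) auto
  also have "\<dots> = (\<integral>\<^sup>+t. (ennreal (2 * M) * ?\<alpha> t) * (ennreal (2 * M) * energy 2 \<psi>) \<partial>lborel)"
    unfolding energy_def
    by (subst nn_integral_plane(1)[of "\<lambda>x. ennreal ((norm (pdiff 2 \<psi> x))\<^sup>2)"]) (simp_all add: nn_integral_cmult)
  also have "\<dots> = (ennreal (2 * M) * energy 1 \<phi>) * (ennreal (2 * M) * energy 2 \<psi>)"
    unfolding energy_def
    by (subst nn_integral_plane(2)[of "\<lambda>x. ennreal ((norm (pdiff 1 \<phi> x))\<^sup>2)"])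
       (simp_all add: nn_integral_cmult nn_integral_multc)
  also have "\<dots> = (ennreal (2 * M) * ennreal (2 * M)) * (energy 1 \<phi> * energy 2 \<psi>)"
    by (simp add: mult_ac)
  also have "ennreal (2 * M) * ennreal (2 * M) = ennreal (4 * M\<^sup>2)"
    using M by (simp add: ennreal_mult[symmetric] power2_eq_square)
  finally show ?thesis .
qed

text \<open>The cells are half-open squares of side \<open>h\<close>, so that every point of the plane lies in exactly one of them.\<close>

definition cell :: "real \<Rightarrow> int \<times> int \<Rightarrow> (real^2) set" where
  "cell h z = {x. \<lfloor>x $ 1 / h\<rfloor> = fst z \<and> \<lfloor>x $ 2 / h\<rfloor> = snd z}"

definition strip :: "real \<Rightarrow> int \<Rightarrow> real set" where
  "strip h i = {s. \<lfloor>s / h\<rfloor> = i}"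

lemma strip_eq: "h > 0 \<Longrightarrow> strip h i = {i * h..<(i + 1) * h}"
  by (auto simp: strip_def floor_eq_iff field_simps)

lemma indicator_cell_pt: "indicator (cell h z) (pt s t) = (indicator (strip h (fst z)) s * indicator (strip h (snd z)) t :: ennreal)"
  by (auto simp: cell_def strip_def split: split_indicator)

lemma measurable_cell [measurable]: "cell h z \<in> sets borel"
  unfolding cell_def by measurable

lemma measurable_strip [measurable]: "strip h i \<in> sets borel"
  unfolding strip_def by measurable

lemma emeasure_strip: "h > 0 \<Longrightarrow> emeasure lborel (strip h i) = ennreal h"
  by (simp add: strip_eq algebra_simps)

lemma nn_integral_cell:
  assumes [measurable]: "f \<in> borel_measurable borel"
  shows "(\<integral>\<^sup>+x. indicator (cell h z) x * f x \<partial>lborel)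
     = (\<integral>\<^sup>+s. indicator (strip h (fst z)) s * (\<integral>\<^sup>+t. indicator (strip h (snd z)) t * f (pt s t) \<partial>lborel) \<partial>lborel)"
    "(\<integral>\<^sup>+x. indicator (cell h z) x * f x \<partial>lborel)
     = (\<integral>\<^sup>+t. indicator (strip h (snd z)) t * (\<integral>\<^sup>+s. indicator (strip h (fst z)) s * f (pt s t) \<partial>lborel) \<partial>lborel)"
  by (subst nn_integral_plane(1), measurable, intro nn_integral_cong,
      simp add: indicator_cell_pt mult.assoc nn_integral_cmult)
     (subst nn_integral_plane(2), measurable, intro nn_integral_cong,
      simp add: indicator_cell_pt mult.assoc mult.left_commute[of _ "indicator (strip h (snd z)) _"] nn_integral_cmult)

lemma nn_integral_indicator_mono:
  assumes "\<And>x. x \<in> A \<Longrightarrow> f x \<le> g x"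
  shows "(\<integral>\<^sup>+x. indicator A x * f x \<partial>M) \<le> (\<integral>\<^sup>+x. indicator A x * g x \<partial>M)"
  by (intro nn_integral_mono) (use assms in \<open>auto split: split_indicator\<close>)

lemma emeasure_cell: assumes "h > 0" shows "emeasure lborel (cell h z) = ennreal (h\<^sup>2)"
proof -
  have "emeasure lborel (cell h z) = (\<integral>\<^sup>+x. indicator (cell h z) x * 1 \<partial>lborel)" by simp
  also have "\<dots> = ennreal h * ennreal h"
    using assms by (subst nn_integral_cell(1)) (simp_all add: emeasure_strip nn_integral_multc)
  finally show ?thesis using assms by (simp add: ennreal_mult[symmetric] power2_eq_square)
qed

lemma bounded_cell: assumes "h > 0" shows "bounded (cell h z)"
proof (rule bounded_subset[OF bounded_cbox])
  show "cell h z \<subseteq> cbox (pt (fst z * h) (snd z * h)) (pt ((fst z + 1) * h) ((snd z + 1) * h))"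
    using assms by (auto simp: cell_def mem_box_cart forall_2 floor_eq_iff field_simps)
qed

lemma norm_add_power2_le: "(norm (a + b))\<^sup>2 \<le> 2 * (norm a)\<^sup>2 + 2 * (norm (b :: 'a::real_inner))\<^sup>2"
proof -
  have "(norm (a + b))\<^sup>2 \<le> (norm a + norm b)\<^sup>2" by (intro power_mono norm_triangle_ineq) simp
  also have "\<dots> \<le> 2 * (norm a)\<^sup>2 + 2 * (norm b)\<^sup>2"
    using sum_squares_bound[of "norm a" "norm b"] by (simp add: power2_sum)
  finally show ?thesis .
qed

text \<open>Any two values in a cell differ by two slice increments: first along the horizontal
  slice through one point, then along the vertical slice through the other.\<close>

lemma cell_increment:
  fixes \<phi> :: "real^2 \<Rightarrow> 'b::euclidean_space"
  assumes \<phi>: "smooth \<phi>" and h: "h > 0"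
    and s: "s \<in> strip h i" "s' \<in> strip h i" and t: "t \<in> strip h j" "t' \<in> strip h j"
  shows "ennreal ((norm (\<phi> (pt s t) - \<phi> (pt s' t')))\<^sup>2) \<le> ennreal (2 * h) *
     ((\<integral>\<^sup>+s. indicator (strip h i) s * ennreal ((norm (pdiff 1 \<phi> (pt s t)))\<^sup>2) \<partial>lborel)
      + (\<integral>\<^sup>+t. indicator (strip h j) t * ennreal ((norm (pdiff 2 \<phi> (pt s' t)))\<^sup>2) \<partial>lborel))"
    (is "_ \<le> _ * (?A + ?B)")
proof -
  have seg: "{min x y..max x y} \<subseteq> strip h k \<and> \<bar>x - y\<bar> \<le> h" if "x \<in> strip h k" "y \<in> strip h k" for x y k
    using that h by (auto simp: strip_eq min_def max_def algebra_simps abs_le_iff)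
  have "(norm (\<phi> (pt s t) - \<phi> (pt s' t')))\<^sup>2
      = (norm ((\<phi> (pt s t) - \<phi> (pt s' t)) + (\<phi> (pt s' t) - \<phi> (pt s' t'))))\<^sup>2" by simp
  also have "\<dots> \<le> 2 * (norm (\<phi> (pt s t) - \<phi> (pt s' t)))\<^sup>2 + 2 * (norm (\<phi> (pt s' t) - \<phi> (pt s' t')))\<^sup>2"
    by (rule norm_add_power2_le)
  finally have "ennreal ((norm (\<phi> (pt s t) - \<phi> (pt s' t')))\<^sup>2)
      \<le> ennreal (2 * (norm (\<phi> (pt s t) - \<phi> (pt s' t)))\<^sup>2 + 2 * (norm (\<phi> (pt s' t) - \<phi> (pt s' t')))\<^sup>2)"
    by (rule ennreal_leI)
  also have "\<dots> = 2 * ennreal ((norm (\<phi> (pt s t) - \<phi> (pt s' t)))\<^sup>2) + 2 * ennreal ((norm (\<phi> (pt s' t) - \<phi> (pt s' t')))\<^sup>2)"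
    by (simp add: ennreal_mult)
  also have "\<dots> \<le> 2 * (ennreal h * ?A) + 2 * (ennreal h * ?B)"
    using seg[OF s] seg[OF t]
    by (intro add_mono mult_left_mono slice_increment(1)[OF \<phi>] slice_increment(2)[OF \<phi>]) auto
  also have "\<dots> = ennreal (2 * h) * (?A + ?B)"
    using h by (simp add: ennreal_mult distrib_left mult.assoc)
  finally show ?thesis .
qed

text \<open>Jensen's inequality: the deviation from the mean is the mean of the deviations.\<close>

lemma deviation_from_mean:
  fixes f :: "'a::euclidean_space \<Rightarrow> 'b::euclidean_space"
  assumes A [measurable]: "A \<in> sets borel" "bounded A" "emeasure lborel A = ennreal m" and m: "m > 0"
    and f: "continuous_on UNIV f"
  shows "ennreal ((norm (c - (1 / m) *\<^sub>R (LINT y|lborel. indicator A y *\<^sub>R f y)))\<^sup>2)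
    \<le> ennreal (1 / m) * (\<integral>\<^sup>+y. indicator A y * ennreal ((norm (c - f y))\<^sup>2) \<partial>lborel)"
proof -
  have cf: "continuous_on UNIV (\<lambda>y. c - f y)" by (intro continuous_intros f)
  note sq = square_int_indicator_continuous[OF _ A(2) A(1)]
  have int_f: "integrable lborel (\<lambda>y. indicator A y *\<^sub>R f y)"
    using norm_integral_power2_le(1)[OF A(1) A(3) _ sq[OF f]] m by simp
  have meas: "measure lborel A = m" using A(3) m by (simp add: measure_def)
  have int_c: "integrable lborel (\<lambda>y. indicator A y *\<^sub>R c)"
    using A by (intro integrable_scaleR_left) (auto simp: integrable_indicator_iff)
  have "(LINT y|lborel. indicator A y *\<^sub>R (c - f y))
      = (LINT y|lborel. indicator A y *\<^sub>R c) - (LINT y|lborel. indicator A y *\<^sub>R f y)"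
    using int_f int_c by (simp add: scaleR_diff_right)
  also have "(LINT y|lborel. indicator A y *\<^sub>R c) = m *\<^sub>R c"
    using A by (simp add: meas integrable_indicator_iff)
  finally have eq: "c - (1 / m) *\<^sub>R (LINT y|lborel. indicator A y *\<^sub>R f y)
      = (1 / m) *\<^sub>R (LINT y|lborel. indicator A y *\<^sub>R (c - f y))"
    using m by (simp add: scaleR_diff_right)
  have "(norm (c - (1 / m) *\<^sub>R (LINT y|lborel. indicator A y *\<^sub>R f y)))\<^sup>2
      = (1 / m)\<^sup>2 * (norm (LINT y|lborel. indicator A y *\<^sub>R (c - f y)))\<^sup>2"
    unfolding eq by (simp add: power_mult_distrib power_divide)
  then have "ennreal ((norm (c - (1 / m) *\<^sub>R (LINT y|lborel. indicator A y *\<^sub>R f y)))\<^sup>2)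
      = ennreal ((1 / m)\<^sup>2) * ennreal ((norm (LINT y|lborel. indicator A y *\<^sub>R (c - f y)))\<^sup>2)"
    by (simp only: ennreal_mult zero_le_power2)
  also have "\<dots> \<le> ennreal ((1 / m)\<^sup>2) * (ennreal m * (\<integral>\<^sup>+y. indicator A y * ennreal ((norm (c - f y))\<^sup>2) \<partial>lborel))"
    using norm_integral_power2_le(2)[OF A(1) A(3) _ sq[OF cf]] m by (intro mult_left_mono) auto
  also have "\<dots> = ennreal (1 / m) * (\<integral>\<^sup>+y. indicator A y * ennreal ((norm (c - f y))\<^sup>2) \<partial>lborel)"
    using m by (simp add: mult.assoc[symmetric] ennreal_mult[symmetric] power2_eq_square)
  finally show ?thesis .
qed

text \<open>A Poincare inequality on one cell: the field is close to its mean, with a constant of order \<open>h\<^sup>2\<close>.\<close>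

lemma cell_poincare:
  fixes \<phi> :: "real^2 \<Rightarrow> 'b::euclidean_space"
  assumes \<phi>: "smooth \<phi>" and h: "h > 0"
  shows "(\<integral>\<^sup>+x. indicator (cell h z) x * ennreal ((norm (\<phi> x))\<^sup>2) \<partial>lborel)
     \<le> ennreal (4 * h\<^sup>2) * ((\<integral>\<^sup>+x. indicator (cell h z) x * ennreal ((norm (pdiff 1 \<phi> x))\<^sup>2) \<partial>lborel)
           + (\<integral>\<^sup>+x. indicator (cell h z) x * ennreal ((norm (pdiff 2 \<phi> x))\<^sup>2) \<partial>lborel))
       + ennreal (2 / h\<^sup>2) * ennreal ((norm (LINT x|lborel. indicator (cell h z) x *\<^sub>R \<phi> x))\<^sup>2)"
proof -
  note [measurable] = measurable_smooth[OF \<phi>] measurable_pdiff[OF \<phi>]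
  let ?I = "strip h (fst z)" and ?J = "strip h (snd z)" and ?Q = "cell h z"
  define A where "A t = (\<integral>\<^sup>+s. indicator ?I s * ennreal ((norm (pdiff 1 \<phi> (pt s t)))\<^sup>2) \<partial>lborel)" for t
  define B where "B s = (\<integral>\<^sup>+t. indicator ?J t * ennreal ((norm (pdiff 2 \<phi> (pt s t)))\<^sup>2) \<partial>lborel)" for s
  define D1 where "D1 = (\<integral>\<^sup>+x. indicator ?Q x * ennreal ((norm (pdiff 1 \<phi> x))\<^sup>2) \<partial>lborel)"
  define D2 where "D2 = (\<integral>\<^sup>+x. indicator ?Q x * ennreal ((norm (pdiff 2 \<phi> x))\<^sup>2) \<partial>lborel)"
  have [measurable]: "A \<in> borel_measurable borel" "B \<in> borel_measurable borel"
    unfolding A_def B_def by measurable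
  have D1: "(\<integral>\<^sup>+t. indicator ?J t * A t \<partial>lborel) = D1"
    unfolding D1_def A_def by (subst nn_integral_cell(2)) (auto)
  have D2: "(\<integral>\<^sup>+s. indicator ?I s * B s \<partial>lborel) = D2"
    unfolding D2_def B_def by (subst nn_integral_cell(1)) (auto)
  have int_strip: "(\<integral>\<^sup>+s. indicator (strip h i) s * c \<partial>lborel) = ennreal h * c" for i c
    using h by (simp add: nn_integral_multc emeasure_strip)
  define m where "m = (1 / h\<^sup>2) *\<^sub>R (LINT x|lborel. indicator ?Q x *\<^sub>R \<phi> x)"
  have dev: "ennreal ((norm (\<phi> (pt s t) - m))\<^sup>2) \<le> 2 * (ennreal h * A t + D2)"
    if st: "s \<in> ?I" "t \<in> ?J" for s t
  proof -
    have "ennreal ((norm (\<phi> (pt s t) - m))\<^sup>2)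
        \<le> ennreal (1 / h\<^sup>2) * (\<integral>\<^sup>+y. indicator ?Q y * ennreal ((norm (\<phi> (pt s t) - \<phi> y))\<^sup>2) \<partial>lborel)"
      unfolding m_def using h
      by (intro deviation_from_mean smooth_continuous \<phi> bounded_cell) (auto simp: emeasure_cell)
    also have "(\<integral>\<^sup>+y. indicator ?Q y * ennreal ((norm (\<phi> (pt s t) - \<phi> y))\<^sup>2) \<partial>lborel)
       = (\<integral>\<^sup>+s'. indicator ?I s' * (\<integral>\<^sup>+t'. indicator ?J t' * ennreal ((norm (\<phi> (pt s t) - \<phi> (pt s' t')))\<^sup>2) \<partial>lborel) \<partial>lborel)"
      by (rule nn_integral_cell(1)) measurable
    also have "\<dots> \<le> (\<integral>\<^sup>+s'. indicator ?I s' * (\<integral>\<^sup>+t'. indicator ?J t' * (ennreal (2 * h) * (A t + B s')) \<partial>lborel) \<partial>lborel)"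
      unfolding A_def B_def
      by (intro nn_integral_indicator_mono cell_increment[OF \<phi> h st(1) _ st(2)])
    also have "\<dots> = (\<integral>\<^sup>+s'. ennreal h * ennreal (2 * h) * (indicator ?I s' * A t + indicator ?I s' * B s') \<partial>lborel)"
      unfolding int_strip by (intro nn_integral_cong) (auto split: split_indicator simp: mult.assoc)
    also have "\<dots> = ennreal h * ennreal (2 * h) * (ennreal h * A t + D2)"
      by (simp add: nn_integral_cmult nn_integral_add int_strip D2)
    finally have "ennreal ((norm (\<phi> (pt s t) - m))\<^sup>2)
        \<le> ennreal (1 / h\<^sup>2) * (ennreal h * ennreal (2 * h) * (ennreal h * A t + D2))" by (simp add: mult_left_mono)
    also have "\<dots> = (ennreal (1 / h\<^sup>2) * ennreal h * ennreal (2 * h)) * (ennreal h * A t + D2)"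
      by (simp add: mult.assoc)
    also have "ennreal (1 / h\<^sup>2) * ennreal h * ennreal (2 * h) = 2"
      using h by (simp add: ennreal_mult[symmetric] power2_eq_square)
    finally show ?thesis .
  qed
  have "(\<integral>\<^sup>+x. indicator ?Q x * ennreal ((norm (\<phi> x - m))\<^sup>2) \<partial>lborel)
      = (\<integral>\<^sup>+t. indicator ?J t * (\<integral>\<^sup>+s. indicator ?I s * ennreal ((norm (\<phi> (pt s t) - m))\<^sup>2) \<partial>lborel) \<partial>lborel)"
    by (rule nn_integral_cell(2)) measurable
  also have "\<dots> \<le> (\<integral>\<^sup>+t. indicator ?J t * (\<integral>\<^sup>+s. indicator ?I s * (2 * (ennreal h * A t + D2)) \<partial>lborel) \<partial>lborel)"
    by (intro nn_integral_indicator_mono dev)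
  also have "\<dots> = (\<integral>\<^sup>+t. 2 * ennreal h * (ennreal h * (indicator ?J t * A t) + indicator ?J t * D2) \<partial>lborel)"
    unfolding int_strip by (intro nn_integral_cong) (auto split: split_indicator simp: distrib_left mult_ac)
  also have "\<dots> = 2 * ennreal h * (ennreal h * D1 + ennreal h * D2)"
    by (simp add: nn_integral_cmult nn_integral_add int_strip D1)
  also have "\<dots> = ennreal (2 * h\<^sup>2) * (D1 + D2)"
    using h by (simp add: ennreal_mult power2_eq_square distrib_left mult_ac)
  finally have var: "(\<integral>\<^sup>+x. indicator ?Q x * ennreal ((norm (\<phi> x - m))\<^sup>2) \<partial>lborel) \<le> ennreal (2 * h\<^sup>2) * (D1 + D2)" .
  have "(\<integral>\<^sup>+x. indicator ?Q x * ennreal ((norm (\<phi> x))\<^sup>2) \<partial>lborel)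
      \<le> (\<integral>\<^sup>+x. 2 * (indicator ?Q x * ennreal ((norm (\<phi> x - m))\<^sup>2)) + 2 * ennreal ((norm m)\<^sup>2) * indicator ?Q x \<partial>lborel)"
  proof (rule nn_integral_mono)
    fix x
    have "ennreal ((norm (\<phi> x))\<^sup>2) \<le> ennreal (2 * (norm (\<phi> x - m))\<^sup>2 + 2 * (norm m)\<^sup>2)"
      using norm_add_power2_le[of "\<phi> x - m" m] by (intro ennreal_leI) simp
    then show "indicator ?Q x * ennreal ((norm (\<phi> x))\<^sup>2)
        \<le> 2 * (indicator ?Q x * ennreal ((norm (\<phi> x - m))\<^sup>2)) + 2 * ennreal ((norm m)\<^sup>2) * indicator ?Q x"
      by (auto split: split_indicator simp: ennreal_mult)
  qed
  also have "\<dots> = 2 * (\<integral>\<^sup>+x. indicator ?Q x * ennreal ((norm (\<phi> x - m))\<^sup>2) \<partial>lborel) + 2 * ennreal ((norm m)\<^sup>2) * ennreal (h\<^sup>2)"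
    using h by (simp add: nn_integral_add nn_integral_cmult emeasure_cell nn_integral_cmult_indicator)
  also have "\<dots> \<le> 2 * (ennreal (2 * h\<^sup>2) * (D1 + D2)) + 2 * ennreal ((norm m)\<^sup>2) * ennreal (h\<^sup>2)"
    by (intro add_mono mult_left_mono var) auto
  also have "2 * (ennreal (2 * h\<^sup>2) * (D1 + D2)) = ennreal (4 * h\<^sup>2) * (D1 + D2)"
    by (simp add: ennreal_mult mult.assoc[symmetric])
  also have "2 * ennreal ((norm m)\<^sup>2) * ennreal (h\<^sup>2) = ennreal (2 / h\<^sup>2) * ennreal ((norm (LINT x|lborel. indicator ?Q x *\<^sub>R \<phi> x))\<^sup>2)"
  proof -
    have "2 * ennreal ((norm m)\<^sup>2) * ennreal (h\<^sup>2) = ennreal (2 * (norm m)\<^sup>2 * h\<^sup>2)"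
      by (simp add: ennreal_mult)
    also have "2 * (norm m)\<^sup>2 * h\<^sup>2 = 2 / h\<^sup>2 * (norm (LINT x|lborel. indicator ?Q x *\<^sub>R \<phi> x))\<^sup>2"
      using h by (simp add: m_def power_mult_distrib power_divide power2_eq_square field_simps)
    also have "ennreal \<dots> = ennreal (2 / h\<^sup>2) * ennreal ((norm (LINT x|lborel. indicator ?Q x *\<^sub>R \<phi> x))\<^sup>2)"
      by (rule ennreal_mult) (use h in simp_all)
    finally show ?thesis .
  qed
  finally show ?thesis unfolding D1_def D2_def .
qed

definition cells :: "real \<Rightarrow> real \<Rightarrow> (int \<times> int) set" where
  "cells h M = {-\<lceil>M / h\<rceil>..\<lceil>M / h\<rceil>} \<times> {-\<lceil>M / h\<rceil>..\<lceil>M / h\<rceil>}"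

lemma cells_cover:
  assumes h: "h > 0" and x: "\<And>i. \<bar>x $ i\<bar> < M"
  shows "\<exists>z\<in>cells h M. x \<in> cell h z"
proof -
  have "\<lfloor>x $ i / h\<rfloor> \<in> {-\<lceil>M / h\<rceil>..\<lceil>M / h\<rceil>}" for i
  proof -
    have "x $ i / h \<le> M / h" "- (M / h) \<le> x $ i / h"
      using x[of i] h by (auto simp: field_simps abs_less_iff)
    then have "\<lfloor>x $ i / h\<rfloor> \<le> \<lceil>M / h\<rceil>" "- \<lceil>M / h\<rceil> \<le> \<lfloor>x $ i / h\<rfloor>" by linarith+
    then show ?thesis by simp
  qed
  then show ?thesis by (intro bexI[of _ "(\<lfloor>x $ 1 / h\<rfloor>, \<lfloor>x $ 2 / h\<rfloor>)"]) (auto simp: cell_def cells_def)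
qed

lemma sum_indicator_cells:
  "finite Z \<Longrightarrow> (\<Sum>z\<in>Z. indicator (cell h z) x) \<le> (1::ennreal)"
  "finite Z \<Longrightarrow> x \<in> cell h z \<Longrightarrow> z \<in> Z \<Longrightarrow> (\<Sum>z\<in>Z. indicator (cell h z) x) = (1::ennreal)"
proof -
  have eq: "(\<Sum>z\<in>Z. indicator (cell h z) x) = (\<Sum>z\<in>Z. if z = (\<lfloor>x $ 1 / h\<rfloor>, \<lfloor>x $ 2 / h\<rfloor>) then 1 else (0::ennreal))"
    by (intro sum.cong refl) (auto simp: cell_def split: split_indicator)
  show "finite Z \<Longrightarrow> (\<Sum>z\<in>Z. indicator (cell h z) x) \<le> (1::ennreal)"
    unfolding eq by simp
  show "finite Z \<Longrightarrow> x \<in> cell h z \<Longrightarrow> z \<in> Z \<Longrightarrow> (\<Sum>z\<in>Z. indicator (cell h z) x) = (1::ennreal)"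
    unfolding eq by (auto simp: cell_def)
qed

text \<open>Summing the inequality on single cells over finitely many cells that cover the support; by disjointness the
  energies on the cells add up to at most the total energy.\<close>

lemma smooth_friedrichs:
  fixes \<phi> :: "real^2 \<Rightarrow> 'b::euclidean_space"
  assumes \<phi>: "smooth \<phi>" and M: "\<And>x i. \<phi> x \<noteq> 0 \<Longrightarrow> \<bar>x $ i\<bar> < M" and h: "h > 0"
  shows "(\<integral>\<^sup>+x. ennreal ((norm (\<phi> x))\<^sup>2) \<partial>lborel)
     \<le> ennreal (4 * h\<^sup>2) * (energy 1 \<phi> + energy 2 \<phi>)
       + (\<Sum>z\<in>cells h M. ennreal (2 / h\<^sup>2) * ennreal ((norm (LINT x|lborel. indicator (cell h z) x *\<^sub>R \<phi> x))\<^sup>2))"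
proof -
  note [measurable] = measurable_smooth[OF \<phi>] measurable_pdiff[OF \<phi>]
  let ?Z = "cells h M"
  have fin: "finite ?Z" by (simp add: cells_def)
  have part: "(\<Sum>z\<in>?Z. \<integral>\<^sup>+x. indicator (cell h z) x * f x \<partial>lborel) \<le> (\<integral>\<^sup>+x. f x \<partial>lborel)"
    if [measurable]: "f \<in> borel_measurable borel" for f :: "real^2 \<Rightarrow> ennreal"
  proof -
    have "(\<Sum>z\<in>?Z. \<integral>\<^sup>+x. indicator (cell h z) x * f x \<partial>lborel) = (\<integral>\<^sup>+x. (\<Sum>z\<in>?Z. indicator (cell h z) x) * f x \<partial>lborel)"
      unfolding sum_distrib_right by (rule nn_integral_sum[symmetric]) measurable
    also have "\<dots> \<le> (\<integral>\<^sup>+x. 1 * f x \<partial>lborel)"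
      by (intro nn_integral_mono mult_right_mono sum_indicator_cells(1) fin) simp
    finally show ?thesis by simp
  qed
  have "(\<integral>\<^sup>+x. ennreal ((norm (\<phi> x))\<^sup>2) \<partial>lborel)
      \<le> (\<integral>\<^sup>+x. (\<Sum>z\<in>?Z. indicator (cell h z) x) * ennreal ((norm (\<phi> x))\<^sup>2) \<partial>lborel)"
  proof (rule nn_integral_mono)
    fix x
    show "ennreal ((norm (\<phi> x))\<^sup>2) \<le> (\<Sum>z\<in>?Z. indicator (cell h z) x) * ennreal ((norm (\<phi> x))\<^sup>2)"
    proof (cases "\<phi> x = 0")
      case False
      obtain z where "z \<in> ?Z" "x \<in> cell h z" using cells_cover[OF h M[OF False]] by blast
      then show ?thesis using sum_indicator_cells(2)[OF fin, of x h z] by simp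
    qed simp
  qed
  also have "\<dots> = (\<Sum>z\<in>?Z. \<integral>\<^sup>+x. indicator (cell h z) x * ennreal ((norm (\<phi> x))\<^sup>2) \<partial>lborel)"
    unfolding sum_distrib_right by (rule nn_integral_sum) measurable
  also have "\<dots> \<le> (\<Sum>z\<in>?Z. ennreal (4 * h\<^sup>2) * ((\<integral>\<^sup>+x. indicator (cell h z) x * ennreal ((norm (pdiff 1 \<phi> x))\<^sup>2) \<partial>lborel)
           + (\<integral>\<^sup>+x. indicator (cell h z) x * ennreal ((norm (pdiff 2 \<phi> x))\<^sup>2) \<partial>lborel))
       + ennreal (2 / h\<^sup>2) * ennreal ((norm (LINT x|lborel. indicator (cell h z) x *\<^sub>R \<phi> x))\<^sup>2))"
    by (intro sum_mono cell_poincare \<phi> h)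
  also have "\<dots> = ennreal (4 * h\<^sup>2) * ((\<Sum>z\<in>?Z. \<integral>\<^sup>+x. indicator (cell h z) x * ennreal ((norm (pdiff 1 \<phi> x))\<^sup>2) \<partial>lborel)
         + (\<Sum>z\<in>?Z. \<integral>\<^sup>+x. indicator (cell h z) x * ennreal ((norm (pdiff 2 \<phi> x))\<^sup>2) \<partial>lborel))
       + (\<Sum>z\<in>?Z. ennreal (2 / h\<^sup>2) * ennreal ((norm (LINT x|lborel. indicator (cell h z) x *\<^sub>R \<phi> x))\<^sup>2))"
    by (simp only: sum.distrib sum_distrib_left distrib_left)
  also have "\<dots> \<le> ennreal (4 * h\<^sup>2) * (energy 1 \<phi> + energy 2 \<phi>)
       + (\<Sum>z\<in>?Z. ennreal (2 / h\<^sup>2) * ennreal ((norm (LINT x|lborel. indicator (cell h z) x *\<^sub>R \<phi> x))\<^sup>2))"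
    unfolding energy_def by (intro add_mono mult_left_mono part order_refl) auto
  finally show ?thesis .
qed

section \<open>Integration by parts\<close>

text \<open>The integral of \<open>F (x + e/n) - F x\<close> vanishes by translation invariance; after multiplication
  by \<open>n\<close> these difference quotients converge boundedly to the directional derivative.\<close>

lemma integral_derivative_zero:
  fixes F :: "'a::euclidean_space \<Rightarrow> real"
  assumes deriv: "\<And>x. (F has_derivative F' x) (at x)"
    and cont: "continuous_on UNIV (\<lambda>x. F' x e)"
    and supp: "\<And>x. r < norm x \<Longrightarrow> F x = 0"
  shows "(LINT x|lborel. F' x e) = 0"
proof -
  have cont_F: "continuous_on UNIV F"
    by (intro continuous_at_imp_continuous_on ballI has_derivative_continuous[OF deriv])
  have [measurable]: "F \<in> borel_measurable borel" "(\<lambda>x. F' x e) \<in> borel_measurable borel"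
    by (intro borel_measurable_continuous_onI cont_F cont)+
  have int_F: "integrable lborel F"
  proof -
    have "integrable lborel (\<lambda>x. indicator (cball 0 r) x *\<^sub>R F x)"
      by (rule borel_integrable_compact) (auto intro: continuous_on_subset[OF cont_F])
    also have "(\<lambda>x. indicator (cball 0 r) x *\<^sub>R F x) = F"
      using supp by (auto split: split_indicator)
    finally show ?thesis .
  qed
  define q where "q n x = real (Suc n) * (F (x + (1 / real (Suc n)) *\<^sub>R e) - F x)" for n x
  have [measurable]: "q n \<in> borel_measurable borel" for n unfolding q_def by measurable
  have int_q: "(LINT x|lborel. q n x) = 0" for n
  proof -
    let ?c = "(1 / real (Suc n)) *\<^sub>R e"
    have "integrable (distr lborel borel ((+) ?c)) F" using int_F by (simp add: lborel_distr_plus)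
    then have "integrable lborel (\<lambda>x. F (?c + x))" by (subst (asm) integrable_distr_eq) auto
    moreover have "(LINT x|lborel. F (?c + x)) = (LINT x|distr lborel borel ((+) ?c). F x)"
      by (subst integral_distr) auto
    ultimately show ?thesis
      unfolding q_def using int_F by (simp add: lborel_distr_plus add.commute)
  qed
  have mean: "\<exists>z. 0 < z \<and> z < 1 / real (Suc n) \<and> q n x = F' (x + z *\<^sub>R e) e" for n x
  proof -
    have d: "((\<lambda>t. F (x + t *\<^sub>R e)) has_real_derivative F' (x + t *\<^sub>R e) e) (at t)" for t
    proof -
      have "((\<lambda>t. x + t *\<^sub>R e) has_derivative (\<lambda>h. h *\<^sub>R e)) (at t)"
        by (auto intro!: derivative_eq_intros)
      from has_derivative_compose[OF this deriv]
      show ?thesis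
        by (simp add: has_field_derivative_def linear_scale[OF has_derivative_linear[OF deriv]] mult.commute[of _ "F' (x + t *\<^sub>R e) e"])
    qed
    obtain z where "0 < z" "z < 1 / real (Suc n)"
      "F (x + (1 / real (Suc n)) *\<^sub>R e) - F (x + 0 *\<^sub>R e) = (1 / real (Suc n) - 0) * F' (x + z *\<^sub>R e) e"
      using MVT2[of 0 "1 / real (Suc n)" "\<lambda>t. F (x + t *\<^sub>R e)" "\<lambda>t. F' (x + t *\<^sub>R e) e"] d by auto
    then show ?thesis by (intro exI[of _ z]) (simp add: q_def)
  qed
  have comp: "compact ((\<lambda>x. F' x e) ` cball 0 (r + 2 * norm e))"
    by (intro compact_continuous_image continuous_on_subset[OF cont]) auto
  obtain C where "\<forall>y\<in>(\<lambda>x. F' x e) ` cball 0 (r + 2 * norm e). norm y \<le> C"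
    using compact_imp_bounded[OF comp] unfolding bounded_iff by blast
  then have C: "\<And>x. norm x \<le> r + 2 * norm e \<Longrightarrow> \<bar>F' x e\<bar> \<le> C" by simp
  have bound: "\<bar>q n x\<bar> \<le> \<bar>C\<bar> * indicator (cball 0 (r + norm e)) x" for n x
  proof (cases "x \<in> cball 0 (r + norm e)")
    case True
    obtain z where z: "0 < z" "z < 1 / real (Suc n)" "q n x = F' (x + z *\<^sub>R e) e" using mean by blast
    have "1 / real (Suc n) \<le> 1" by simp
    with z(2) have "z \<le> 1" by (rule less_imp_le[OF less_le_trans])
    then have "z * norm e \<le> 1 * norm e" by (intro mult_right_mono) auto
    then have "norm (x + z *\<^sub>R e) \<le> r + 2 * norm e"
      using norm_triangle_ineq[of x "z *\<^sub>R e"] True z(1) by simp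
    from C[OF this] have "\<bar>q n x\<bar> \<le> \<bar>C\<bar>" using z(3) by linarith
    then show ?thesis using True by simp
  next
    case False
    let ?c = "(1 / real (Suc n)) *\<^sub>R e"
    have "norm ?c \<le> norm e" using mult_right_mono[of "1 / real (Suc n)" 1 "norm e"] by simp
    moreover have "r + norm e < norm x" using False by simp
    moreover have "norm x \<le> norm (x + ?c) + norm ?c" using norm_triangle_ineq4[of "x + ?c" ?c] by simp
    ultimately have "r < norm (x + ?c)" "r < norm x" using norm_ge_zero[of e] by linarith+
    from supp[OF this(1)] supp[OF this(2)] have "q n x = 0" unfolding q_def by simp
    then show ?thesis by simp
  qed
  have "(\<lambda>n. LINT x|lborel. q n x) \<longlonglongrightarrow> (LINT x|lborel. F' x e)"
  proof (rule integral_dominated_convergence)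
    show "integrable lborel (\<lambda>x. \<bar>C\<bar> * indicator (cball 0 (r + norm e)) x)"
      using emeasure_bounded_finite[OF bounded_cball] by (intro integrable_mult_right) (auto simp: integrable_indicator_iff)
    show "AE x in lborel. (\<lambda>n. q n x) \<longlonglongrightarrow> F' x e"
    proof (rule AE_I2)
      fix x
      have "\<forall>n. \<exists>z. 0 < z \<and> z < 1 / real (Suc n) \<and> q n x = F' (x + z *\<^sub>R e) e" using mean by blast
      then obtain z where "\<forall>n. 0 < z n \<and> z n < 1 / real (Suc n) \<and> q n x = F' (x + z n *\<^sub>R e) e"
        by (rule choice[THEN exE])
      then have z: "\<And>n. 0 < z n" "\<And>n. z n < 1 / real (Suc n)" "\<And>n. q n x = F' (x + z n *\<^sub>R e) e"
        by blast+
      have "z \<longlonglongrightarrow> 0"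
        by (rule Lim_null_comparison[OF always_eventually LIMSEQ_inverse_real_of_nat])
           (use z(1,2) in \<open>auto simp: less_imp_le inverse_eq_divide simp del: of_nat_Suc\<close>)
      then have "(\<lambda>n. x + z n *\<^sub>R e) \<longlonglongrightarrow> x + 0 *\<^sub>R e" by (intro tendsto_intros)
      then have "(\<lambda>n. F' (x + z n *\<^sub>R e) e) \<longlonglongrightarrow> F' (x + 0 *\<^sub>R e) e"
        by (rule continuous_on_tendsto_compose[OF cont]) auto
      then show "(\<lambda>n. q n x) \<longlonglongrightarrow> F' x e" by (simp add: z(3))
    qed
    show "AE x in lborel. norm (q n x) \<le> \<bar>C\<bar> * indicator (cball 0 (r + norm e)) x" for n
      using bound by simp
  qed measurable
  then show ?thesis using int_q LIMSEQ_unique[OF _ tendsto_const] by simp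
qed

section \<open>Functions with vanishing averages against test functions\<close>

lemma box_Int_box_exists: "\<exists>c d. box a b \<inter> box a' b' = box c (d :: 'a::euclidean_space)"
  by (auto simp: box_Int_box)

text \<open>Boxes form a generating system stable under intersections, so the integrals over all Borel sets vanish,
  in particular those over the sets where \<open>g\<close> is positive or negative. The last hypothesis starts the
  induction on complements.\<close>

lemma AE_zero_if_box_integrals_zero:
  fixes g :: "'a::euclidean_space \<Rightarrow> real"
  assumes int: "integrable lborel g" and zero: "\<And>a b. (LINT x:box a b|lborel. g x) = 0"
    and total: "(LINT x|lborel. g x) = 0"
  shows "AE x in lborel. g x = 0"
proof -
  have [measurable]: "g \<in> borel_measurable borel" using int by simp
  have int_A: "set_integrable lborel A g" if "A \<in> sets borel" for A
    unfolding set_integrable_def by (rule integrable_mult_indicator) (use int that in simp_all)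
  have sets: "sets borel = sigma_sets UNIV (range (\<lambda>(a, b). box a (b :: 'a)))"
    by (simp add: borel_eq_box sets_measure_of)
  have all: "(LINT x:A|lborel. g x) = 0" if "A \<in> sets borel" for A
  proof -
    have "Int_stable (range (\<lambda>(a, b). box a (b :: 'a)))"
    proof (rule Int_stableI_image)
      fix p q :: "'a \<times> 'a"
      obtain c d where "box (fst p) (snd p) \<inter> box (fst q) (snd q) = box c d"
        using box_Int_box_exists by blast
      then show "\<exists>k\<in>UNIV. (case p of (a, b) \<Rightarrow> box a b) \<inter> (case q of (a, b) \<Rightarrow> box a b)
          = (case k of (a, b) \<Rightarrow> box a b)"
        by (intro bexI[of _ "(c, d)"]) (simp_all add: split_beta)
    qed
    moreover have "range (\<lambda>(a, b). box a (b :: 'a)) \<subseteq> Pow UNIV" by simp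
    moreover have "A \<in> sigma_sets UNIV (range (\<lambda>(a, b). box a (b :: 'a)))" using that sets by simp
    ultimately show ?thesis
    proof (induction rule: sigma_sets_induct_disjoint)
      case (basic A)
      then show ?case using zero by auto
    next
      case empty
      show ?case by (simp add: set_lebesgue_integral_def)
    next
      case (compl A)
      then have A: "A \<in> sets borel" by (simp add: sets)
      have "(LINT x:UNIV - A|lborel. g x) = (LINT x|lborel. g x) - (LINT x:A|lborel. g x)"
      proof -
        have "(\<lambda>x. indicator (UNIV - A) x *\<^sub>R g x) = (\<lambda>x. g x - indicator A x *\<^sub>R g x)"
          by (auto split: split_indicator)
        then show ?thesis
          using int_A[OF A] int unfolding set_lebesgue_integral_def set_integrable_def by simp
      qed
      then show ?case using compl total by simp
    next
      case (union A)
      then have "range A \<subseteq> sets borel" by (simp add: sets)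
      then have A: "A i \<in> sets borel" for i by blast
      have "(LINT x:(\<Union>i. A i)|lborel. g x) = (\<Sum>i. LINT x:A i|lborel. g x)"
      proof (rule lebesgue_integral_countable_add)
        show "A i \<in> sets lborel" for i using A by simp
        show "set_integrable lborel (\<Union>i. A i) g" by (rule int_A) (use A in blast)
        show "i \<noteq> j \<Longrightarrow> A i \<inter> A j = {}" for i j
          using union(1) by (simp add: disjoint_family_on_def)
      qed
      then show ?case using union by simp
    qed
  qed
  have half: "AE x in lborel. x \<in> A \<longrightarrow> g x = 0"
    if A [measurable]: "A \<in> sets borel" and s: "\<And>x. x \<in> A \<Longrightarrow> 0 \<le> c * g x" "c \<noteq> 0" for A c
  proof -
    have "integrable lborel (\<lambda>x. c * (indicator A x * g x))"
      using int_A[OF A] by (simp add: set_integrable_def)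
    moreover have "(LINT x|lborel. c * (indicator A x * g x)) = 0"
      using all[OF A] by (simp add: set_lebesgue_integral_def)
    ultimately have "AE x in lborel. c * (indicator A x * g x) = 0"
      by (subst (asm) integral_nonneg_eq_0_iff_AE) (use s in \<open>auto split: split_indicator\<close>)
    then show ?thesis by eventually_elim (use s(2) in \<open>auto split: split_indicator_asm\<close>)
  qed
  have pos: "{x. 0 < g x} \<in> sets borel" and neg: "{x. g x < 0} \<in> sets borel" by measurable
  have "AE x in lborel. x \<in> {x. 0 < g x} \<longrightarrow> g x = 0" by (rule half[OF pos, of 1]) auto
  moreover have "AE x in lborel. x \<in> {x. g x < 0} \<longrightarrow> g x = 0" by (rule half[OF neg, of "-1"]) auto
  ultimately show ?thesis by eventually_elim (metis linorder_neqE mem_Collect_eq)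
qed

text \<open>Bump functions approximate indicators of boxes, so the integrals over all boxes in \<open>\<Omega>\<close>
  vanish.\<close>

lemma AE_zero_if_test_integrals_zero:
  fixes g :: "'a::euclidean_space \<Rightarrow> real"
  assumes "open \<Omega>" and sq: "square_int g"
    and zero: "\<And>\<phi>. \<phi> \<in> test_functions \<Omega> \<Longrightarrow> (LINT x|lborel. g x * \<phi> x) = 0"
  shows "AE x in lborel. x \<in> \<Omega> \<longrightarrow> g x = 0"
proof -
  have [measurable]: "g \<in> borel_measurable borel" using sq by (simp add: square_int_def)
  have int_box: "set_integrable lborel (box a b) g" for a b
  proof -
    have "integrable lborel (indicator (box a b) :: 'a \<Rightarrow> real)"
      using emeasure_lborel_box_finite[of a b] by (simp add: integrable_indicator_iff)
    moreover have "integrable lborel (\<lambda>x. (norm (g x))\<^sup>2)" using sq by (simp add: square_int_def)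
    ultimately have "integrable lborel (\<lambda>x. indicator (box a b) x + (norm (g x))\<^sup>2)"
      by (rule Bochner_Integration.integrable_add)
    then show ?thesis
      unfolding set_integrable_def
    proof (rule Bochner_Integration.integrable_bound)
      have "\<bar>t\<bar> \<le> 1 + t\<^sup>2" for t :: real
        using sum_squares_ge_zero[of "\<bar>t\<bar> - 1/2" 0] by (simp add: power2_eq_square algebra_simps)
      then show "AE x in lborel. norm (indicator (box a b) x *\<^sub>R g x) \<le> norm (indicator (box a b) x + (norm (g x))\<^sup>2)"
        by (intro AE_I2) (auto split: split_indicator)
    qed measurable
  qed
  have sub: "(LINT x:box a b|lborel. g x) = 0" if ab: "box a b \<subseteq> \<Omega>" for a b
  proof -
    have [measurable]: "bump a b n \<in> borel_measurable borel" for n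
      by (intro borel_measurable_continuous_onI smooth_continuous smooth_bump)
    have inside: "bump a b n x \<noteq> 0 \<Longrightarrow> x \<in> box a b" for n x
      using bump_test_function[OF order_refl, of a b n] closure_subset[of "{x. bump a b n x \<noteq> 0}"]
      by (auto simp: test_functions_def)
    have "(\<lambda>n. LINT x|lborel. g x * bump a b n x) \<longlonglongrightarrow> (LINT x|lborel. indicator (box a b) x *\<^sub>R g x)"
    proof (rule integral_dominated_convergence)
      show "integrable lborel (\<lambda>x. \<bar>indicator (box a b) x *\<^sub>R g x\<bar>)"
        using int_box[of a b] by (intro integrable_abs) (simp add: set_integrable_def)
      show "AE x in lborel. (\<lambda>n. g x * bump a b n x) \<longlonglongrightarrow> indicator (box a b) x *\<^sub>R g x"
      proof (rule AE_I2)
        fix x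
        have "(\<lambda>n. g x * bump a b n x) \<longlonglongrightarrow> g x * indicator (box a b) x"
          by (intro tendsto_mult tendsto_const bump_tendsto)
        then show "(\<lambda>n. g x * bump a b n x) \<longlonglongrightarrow> indicator (box a b) x *\<^sub>R g x" by (simp add: mult.commute)
      qed
      show "AE x in lborel. norm (g x * bump a b n x) \<le> \<bar>indicator (box a b) x *\<^sub>R g x\<bar>" for n
      proof (rule AE_I2)
        fix x
        have "\<bar>bump a b n x\<bar> \<le> indicator (box a b) x"
          using bump_bounds[of a b n x] inside[of n x] by (auto split: split_indicator)
        then have "\<bar>g x\<bar> * \<bar>bump a b n x\<bar> \<le> \<bar>g x\<bar> * indicator (box a b) x" by (intro mult_left_mono) auto
        then show "norm (g x * bump a b n x) \<le> \<bar>indicator (box a b) x *\<^sub>R g x\<bar>"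
          by (simp add: abs_mult mult.commute)
      qed
    qed measurable
    moreover have "(LINT x|lborel. g x * bump a b n x) = 0" for n
      by (rule zero[OF bump_test_function[OF ab]])
    ultimately show ?thesis using LIMSEQ_unique[OF _ tendsto_const] by (simp add: set_lebesgue_integral_def)
  qed
  have box: "AE x in lborel. x \<in> box a b \<longrightarrow> g x = 0" if ab: "box a b \<subseteq> \<Omega>" for a b
  proof -
    have "AE x in lborel. indicator (box a b) x *\<^sub>R g x = 0"
    proof (rule AE_zero_if_box_integrals_zero)
      show "integrable lborel (\<lambda>x. indicator (box a b) x *\<^sub>R g x)"
        using int_box[of a b] by (simp add: set_integrable_def)
      show "(LINT x|lborel. indicator (box a b) x *\<^sub>R g x) = 0"
        using sub[OF ab] by (simp add: set_lebesgue_integral_def)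
      fix c d
      obtain p q where pq: "box c d \<inter> box a b = box p q" using box_Int_box_exists by blast
      have "(LINT x:box c d|lborel. indicator (box a b) x *\<^sub>R g x) = (LINT x:box c d \<inter> box a b|lborel. g x)"
        unfolding set_lebesgue_integral_def
        by (intro Bochner_Integration.integral_cong) (auto split: split_indicator)
      also have "\<dots> = 0" unfolding pq by (rule sub) (simp add: pq[symmetric] le_infI2 ab)
      finally show "(LINT x:box c d|lborel. indicator (box a b) x *\<^sub>R g x) = 0" .
    qed
    then show ?thesis by eventually_elim (auto split: split_indicator_asm)
  qed
  obtain \<D> where D: "countable \<D>" "\<And>X. X \<in> \<D> \<Longrightarrow> X \<subseteq> \<Omega>" "\<And>X. X \<in> \<D> \<Longrightarrow> \<exists>a b. X = box a b" "\<Union>\<D> = \<Omega>"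
    by (rule open_countable_Union_open_box[OF \<open>open \<Omega>\<close>]) blast
  have "AE x in lborel. \<forall>X\<in>\<D>. x \<in> X \<longrightarrow> g x = 0"
    unfolding AE_ball_countable[OF D(1)]
  proof
    fix X assume "X \<in> \<D>"
    obtain a b where "X = box a b" using D(3)[OF \<open>X \<in> \<D>\<close>] by blast
    moreover have "X \<subseteq> \<Omega>" by (rule D(2)[OF \<open>X \<in> \<D>\<close>])
    ultimately show "AE x in lborel. x \<in> X \<longrightarrow> g x = 0" using box by simp
  qed
  then show ?thesis by eventually_elim (use D(4) in blast)
qed

section \<open>Test functions\<close>

lemma test_smooth: "\<phi> \<in> test_functions \<Omega> \<Longrightarrow> smooth \<phi>"
  by (simp add: test_functions_def)

lemma test_zero: "\<phi> \<in> test_functions \<Omega> \<Longrightarrow> x \<notin> \<Omega> \<Longrightarrow> \<phi> x = 0"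
  using closure_subset[of "{x. \<phi> x \<noteq> 0}"] by (auto simp: test_functions_def)

lemma test_smaller_support:
  assumes "\<phi> \<in> test_functions \<Omega>" "smooth \<psi>" and sub: "\<And>x. \<psi> x \<noteq> 0 \<Longrightarrow> x \<in> closure {x. \<phi> x \<noteq> 0}"
  shows "\<psi> \<in> test_functions \<Omega>"
proof -
  have *: "closure {x. \<psi> x \<noteq> 0} \<subseteq> closure {x. \<phi> x \<noteq> 0}"
    by (rule closure_minimal) (simp_all add: subset_iff sub)
  have "bounded (closure {x. \<phi> x \<noteq> 0})"
    using assms(1) by (simp add: test_functions_def compact_imp_bounded)
  then have "compact (closure {x. \<psi> x \<noteq> 0})"
    using bounded_subset[OF _ *] by (simp add: compact_eq_bounded_closed)
  moreover have "closure {x. \<phi> x \<noteq> 0} \<subseteq> \<Omega>" using assms(1) by (simp add: test_functions_def)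
  ultimately show ?thesis using assms(2) order_trans[OF *] by (simp add: test_functions_def)
qed

lemma test_bounded_linear:
  assumes "\<phi> \<in> test_functions \<Omega>" "bounded_linear h"
  shows "(\<lambda>x. h (\<phi> x)) \<in> test_functions \<Omega>"
proof (rule test_smaller_support[OF assms(1)])
  show "smooth (\<lambda>x. h (\<phi> x))" by (rule smooth_bounded_linear[OF assms(2) test_smooth[OF assms(1)]])
  show "x \<in> closure {x. \<phi> x \<noteq> 0}" if "h (\<phi> x) \<noteq> 0" for x
    using that closure_subset[of "{x. \<phi> x \<noteq> 0}"] linear_0[OF bounded_linear.linear[OF assms(2)]] by auto
qed

lemma test_nth: "\<phi> \<in> test_functions \<Omega> \<Longrightarrow> (\<lambda>x. \<phi> x $ i) \<in> test_functions \<Omega>"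
  by (rule test_bounded_linear[OF _ bounded_linear_vec_nth])

lemma test_scaleR: "\<phi> \<in> test_functions \<Omega> \<Longrightarrow> (\<lambda>x. c *\<^sub>R \<phi> x) \<in> test_functions \<Omega>"
  by (rule test_bounded_linear[OF _ bounded_linear_scaleR_right])

lemma test_scaleR_const: "\<phi> \<in> test_functions \<Omega> \<Longrightarrow> (\<lambda>x. \<phi> x *\<^sub>R v) \<in> test_functions \<Omega>"
  by (rule test_bounded_linear[OF _ bounded_linear_scaleR_left])

lemma test_add:
  assumes "\<phi> \<in> test_functions \<Omega>" "\<psi> \<in> test_functions \<Omega>"
  shows "(\<lambda>x. \<phi> x + \<psi> x) \<in> test_functions \<Omega>"
proof -
  let ?K = "closure {x. \<phi> x \<noteq> 0} \<union> closure {x. \<psi> x \<noteq> 0}"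
  have K: "compact ?K" "?K \<subseteq> \<Omega>" using assms by (auto simp: test_functions_def)
  have *: "closure {x. \<phi> x + \<psi> x \<noteq> 0} \<subseteq> ?K"
  proof (rule closure_minimal)
    show "{x. \<phi> x + \<psi> x \<noteq> 0} \<subseteq> ?K"
    proof
      fix x assume "x \<in> {x. \<phi> x + \<psi> x \<noteq> 0}"
      then have "x \<in> {x. \<phi> x \<noteq> 0} \<or> x \<in> {x. \<psi> x \<noteq> 0}" by auto
      then show "x \<in> ?K"
        using subsetD[OF closure_subset[of "{x. \<phi> x \<noteq> 0}"]] subsetD[OF closure_subset[of "{x. \<psi> x \<noteq> 0}"]] by blast
    qed
  qed auto
  have "compact (closure {x. \<phi> x + \<psi> x \<noteq> 0})"
    using bounded_subset[OF compact_imp_bounded[OF K(1)] *] by (simp add: compact_eq_bounded_closed)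
  then show ?thesis
    using * K(2) smooth_add[OF test_smooth[OF assms(1)] test_smooth[OF assms(2)]]
    by (auto simp: test_functions_def)
qed

lemma test_pdiff:
  fixes \<phi> :: "real^2 \<Rightarrow> 'b::euclidean_space"
  assumes "\<phi> \<in> test_functions \<Omega>"
  shows "pdiff j \<phi> \<in> test_functions \<Omega>"
proof (rule test_smaller_support[OF assms])
  show "smooth (pdiff j \<phi>)"
    unfolding pdiff_def[abs_def] by (rule smooth_deriv[OF test_smooth[OF assms]]) simp
  fix x
  show "x \<in> closure {x. \<phi> x \<noteq> 0}" if "pdiff j \<phi> x \<noteq> 0"
  proof (rule ccontr)
    assume out: "x \<notin> closure {x. \<phi> x \<noteq> 0}"
    have "(\<phi> has_derivative (\<lambda>_. 0)) (at x)"
    proof (rule has_derivative_transform_within_open)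
      show "((\<lambda>_. 0) has_derivative (\<lambda>_. 0)) (at x)" by simp
      show "open (- closure {x. \<phi> x \<noteq> 0})" by (simp add: open_Compl)
      show "x \<in> - closure {x. \<phi> x \<noteq> 0}" using out by simp
      show "0 = \<phi> y" if "y \<in> - closure {x. \<phi> x \<noteq> 0}" for y
        using that closure_subset[of "{x. \<phi> x \<noteq> 0}"] by auto
    qed
    then have "pdiff j \<phi> x = 0" by (simp add: pdiff_def frechet_derivative_eqI)
    then show False using that by simp
  qed
qed

lemma test_integrable_mult:
  fixes \<phi> g :: "'a::euclidean_space \<Rightarrow> real"
  assumes "\<phi> \<in> test_functions \<Omega>" and g: "continuous_on UNIV g"
  shows "integrable lborel (\<lambda>x. \<phi> x * g x)"
proof -
  let ?K = "closure {x. \<phi> x \<noteq> 0}"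
  have "integrable lborel (\<lambda>x. indicator ?K x *\<^sub>R (\<phi> x * g x))"
  proof (rule borel_integrable_compact)
    show "compact ?K" using assms(1) by (simp add: test_functions_def)
    show "continuous_on ?K (\<lambda>x. \<phi> x * g x)"
      by (intro continuous_on_mult smooth_continuous[OF test_smooth[OF assms(1)]] continuous_on_subset[OF g] subset_UNIV)
  qed
  also have "(\<lambda>x. indicator ?K x *\<^sub>R (\<phi> x * g x)) = (\<lambda>x. \<phi> x * g x)"
    using closure_subset[of "{x. \<phi> x \<noteq> 0}"] by (auto simp: fun_eq_iff split: split_indicator)
  finally show ?thesis .
qed

lemma test_bounded_support:
  assumes "\<phi> \<in> test_functions \<Omega>"
  obtains r where "\<And>x. r < norm x \<Longrightarrow> \<phi> x = 0"
proof -
  have "bounded (closure {x. \<phi> x \<noteq> 0})"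
    using assms by (simp add: test_functions_def compact_imp_bounded)
  then obtain r where r: "\<forall>x\<in>closure {x. \<phi> x \<noteq> 0}. norm x \<le> r" unfolding bounded_iff by blast
  have "\<phi> x = 0" if "r < norm x" for x
  proof (rule ccontr)
    assume "\<phi> x \<noteq> 0"
    then have "x \<in> closure {x. \<phi> x \<noteq> 0}" using closure_subset[of "{x. \<phi> x \<noteq> 0}"] by auto
    then show False using r \<open>r < norm x\<close> by force
  qed
  then show ?thesis using that by blast
qed

lemma pdiff_eqI: "(f has_derivative f') (at x) \<Longrightarrow> pdiff j f x = f' (axis j 1)"
  by (simp add: pdiff_def frechet_derivative_eqI)

lemma pdiff_nth:
  assumes "smooth \<phi>" shows "pdiff j (\<lambda>x. \<phi> x $ i) x = pdiff j \<phi> x $ i"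
  unfolding pdiff_def[of j \<phi>]
  by (rule pdiff_eqI[OF bounded_linear.has_derivative[OF bounded_linear_vec_nth smooth_has_derivative[OF assms]]])

lemma pdiff_mult:
  fixes \<phi> \<psi> :: "real^2 \<Rightarrow> real"
  assumes "smooth \<phi>" "smooth \<psi>"
  shows "pdiff j (\<lambda>x. \<phi> x * \<psi> x) x = \<phi> x * pdiff j \<psi> x + pdiff j \<phi> x * \<psi> x"
  unfolding pdiff_def[of j \<phi>] pdiff_def[of j \<psi>]
  by (rule pdiff_eqI[OF has_derivative_mult[OF smooth_has_derivative[OF assms(1)] smooth_has_derivative[OF assms(2)]]])

lemma smooth_mult:
  fixes \<phi> \<psi> :: "'a::euclidean_space \<Rightarrow> real"
  shows "smooth \<phi> \<Longrightarrow> smooth \<psi> \<Longrightarrow> smooth (\<lambda>x. \<phi> x * \<psi> x)"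
  by (simp add: smooth_def Ck_mult)

lemma test_integration_by_parts:
  fixes \<phi> \<psi> :: "real^2 \<Rightarrow> real"
  assumes \<phi>: "\<phi> \<in> test_functions \<Omega>" and \<psi>: "smooth \<psi>"
  shows "(LINT x|lborel. \<phi> x * pdiff j \<psi> x) = - (LINT x|lborel. pdiff j \<phi> x * \<psi> x)"
proof -
  obtain r where r: "\<And>x. r < norm x \<Longrightarrow> \<phi> x = 0" using test_bounded_support[OF \<phi>] by blast
  have sm: "smooth (\<lambda>x. \<phi> x * \<psi> x)" by (rule smooth_mult[OF test_smooth[OF \<phi>] \<psi>])
  have "(LINT x|lborel. frechet_derivative (\<lambda>x. \<phi> x * \<psi> x) (at x) (axis j 1)) = 0"
  proof (rule integral_derivative_zero)
    show "((\<lambda>x. \<phi> x * \<psi> x) has_derivative frechet_derivative (\<lambda>x. \<phi> x * \<psi> x) (at x)) (at x)" for x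
      by (rule smooth_has_derivative[OF sm])
    show "continuous_on UNIV (\<lambda>x. frechet_derivative (\<lambda>x. \<phi> x * \<psi> x) (at x) (axis j 1))"
      using continuous_pdiff[OF sm] by (simp add: pdiff_def[abs_def])
    show "\<phi> x * \<psi> x = 0" if "r < norm x" for x using r[OF that] by simp
  qed
  then have "(LINT x|lborel. \<phi> x * pdiff j \<psi> x + pdiff j \<phi> x * \<psi> x) = 0"
    using pdiff_mult[OF test_smooth[OF \<phi>] \<psi>, of j] by (simp add: pdiff_def[of j "\<lambda>x. \<phi> x * \<psi> x"])
  moreover have "integrable lborel (\<lambda>x. \<phi> x * pdiff j \<psi> x)"
    by (rule test_integrable_mult[OF \<phi> continuous_pdiff[OF \<psi>]])
  moreover have "integrable lborel (\<lambda>x. pdiff j \<phi> x * \<psi> x)"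
    by (rule test_integrable_mult[OF test_pdiff[OF \<phi>] smooth_continuous[OF \<psi>]])
  ultimately show ?thesis by simp
qed

section \<open>Weak gradients\<close>

lemma inner_axis_matrix: "(A :: real^2^2) \<bullet> (c *\<^sub>R axis i (axis j 1)) = A $ i $ j * c"
  by (simp add: inner_axis)

lemma inner_axis_vector: "(v :: real^2) \<bullet> (c *\<^sub>R axis i 1) = v $ i * c"
  by (simp add: inner_axis)

text \<open>Both sides of the definition of weak gradients are inner products with fixed elements of \<open>L\<^sup>2\<close>; this makes the
  definition stable under limits.\<close>

lemma weak_grad_left:
  assumes \<psi>: "\<psi> \<in> test_functions \<Omega>"
  shows "(LINT x:\<Omega>|lborel. L2_fun u x $ i * \<psi> x) = (u :: (real^2, real^2) L2) \<bullet> L2_class (\<lambda>x. \<psi> x *\<^sub>R axis i 1)"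
proof -
  have "u \<bullet> L2_class (\<lambda>x. \<psi> x *\<^sub>R axis i 1) = (LINT x|lborel. L2_fun u x \<bullet> (\<psi> x *\<^sub>R axis i 1))"
    by (rule inner_L2_class_right[OF test_functions_square_int[OF test_scaleR_const[OF \<psi>]]])
  also have "\<dots> = (LINT x:\<Omega>|lborel. L2_fun u x $ i * \<psi> x)"
    unfolding set_lebesgue_integral_def inner_axis_vector
    by (intro Bochner_Integration.integral_cong) (use test_zero[OF \<psi>] in \<open>auto split: split_indicator\<close>)
  finally show ?thesis by simp
qed

lemma weak_grad_right:
  assumes \<psi>: "\<psi> \<in> test_functions \<Omega>"
  shows "(LINT x:\<Omega>|lborel. L2_fun G x $ i $ j * \<psi> x) = (G :: (real^2, real^2^2) L2) \<bullet> L2_class (\<lambda>x. \<psi> x *\<^sub>R axis i (axis j 1))"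
proof -
  have "G \<bullet> L2_class (\<lambda>x. \<psi> x *\<^sub>R axis i (axis j 1)) = (LINT x|lborel. L2_fun G x \<bullet> (\<psi> x *\<^sub>R axis i (axis j 1)))"
    by (rule inner_L2_class_right[OF test_functions_square_int[OF test_scaleR_const[OF \<psi>]]])
  also have "\<dots> = (LINT x:\<Omega>|lborel. L2_fun G x $ i $ j * \<psi> x)"
    unfolding set_lebesgue_integral_def inner_axis_matrix
    by (intro Bochner_Integration.integral_cong) (use test_zero[OF \<psi>] in \<open>auto split: split_indicator\<close>)
  finally show ?thesis by simp
qed

lemma is_weak_grad_iff:
  "is_weak_grad \<Omega> u G \<longleftrightarrow> G \<in> L2_on \<Omega> \<and> (\<forall>\<psi>\<in>test_functions \<Omega>. \<forall>i j.
     u \<bullet> L2_class (\<lambda>x. pdiff j \<psi> x *\<^sub>R axis i 1) = - (G \<bullet> L2_class (\<lambda>x. \<psi> x *\<^sub>R axis i (axis j 1))))"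
proof -
  have "(LINT x:\<Omega>|lborel. L2_fun u x $ i * frechet_derivative \<psi> (at x) (axis j 1))
      = u \<bullet> L2_class (\<lambda>x. pdiff j \<psi> x *\<^sub>R axis i 1)" if "\<psi> \<in> test_functions \<Omega>" for \<psi> i j
    using weak_grad_left[OF test_pdiff[OF that], of u i j] by (simp add: pdiff_def)
  then show ?thesis unfolding is_weak_grad_def by (simp add: weak_grad_right cong: ball_cong)
qed

lemma L2_on_diff:
  assumes "u \<in> L2_on \<Omega>" "v \<in> L2_on \<Omega>" shows "u - v \<in> L2_on \<Omega>"
  using assms L2_fun_diff[of u v] unfolding L2_on_def mem_Collect_eq by eventually_elim auto

lemma closed_L2_on: "closed (L2_on \<Omega>)"
  unfolding closed_sequential_limits
proof (intro allI impI)
  fix u u0 assume "(\<forall>n. u n \<in> L2_on \<Omega>) \<and> u \<longlonglongrightarrow> u0"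
  then have u: "\<And>n. u n \<in> L2_on \<Omega>" and lim: "u \<longlonglongrightarrow> u0" by auto
  obtain r where r: "AE x in lborel. (\<lambda>n. L2_fun (u (r n)) x) \<longlonglongrightarrow> L2_fun u0 x"
    using L2_subseq_AE[OF lim] by blast
  have "AE x in lborel. \<forall>n. x \<notin> \<Omega> \<longrightarrow> L2_fun (u (r n)) x = 0"
    unfolding AE_all_countable using u by (auto simp: L2_on_def)
  with r show "u0 \<in> L2_on \<Omega>"
    unfolding L2_on_def mem_Collect_eq
  proof eventually_elim
    case (elim x)
    then show ?case using LIMSEQ_unique[OF elim(1), of 0] by auto
  qed
qed

lemma norm_entry_le: "norm ((A :: real^2^2) $ i $ j) \<le> norm A"
  by (rule order_trans[OF Finite_Cartesian_Product.norm_nth_le Finite_Cartesian_Product.norm_nth_le])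

lemma weak_grad_unique:
  assumes "open \<Omega>" "is_weak_grad \<Omega> u G" "is_weak_grad \<Omega> u G'"
  shows "G = G'"
proof -
  let ?E = "G - G'"
  have on: "?E \<in> L2_on \<Omega>" using assms by (intro L2_on_diff) (auto simp: is_weak_grad_def)
  have comp: "AE x in lborel. x \<in> \<Omega> \<longrightarrow> L2_fun ?E x $ i $ j = 0" for i j
  proof (rule AE_zero_if_test_integrals_zero[OF \<open>open \<Omega>\<close>])
    show "square_int (\<lambda>x. L2_fun ?E x $ i $ j)"
    proof (rule square_intI)
      have "(\<lambda>A :: real^2^2. A $ i $ j) \<in> borel_measurable borel"
        by (intro borel_measurable_continuous_onI continuous_intros)
      then show "(\<lambda>x. L2_fun ?E x $ i $ j) \<in> borel_measurable borel"
        by (rule measurable_compose[OF measurable_L2_fun])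
      have "(\<integral>\<^sup>+x. ennreal ((norm (L2_fun ?E x $ i $ j))\<^sup>2) \<partial>lborel) \<le> (\<integral>\<^sup>+x. ennreal ((norm (L2_fun ?E x))\<^sup>2) \<partial>lborel)"
        by (intro nn_integral_mono ennreal_leI power_mono norm_entry_le norm_ge_zero)
      then show "(\<integral>\<^sup>+x. ennreal ((norm (L2_fun ?E x $ i $ j))\<^sup>2) \<partial>lborel) < \<infinity>"
        by (rule le_less_trans) (simp add: nn_norm_L2)
    qed
    fix \<psi> :: "real^2 \<Rightarrow> real" assume \<psi>: "\<psi> \<in> test_functions \<Omega>"
    have "?E \<bullet> L2_class (\<lambda>x. \<psi> x *\<^sub>R axis i (axis j 1)) = 0"
      using assms(2,3) \<psi> unfolding is_weak_grad_iff by (simp add: inner_diff_left)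
    then have "(LINT x|lborel. L2_fun ?E x \<bullet> (\<psi> x *\<^sub>R axis i (axis j 1))) = 0"
      by (simp add: inner_L2_class_right[OF test_functions_square_int[OF test_scaleR_const[OF \<psi>]]])
    then show "(LINT x|lborel. L2_fun ?E x $ i $ j * \<psi> x) = 0" by (simp only: inner_axis_matrix)
  qed
  have "AE x in lborel. \<forall>i j. x \<in> \<Omega> \<longrightarrow> L2_fun ?E x $ i $ j = 0"
    by (intro eventually_all_finite comp)
  moreover have "AE x in lborel. x \<notin> \<Omega> \<longrightarrow> L2_fun ?E x = 0" using on by (simp add: L2_on_def)
  moreover have "AE x in lborel. L2_fun (0 :: (real^2, real^2^2) L2) x = 0" by (rule L2_fun_zero)
  ultimately have "AE x in lborel. L2_fun ?E x = L2_fun 0 x"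
  proof eventually_elim
    case (elim x)
    then show ?case by (cases "x \<in> \<Omega>") (auto simp: vec_eq_iff)
  qed
  then have "?E = 0" by (rule L2_eqI)
  then show ?thesis by simp
qed

lemma grad_eqI: "open \<Omega> \<Longrightarrow> is_weak_grad \<Omega> u G \<Longrightarrow> grad \<Omega> u = G"
  unfolding grad_def by (rule the_equality) (auto intro: weak_grad_unique)

section \<open>The energy space as a closure of smooth fields\<close>

definition jac :: "(real^2 \<Rightarrow> real^2) \<Rightarrow> real^2 \<Rightarrow> real^2^2" where
  "jac \<phi> x = jacobian \<phi> (at x)"

lemma jac_nth: "jac \<phi> x $ i $ j = pdiff j \<phi> x $ i"
  by (simp add: jac_def jacobian_def matrix_def pdiff_def)

lemma norm_jac: "(norm (jac \<phi> x))\<^sup>2 = (norm (pdiff 1 \<phi> x))\<^sup>2 + (norm (pdiff 2 \<phi> x))\<^sup>2"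
  by (simp add: power2_norm_eq_inner inner_vec_def UNIV_2 jac_nth)

lemma continuous_jac: "smooth \<phi> \<Longrightarrow> continuous_on S (jac \<phi>)"
proof -
  assume "smooth \<phi>"
  have "jac \<phi> = (\<lambda>x. \<chi> i j. pdiff j \<phi> x $ i)" by (simp add: fun_eq_iff vec_eq_iff jac_nth)
  then show ?thesis
    by (simp only:) (intro continuous_on_vec_lambda continuous_on_component continuous_pdiff[OF \<open>smooth \<phi>\<close>])
qed

lemma jac_energy:
  assumes "smooth \<phi>"
  shows "(\<integral>\<^sup>+x. ennreal ((norm (jac \<phi> x))\<^sup>2) \<partial>lborel) = energy 1 \<phi> + energy 2 \<phi>"
proof -
  note [measurable] = measurable_pdiff[OF assms]
  have "(\<integral>\<^sup>+x. ennreal ((norm (jac \<phi> x))\<^sup>2) \<partial>lborel)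
      = (\<integral>\<^sup>+x. ennreal ((norm (pdiff 1 \<phi> x))\<^sup>2) + ennreal ((norm (pdiff 2 \<phi> x))\<^sup>2) \<partial>lborel)"
    by (simp add: norm_jac)
  also have "\<dots> = energy 1 \<phi> + energy 2 \<phi>"
    unfolding energy_def by (rule nn_integral_add) measurable
  finally show ?thesis .
qed

lemma square_int_jac:
  assumes "\<phi> \<in> test_functions \<Omega>"
  shows "square_int (jac \<phi>)"
proof (rule square_intI)
  have sm: "smooth \<phi>" by (rule test_smooth[OF assms])
  show "jac \<phi> \<in> borel_measurable borel" by (intro borel_measurable_continuous_onI continuous_jac sm)
  have "energy j \<phi> < \<infinity>" for j
    unfolding energy_def nn_norm_L2_class[OF test_functions_square_int[OF test_pdiff[OF assms]]] by simp
  then show "(\<integral>\<^sup>+x. ennreal ((norm (jac \<phi> x))\<^sup>2) \<partial>lborel) < \<infinity>" unfolding jac_energy[OF sm] by simp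
qed

lemma norm_jac_class:
  assumes "\<phi> \<in> test_functions \<Omega>"
  shows "ennreal ((norm (L2_class (jac \<phi>)))\<^sup>2) = energy 1 \<phi> + energy 2 \<phi>"
  using nn_norm_L2_class[OF square_int_jac[OF assms]] jac_energy[OF test_smooth[OF assms]] by simp

lemma test_in_L2_on:
  fixes f :: "real^2 \<Rightarrow> 'b::euclidean_space"
  assumes "square_int f" "\<And>x. x \<notin> \<Omega> \<Longrightarrow> f x = 0"
  shows "L2_class f \<in> L2_on \<Omega>"
  unfolding L2_on_def mem_Collect_eq using L2_fun_L2_class[OF assms(1)]
  by eventually_elim (use assms(2) in auto)

lemma jac_zero_outside:
  assumes "\<phi> \<in> test_functions \<Omega>" "x \<notin> \<Omega>" shows "jac \<phi> x = 0"
  using test_zero[OF test_pdiff[OF assms(1)] assms(2)] by (simp add: vec_eq_iff jac_nth)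

lemma weak_grad_jac:
  assumes \<phi>: "\<phi> \<in> test_functions \<Omega>"
  shows "is_weak_grad \<Omega> (L2_class \<phi>) (L2_class (jac \<phi>))"
  unfolding is_weak_grad_iff
proof (intro conjI ballI allI)
  show "L2_class (jac \<phi>) \<in> L2_on \<Omega>"
    by (rule test_in_L2_on[OF square_int_jac[OF \<phi>] jac_zero_outside[OF \<phi>]])
  fix \<psi> :: "real^2 \<Rightarrow> real" and i j assume \<psi>: "\<psi> \<in> test_functions \<Omega>"
  have "L2_class \<phi> \<bullet> L2_class (\<lambda>x. pdiff j \<psi> x *\<^sub>R axis i 1)
      = (LINT x|lborel. \<phi> x \<bullet> (pdiff j \<psi> x *\<^sub>R axis i 1))"
    by (intro inner_L2_class test_functions_square_int[OF \<phi>]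
        test_functions_square_int[OF test_scaleR_const[OF test_pdiff[OF \<psi>]]])
  also have "\<dots> = (LINT x|lborel. \<phi> x $ i * pdiff j \<psi> x)" by (simp only: inner_axis_vector)
  also have "\<dots> = - (LINT x|lborel. pdiff j \<phi> x $ i * \<psi> x)"
    using test_integration_by_parts[OF test_nth[OF \<phi>, of i] test_smooth[OF \<psi>], of j]
    by (simp add: pdiff_nth[OF test_smooth[OF \<phi>]])
  also have "(LINT x|lborel. pdiff j \<phi> x $ i * \<psi> x) = (LINT x|lborel. jac \<phi> x \<bullet> (\<psi> x *\<^sub>R axis i (axis j 1)))"
    by (simp only: inner_axis_matrix jac_nth)
  also have "\<dots> = L2_class (jac \<phi>) \<bullet> L2_class (\<lambda>x. \<psi> x *\<^sub>R axis i (axis j 1))"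
    by (intro inner_L2_class[symmetric] square_int_jac[OF \<phi>]
        test_functions_square_int[OF test_scaleR_const[OF \<psi>]])
  finally show "L2_class \<phi> \<bullet> L2_class (\<lambda>x. pdiff j \<psi> x *\<^sub>R axis i 1)
      = - (L2_class (jac \<phi>) \<bullet> L2_class (\<lambda>x. \<psi> x *\<^sub>R axis i (axis j 1)))" .
qed

definition fields :: "(real^2) set \<Rightarrow> (real^2 \<Rightarrow> real^2) set" where
  "fields \<Omega> = {\<phi> \<in> test_functions \<Omega>. \<forall>x\<in>\<Omega>. divergence \<phi> x = 0}"

definition field_graph :: "(real^2) set \<Rightarrow> ((real^2, real^2) L2 \<times> (real^2, real^2^2) L2) set" where
  "field_graph \<Omega> = (\<lambda>\<phi>. (L2_class \<phi>, L2_class (jac \<phi>))) ` fields \<Omega>"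

lemma divergence_eq: "divergence \<phi> x = pdiff 1 \<phi> x $ 1 + pdiff 2 \<phi> x $ 2"
  unfolding divergence_def jac_def[symmetric] trace_def by (simp add: UNIV_2 jac_nth)

lemma fields_test: "\<phi> \<in> fields \<Omega> \<Longrightarrow> \<phi> \<in> test_functions \<Omega>"
  by (simp add: fields_def)

lemma Dsol_eq: "Dsol \<Omega> = L2_class ` fields \<Omega>"
  by (simp add: Dsol_def fields_def)

lemma pdiff_add: "smooth \<phi> \<Longrightarrow> smooth \<psi> \<Longrightarrow> pdiff j (\<lambda>x. \<phi> x + \<psi> x) x = pdiff j \<phi> x + pdiff j \<psi> x"
  unfolding pdiff_def[of j \<phi>] pdiff_def[of j \<psi>]
  by (rule pdiff_eqI[OF has_derivative_add[OF smooth_has_derivative smooth_has_derivative]])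

lemma pdiff_scaleR: "smooth \<phi> \<Longrightarrow> pdiff j (\<lambda>x. c *\<^sub>R \<phi> x) x = c *\<^sub>R pdiff j \<phi> x"
  unfolding pdiff_def[of j \<phi>]
  by (rule pdiff_eqI[OF has_derivative_scaleR_right[OF smooth_has_derivative]])

lemma subspace_field_graph: "subspace (field_graph \<Omega>)"
proof (rule subspaceI)
  have zero: "(\<lambda>x. 0 :: real^2) \<in> test_functions \<Omega>"
    by (simp add: test_functions_def smooth_def Ck_const)
  have pdz: "pdiff j (\<lambda>x. 0 :: real^2) = (\<lambda>x. 0)" for j
    by (rule ext) (rule pdiff_eqI[where f' = "\<lambda>_. 0", simplified], simp)
  have "jac (\<lambda>x. 0) = (\<lambda>x. 0)" by (simp add: fun_eq_iff vec_eq_iff jac_nth pdz)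
  moreover have "(\<lambda>x. 0) \<in> fields \<Omega>" using zero by (simp add: fields_def divergence_eq pdz)
  ultimately show "0 \<in> field_graph \<Omega>"
    unfolding field_graph_def zero_prod_def L2_class_zero by (intro image_eqI[of _ _ "\<lambda>x. 0"]) simp_all
  fix p q :: "(real^2, real^2) L2 \<times> (real^2, real^2^2) L2" and c :: real
  assume "p \<in> field_graph \<Omega>"
  then obtain \<phi> where \<phi>: "\<phi> \<in> fields \<Omega>" "p = (L2_class \<phi>, L2_class (jac \<phi>))"
    by (auto simp: field_graph_def)
  note t\<phi> = fields_test[OF \<phi>(1)]
  note s\<phi> = test_smooth[OF t\<phi>]
  have "jac (\<lambda>x. c *\<^sub>R \<phi> x) = (\<lambda>x. c *\<^sub>R jac \<phi> x)"
    by (simp add: fun_eq_iff vec_eq_iff jac_nth pdiff_scaleR[OF s\<phi>])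
  moreover have "(\<lambda>x. c *\<^sub>R \<phi> x) \<in> fields \<Omega>"
    using \<phi>(1) test_scaleR[OF t\<phi>, of c]
    by (simp add: fields_def divergence_eq pdiff_scaleR[OF s\<phi>] distrib_left[symmetric])
  ultimately show "c *\<^sub>R p \<in> field_graph \<Omega>"
    unfolding field_graph_def \<phi>(2)
    by (intro image_eqI[of _ _ "\<lambda>x. c *\<^sub>R \<phi> x"])
       (simp_all add: L2_class_scaleR test_functions_square_int[OF t\<phi>] square_int_jac[OF t\<phi>])
  assume "q \<in> field_graph \<Omega>"
  then obtain \<psi> where \<psi>: "\<psi> \<in> fields \<Omega>" "q = (L2_class \<psi>, L2_class (jac \<psi>))"
    by (auto simp: field_graph_def)
  note t\<psi> = fields_test[OF \<psi>(1)]
  note s\<psi> = test_smooth[OF t\<psi>]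
  have "jac (\<lambda>x. \<phi> x + \<psi> x) = (\<lambda>x. jac \<phi> x + jac \<psi> x)"
    by (simp add: fun_eq_iff vec_eq_iff jac_nth pdiff_add[OF s\<phi> s\<psi>])
  moreover have "(\<lambda>x. \<phi> x + \<psi> x) \<in> fields \<Omega>"
    using \<phi>(1) \<psi>(1) test_add[OF t\<phi> t\<psi>]
    by (simp add: fields_def divergence_eq pdiff_add[OF s\<phi> s\<psi>] algebra_simps)
  ultimately show "p + q \<in> field_graph \<Omega>"
    unfolding field_graph_def \<phi>(2) \<psi>(2)
    by (intro image_eqI[of _ _ "\<lambda>x. \<phi> x + \<psi> x"])
       (simp_all add: L2_class_add test_functions_square_int[OF t\<phi>] square_int_jac[OF t\<phi>]
         test_functions_square_int[OF t\<psi>] square_int_jac[OF t\<psi>])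
qed

lemma subspace_closure:
  fixes S :: "'a::real_normed_vector set"
  assumes S: "subspace S"
  shows "subspace (closure S)"
proof (rule subspaceI)
  show "0 \<in> closure S" by (rule subsetD[OF closure_subset subspace_0[OF S]])
  fix x y :: 'a and c :: real
  assume "x \<in> closure S"
  then obtain X where X: "\<And>n. X n \<in> S" "X \<longlonglongrightarrow> x" unfolding closure_sequential by blast
  have "(\<lambda>n. c *\<^sub>R X n) \<longlonglongrightarrow> c *\<^sub>R x" by (intro tendsto_intros X)
  moreover have "c *\<^sub>R X n \<in> S" for n by (rule subspace_scale[OF S X(1)])
  ultimately show "c *\<^sub>R x \<in> closure S"
    unfolding closure_sequential by (intro exI[of _ "\<lambda>n. c *\<^sub>R X n"]) simp
  assume "y \<in> closure S"
  then obtain Y where Y: "\<And>n. Y n \<in> S" "Y \<longlonglongrightarrow> y" unfolding closure_sequential by blast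
  have "(\<lambda>n. X n + Y n) \<longlonglongrightarrow> x + y" by (intro tendsto_intros X Y)
  moreover have "X n + Y n \<in> S" for n by (rule subspace_add[OF S X(1) Y(1)])
  ultimately show "x + y \<in> closure S"
    unfolding closure_sequential by (intro exI[of _ "\<lambda>n. X n + Y n"]) simp
qed

definition energy_graph :: "(real^2) set \<Rightarrow> ((real^2, real^2) L2 \<times> (real^2, real^2^2) L2) set" where
  "energy_graph \<Omega> = closure (field_graph \<Omega>)"

lemma subspace_energy_graph: "subspace (energy_graph \<Omega>)"
  unfolding energy_graph_def by (rule subspace_closure[OF subspace_field_graph])

text \<open>Closed conditions on a field and its gradient need only be checked for smooth fields.\<close>

lemma energy_graph_induct:
  assumes "p \<in> energy_graph \<Omega>" "closed {p. P p}" "\<And>\<phi>. \<phi> \<in> fields \<Omega> \<Longrightarrow> P (L2_class \<phi>, L2_class (jac \<phi>))"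
  shows "P p"
proof -
  have "field_graph \<Omega> \<subseteq> {p. P p}" using assms(3) by (auto simp: field_graph_def)
  then have "energy_graph \<Omega> \<subseteq> {p. P p}" unfolding energy_graph_def by (rule closure_minimal[OF _ assms(2)])
  then show ?thesis using assms(1) by blast
qed

lemma energy_graph_weak_grad:
  assumes "(u, G) \<in> energy_graph \<Omega>"
  shows "u \<in> L2_on \<Omega>" "is_weak_grad \<Omega> u G"
proof -
  have on: "(u, G) \<in> L2_on \<Omega> \<times> L2_on \<Omega>"
  proof (rule energy_graph_induct[OF assms])
    show "closed {p. p \<in> L2_on \<Omega> \<times> L2_on \<Omega>}" by (simp add: closed_Times closed_L2_on)
    fix \<phi> assume "\<phi> \<in> fields \<Omega>"
    then have \<phi>: "\<phi> \<in> test_functions \<Omega>" by (rule fields_test)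
    show "(L2_class \<phi>, L2_class (jac \<phi>)) \<in> L2_on \<Omega> \<times> L2_on \<Omega>"
      by (intro SigmaI test_in_L2_on test_functions_square_int[OF \<phi>] test_zero[OF \<phi>]
          square_int_jac[OF \<phi>] jac_zero_outside[OF \<phi>])
  qed
  show "u \<in> L2_on \<Omega>" using on by simp
  have "u \<bullet> L2_class (\<lambda>x. pdiff j \<psi> x *\<^sub>R axis i 1) = - (G \<bullet> L2_class (\<lambda>x. \<psi> x *\<^sub>R axis i (axis j 1)))"
    if \<psi>: "\<psi> \<in> test_functions \<Omega>" for \<psi> i j
  proof -
    have "fst (u, G) \<bullet> L2_class (\<lambda>x. pdiff j \<psi> x *\<^sub>R axis i 1)
        = - (snd (u, G) \<bullet> L2_class (\<lambda>x. \<psi> x *\<^sub>R axis i (axis j 1)))"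
    proof (rule energy_graph_induct[OF assms])
      show "closed {p :: (real^2, real^2) L2 \<times> (real^2, real^2^2) L2.
          fst p \<bullet> L2_class (\<lambda>x. pdiff j \<psi> x *\<^sub>R axis i 1) = - (snd p \<bullet> L2_class (\<lambda>x. \<psi> x *\<^sub>R axis i (axis j 1)))}"
        by (intro closed_Collect_eq continuous_intros)
      fix \<phi> assume "\<phi> \<in> fields \<Omega>"
      from weak_grad_jac[OF fields_test[OF this]] \<psi>
      show "fst (L2_class \<phi>, L2_class (jac \<phi>)) \<bullet> L2_class (\<lambda>x. pdiff j \<psi> x *\<^sub>R axis i 1)
        = - (snd (L2_class \<phi>, L2_class (jac \<phi>)) \<bullet> L2_class (\<lambda>x. \<psi> x *\<^sub>R axis i (axis j 1)))"
        unfolding is_weak_grad_iff by simp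
    qed
    then show ?thesis by simp
  qed
  then show "is_weak_grad \<Omega> u G" using on unfolding is_weak_grad_iff by simp
qed

lemma energy_graph_grad: "open \<Omega> \<Longrightarrow> (u, G) \<in> energy_graph \<Omega> \<Longrightarrow> grad \<Omega> u = G"
  by (rule grad_eqI[OF _ energy_graph_weak_grad(2)])

text \<open>The \<open>H\<^sup>1\<close> norm of \<open>u - \<phi>\<close> is the distance in the product space, and uniqueness of weak gradients
  identifies the second component of a limit point.\<close>

lemma V_space_graph:
  assumes "open \<Omega>"
  shows "(\<lambda>u. (u, grad \<Omega> u)) ` V_space \<Omega> = energy_graph \<Omega>"
proof
  have norm: "H1_norm \<Omega> (u - L2_class \<phi>) = dist (L2_class \<phi>, L2_class (jac \<phi>)) (u, G)"
    if G: "is_weak_grad \<Omega> u G" and \<phi>: "\<phi> \<in> fields \<Omega>" for u G \<phi>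
  proof -
    have "is_weak_grad \<Omega> (u - L2_class \<phi>) (G - L2_class (jac \<phi>))"
      using G weak_grad_jac[OF fields_test[OF \<phi>]] unfolding is_weak_grad_iff
      by (auto simp: inner_diff_left intro: L2_on_diff)
    from grad_eqI[OF assms this] show ?thesis
      by (simp add: H1_norm_def dist_prod_def dist_norm norm_minus_commute)
  qed
  show "(\<lambda>u. (u, grad \<Omega> u)) ` V_space \<Omega> \<subseteq> energy_graph \<Omega>"
  proof
    fix p assume "p \<in> (\<lambda>u. (u, grad \<Omega> u)) ` V_space \<Omega>"
    then obtain u where u: "u \<in> V_space \<Omega>" "p = (u, grad \<Omega> u)" by blast
    then obtain G where G: "is_weak_grad \<Omega> u G" by (auto simp: V_space_def H1_def)
    have p: "p = (u, G)" using u(2) grad_eqI[OF assms G] by simp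
    show "p \<in> energy_graph \<Omega>"
      unfolding energy_graph_def closure_approachable
    proof (intro allI impI)
      fix e :: real assume "0 < e"
      then obtain \<phi> where \<phi>: "\<phi> \<in> fields \<Omega>" "H1_norm \<Omega> (u - L2_class \<phi>) < e"
        using u(1) by (auto simp: V_space_def Dsol_eq)
      then show "\<exists>y\<in>field_graph \<Omega>. dist y p < e"
        unfolding p using norm[OF G \<phi>(1)] by (auto simp: field_graph_def)
    qed
  qed
  show "energy_graph \<Omega> \<subseteq> (\<lambda>u. (u, grad \<Omega> u)) ` V_space \<Omega>"
  proof
    fix p assume p: "p \<in> energy_graph \<Omega>"
    obtain u G where uG: "p = (u, G)" by (cases p)
    note G = energy_graph_weak_grad[OF p[unfolded uG]]
    have "\<exists>\<phi>\<in>Dsol \<Omega>. H1_norm \<Omega> (u - \<phi>) < \<epsilon>" if pos: "\<epsilon> > 0" for \<epsilon>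
    proof -
      obtain \<phi> where \<phi>: "\<phi> \<in> fields \<Omega>" "dist (L2_class \<phi>, L2_class (jac \<phi>)) (u, G) < \<epsilon>"
        using p pos unfolding energy_graph_def closure_approachable uG by (auto simp: field_graph_def)
      then have "H1_norm \<Omega> (u - L2_class \<phi>) < \<epsilon>" using norm[OF G(2) \<phi>(1)] by simp
      then show ?thesis using \<phi>(1) by (auto simp: Dsol_eq)
    qed
    then have "u \<in> V_space \<Omega>" using G by (auto simp: V_space_def H1_def)
    then show "p \<in> (\<lambda>u. (u, grad \<Omega> u)) ` V_space \<Omega>" using grad_eqI[OF assms G(2)] uG by auto
  qed
qed

section \<open>Estimates on the energy space\<close>

lemma ennreal_square_leD:
  assumes "ennreal (a\<^sup>2) \<le> ennreal (b\<^sup>2)" "0 \<le> b" shows "a \<le> b"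
proof -
  have "a\<^sup>2 \<le> b\<^sup>2" using assms(1) by (subst (asm) ennreal_le_iff) auto
  then show ?thesis by (rule power2_le_imp_le[OF _ assms(2)])
qed

lemma norm_class_norm: "norm (L2_class (\<lambda>x. norm (L2_fun u x))) = norm u"
  and square_int_norm: "square_int (\<lambda>x. norm (L2_fun u x))"
proof -
  show sq: "square_int (\<lambda>x. norm (L2_fun u x))"
    using square_int_L2_fun[of u] by (simp add: square_int_def)
  have "ennreal ((norm (L2_class (\<lambda>x. norm (L2_fun u x))))\<^sup>2) = ennreal ((norm u)\<^sup>2)"
    using nn_norm_L2_class[OF sq] nn_norm_L2[of u] by simp
  then have "(norm (L2_class (\<lambda>x. norm (L2_fun u x))))\<^sup>2 = (norm u)\<^sup>2" by (simp add: ennreal_inj)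
  then show "norm (L2_class (\<lambda>x. norm (L2_fun u x))) = norm u" by simp
qed

lemma integral_le_product:
  fixes k f g :: "'a::euclidean_space \<Rightarrow> real"
  assumes f: "square_int f" and g: "square_int g" and k: "k \<in> borel_measurable borel"
    and le: "AE x in lborel. \<bar>k x\<bar> \<le> f x * g x"
  shows "integrable lborel k" "\<bar>LINT x|lborel. k x\<bar> \<le> norm (L2_class f) * norm (L2_class g)"
proof -
  have fg: "integrable lborel (\<lambda>x. f x * g x)" using square_int_inner[OF f g] by simp
  show int: "integrable lborel k"
  proof (rule Bochner_Integration.integrable_bound[OF fg])
    show "AE x in lborel. norm (k x) \<le> norm (f x * g x)"
      using le by eventually_elim (auto intro: order_trans[OF _ abs_ge_self])
  qed (use k in simp)
  have "\<bar>LINT x|lborel. k x\<bar> \<le> (LINT x|lborel. \<bar>k x\<bar>)" by (rule integral_abs_bound)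
  also have "\<dots> \<le> (LINT x|lborel. f x * g x)"
    by (rule integral_mono_AE) (use int fg le in auto)
  also have "\<dots> = L2_class f \<bullet> L2_class g" by (simp add: inner_L2_class[OF f g])
  also have "\<dots> \<le> norm (L2_class f) * norm (L2_class g)" by (rule norm_cauchy_schwarz)
  finally show "\<bar>LINT x|lborel. k x\<bar> \<le> norm (L2_class f) * norm (L2_class g)" .
qed

lemma square_int_sum:
  "(\<And>i. i \<in> I \<Longrightarrow> square_int (f i)) \<Longrightarrow> square_int (\<lambda>x. \<Sum>i\<in>I. f i x)"
  by (induction I rule: infinite_finite_induct) (simp_all add: square_int_zero square_int_add)

lemma L2_class_sum:
  "(\<And>i. i \<in> I \<Longrightarrow> square_int (f i)) \<Longrightarrow> L2_class (\<lambda>x. \<Sum>i\<in>I. f i x) = (\<Sum>i\<in>I. L2_class (f i))"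
  by (induction I rule: infinite_finite_induct)
     (simp_all add: L2_class_zero[symmetric] L2_class_add[symmetric] square_int_sum)

text \<open>Allows for collisions when an indexed family is turned into a set.\<close>

lemma sum_le_card_image:
  fixes f :: "'b \<Rightarrow> real"
  assumes "finite I" "\<And>y. 0 \<le> f y"
  shows "(\<Sum>i\<in>I. f (g i)) \<le> real (card I) * (\<Sum>y\<in>g ` I. f y)"
proof -
  have "f (g i) \<le> (\<Sum>y\<in>g ` I. f y)" if "i \<in> I" for i
    by (rule member_le_sum) (use that assms in auto)
  then show ?thesis by (rule sum_bounded_above)
qed

lemma power2_norm_vec: "(norm (v :: 'a::real_normed_vector ^ 'n))\<^sup>2 = (\<Sum>i\<in>UNIV. (norm (v $ i))\<^sup>2)"
  by (simp add: norm_vec_def L2_set_def sum_nonneg)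

lemma norm_matrix_vector_le: "norm ((A :: real^2^2) *v x) \<le> norm A * norm x"
proof (rule power2_le_imp_le)
  have "(norm (A *v x))\<^sup>2 = (\<Sum>i\<in>UNIV. (A $ i \<bullet> x)\<^sup>2)"
    unfolding power2_norm_vec by (simp add: matrix_vector_mul_component)
  also have "\<dots> \<le> (\<Sum>i\<in>UNIV. (norm (A $ i))\<^sup>2 * (norm x)\<^sup>2)"
    by (rule sum_mono) (simp only: power2_norm_eq_inner Cauchy_Schwarz_ineq)
  also have "\<dots> = (norm A * norm x)\<^sup>2"
    unfolding power_mult_distrib sum_distrib_right[symmetric] power2_norm_vec[of A] ..
  finally show "(norm (A *v x))\<^sup>2 \<le> (norm A * norm x)\<^sup>2" .
qed simp

lemma abs_form_le: "\<bar>(A *v u) \<bullet> w\<bar> \<le> norm (A :: real^2^2) * (norm u * norm w)"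
proof -
  have "\<bar>(A *v u) \<bullet> w\<bar> \<le> norm (A *v u) * norm w" by (rule Cauchy_Schwarz_ineq2)
  also have "\<dots> \<le> norm A * norm u * norm w"
    by (rule mult_right_mono[OF norm_matrix_vector_le]) simp
  finally show ?thesis by (simp add: mult.assoc)
qed

lemma form_expand: "((A :: real^2^2) *v u) \<bullet> w = (\<Sum>i\<in>UNIV. \<Sum>j\<in>UNIV. A $ i $ j * u $ j * w $ i)"
  by (simp add: inner_vec_def matrix_vector_mult_def sum_distrib_right)

lemma measurable_form [measurable (raw)]:
  assumes [measurable]: "A \<in> borel_measurable M" "u \<in> borel_measurable M" "w \<in> borel_measurable M"
  shows "(\<lambda>x. ((A x :: real^2^2) *v u x) \<bullet> w x) \<in> borel_measurable M"
proof -
  have nth2: "(\<lambda>x. f x $ i) \<in> borel_measurable M" if "f \<in> borel_measurable M" for f :: "_ \<Rightarrow> real^2" and i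
    by (rule measurable_compose[OF that]) (intro borel_measurable_continuous_onI continuous_intros)
  have ent: "(\<lambda>x. A x $ i $ j) \<in> borel_measurable M" for i j
    by (rule measurable_compose[OF assms(1)]) (intro borel_measurable_continuous_onI continuous_intros)
  show ?thesis
    unfolding form_expand
    by (intro borel_measurable_sum borel_measurable_times ent nth2 assms)
qed

lemma test_bounded:
  fixes \<phi> :: "'a::euclidean_space \<Rightarrow> 'b::euclidean_space"
  assumes "\<phi> \<in> test_functions \<Omega>"
  obtains C where "\<And>x. norm (\<phi> x) \<le> C"
proof -
  let ?K = "closure {x. \<phi> x \<noteq> 0}"
  have "compact (\<phi> ` ?K)"
    using assms by (intro compact_continuous_image smooth_continuous) (auto simp: test_functions_def)
  from compact_imp_bounded[OF this] obtain C where C: "\<forall>y\<in>\<phi> ` ?K. norm y \<le> C"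
    unfolding bounded_iff by blast
  have "norm (\<phi> x) \<le> max C 0" for x
  proof (cases "\<phi> x = 0")
    case False
    then have "x \<in> ?K" using subsetD[OF closure_subset[of "{x. \<phi> x \<noteq> 0}"], of x] by simp
    then show ?thesis using C by (auto simp: le_max_iff_disj)
  qed simp
  then show ?thesis using that by blast
qed

text \<open>Every field considered vanishes outside the square \<open>\<bar>x\<^sub>i\<bar> < M\<close>.\<close>

locale plane_domain =
  fixes \<Omega> :: "(real^2) set" and M :: real
  assumes open_domain: "open \<Omega>" and M: "M > 0" and in_square: "x \<in> \<Omega> \<Longrightarrow> \<bar>x $ i\<bar> < M"
begin

lemma test_in_square: "\<phi> \<in> test_functions \<Omega> \<Longrightarrow> \<phi> x \<noteq> 0 \<Longrightarrow> \<bar>x $ i\<bar> < M"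
  using test_zero[of \<phi> \<Omega> x] in_square[of x i] by blast

lemma V_graph: "u \<in> V_space \<Omega> \<Longrightarrow> (u, grad \<Omega> u) \<in> energy_graph \<Omega>"
  using V_space_graph[OF open_domain] by blast

lemma graph_V: "(u, G) \<in> energy_graph \<Omega> \<Longrightarrow> u \<in> V_space \<Omega> \<and> grad \<Omega> u = G"
  using V_space_graph[OF open_domain] energy_graph_grad[OF open_domain] by blast

lemma V_L2_on: "u \<in> V_space \<Omega> \<Longrightarrow> u \<in> L2_on \<Omega>"
  by (rule energy_graph_weak_grad(1)[OF V_graph])

lemma V_space_induct:
  assumes "u \<in> V_space \<Omega>" "closed {p. P (fst p) (snd p)}"
    "\<And>\<phi>. \<phi> \<in> fields \<Omega> \<Longrightarrow> P (L2_class \<phi>) (L2_class (jac \<phi>))"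
  shows "P u (grad \<Omega> u)"
  using energy_graph_induct[OF V_graph[OF assms(1)], of "\<lambda>p. P (fst p) (snd p)"] assms(2,3) by simp

lemma poincare:
  assumes "u \<in> V_space \<Omega>" shows "norm u \<le> 2 * M * norm (grad \<Omega> u)"
proof (rule V_space_induct[OF assms, where P = "\<lambda>u G. norm u \<le> 2 * M * norm G"])
  show "closed {p :: (real^2, real^2) L2 \<times> (real^2, real^2^2) L2. norm (fst p) \<le> 2 * M * norm (snd p)}"
    by (intro closed_Collect_le continuous_intros)
  fix \<phi> assume "\<phi> \<in> fields \<Omega>"
  then have \<phi>: "\<phi> \<in> test_functions \<Omega>" by (rule fields_test)
  have "ennreal ((norm (L2_class \<phi>))\<^sup>2) \<le> ennreal (4 * M\<^sup>2) * energy 1 \<phi>"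
    unfolding nn_norm_L2_class[OF test_functions_square_int[OF \<phi>], symmetric]
    by (rule smooth_poincare[OF test_smooth[OF \<phi>]]) (use M test_in_square[OF \<phi>] in auto)
  also have "\<dots> \<le> ennreal (4 * M\<^sup>2) * ennreal ((norm (L2_class (jac \<phi>)))\<^sup>2)"
    unfolding norm_jac_class[OF \<phi>] by (intro mult_left_mono) auto
  also have "\<dots> = ennreal ((2 * M * norm (L2_class (jac \<phi>)))\<^sup>2)"
    by (simp add: ennreal_mult[symmetric] power_mult_distrib)
  finally show "norm (L2_class \<phi>) \<le> 2 * M * norm (L2_class (jac \<phi>))"
    by (rule ennreal_square_leD) (use M in simp)
qed

lemma friedrichs:
  assumes "\<epsilon> > 0"
  shows "\<exists>G. finite G \<and> (\<forall>u\<in>V_space \<Omega>. (norm u)\<^sup>2 \<le> \<epsilon> * (norm (grad \<Omega> u))\<^sup>2 + (\<Sum>g\<in>G. (u \<bullet> g)\<^sup>2))"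
proof -
  define h where "h = sqrt \<epsilon> / 2"
  have h: "h > 0" "4 * h\<^sup>2 = \<epsilon>" using assms by (simp_all add: h_def power_divide)
  define I where "I = cells h M \<times> (UNIV :: 2 set)"
  have finI: "finite I" by (simp add: I_def cells_def)
  define e :: "(int \<times> int) \<times> 2 \<Rightarrow> (real^2, real^2) L2"
    where "e i = L2_class (\<lambda>x. indicator (cell h (fst i)) x *\<^sub>R axis (snd i) 1)" for i
  \<comment> \<open>The factor \<open>card I\<close> pays for passing from the index set to the set of vectors.\<close>
  define c where "c = sqrt (real (card I) * (2 / h\<^sup>2))"
  have c: "c\<^sup>2 = real (card I) * (2 / h\<^sup>2)" by (simp add: c_def)
  let ?G = "(\<lambda>i. c *\<^sub>R e i) ` I"
  have "(norm u)\<^sup>2 \<le> \<epsilon> * (norm (grad \<Omega> u))\<^sup>2 + (\<Sum>g\<in>?G. (u \<bullet> g)\<^sup>2)" if "u \<in> V_space \<Omega>" for u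
  proof (rule V_space_induct[OF that, where P = "\<lambda>u G. (norm u)\<^sup>2 \<le> \<epsilon> * (norm G)\<^sup>2 + (\<Sum>g\<in>?G. (u \<bullet> g)\<^sup>2)"])
    show "closed {p :: (real^2, real^2) L2 \<times> (real^2, real^2^2) L2.
        (norm (fst p))\<^sup>2 \<le> \<epsilon> * (norm (snd p))\<^sup>2 + (\<Sum>g\<in>?G. (fst p \<bullet> g)\<^sup>2)}"
      by (intro closed_Collect_le continuous_intros)
    fix \<phi> assume "\<phi> \<in> fields \<Omega>"
    then have \<phi>: "\<phi> \<in> test_functions \<Omega>" by (rule fields_test)
    let ?u = "L2_class \<phi>"
    define J where "J z = (LINT x|lborel. indicator (cell h z) x *\<^sub>R \<phi> x)" for z
    have sq: "square_int (\<lambda>x. indicator (cell h z) x *\<^sub>R f x)" if "continuous_on UNIV f" for z and f :: "real^2 \<Rightarrow> real^2"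
      by (rule square_int_indicator_continuous[OF that bounded_cell[OF h(1)] measurable_cell])
    have J: "J z $ k = ?u \<bullet> e (z, k)" for z k
    proof -
      have int: "integrable lborel (\<lambda>x. indicator (cell h z) x *\<^sub>R \<phi> x)"
        by (rule norm_integral_power2_le(1)[OF measurable_cell emeasure_cell[OF h(1)] _ sq[OF smooth_continuous[OF test_smooth[OF \<phi>]]]]) simp
      have "J z $ k = J z \<bullet> axis k 1" by (simp add: inner_axis)
      also have "\<dots> = (LINT x|lborel. (indicator (cell h z) x *\<^sub>R \<phi> x) \<bullet> axis k 1)"
        unfolding J_def by (rule integral_inner_left[symmetric]) (rule int)
      also have "\<dots> = (LINT x|lborel. \<phi> x \<bullet> (indicator (cell h z) x *\<^sub>R axis k 1))" by simp
      also have "\<dots> = ?u \<bullet> e (z, k)"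
        unfolding e_def fst_conv snd_conv
        by (rule inner_L2_class[OF test_functions_square_int[OF \<phi>] sq, symmetric]) (intro continuous_intros)
      finally show ?thesis .
    qed
    have "ennreal ((norm ?u)\<^sup>2) \<le> ennreal (4 * h\<^sup>2) * (energy 1 \<phi> + energy 2 \<phi>)
       + (\<Sum>z\<in>cells h M. ennreal (2 / h\<^sup>2) * ennreal ((norm (J z))\<^sup>2))"
      unfolding nn_norm_L2_class[OF test_functions_square_int[OF \<phi>], symmetric] J_def
      by (rule smooth_friedrichs[OF test_smooth[OF \<phi>] test_in_square[OF \<phi>] h(1)])
    also have "\<dots> = ennreal (\<epsilon> * (norm (L2_class (jac \<phi>)))\<^sup>2 + (\<Sum>z\<in>cells h M. 2 / h\<^sup>2 * (norm (J z))\<^sup>2))"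
    proof -
      have "(\<Sum>z\<in>cells h M. ennreal (2 / h\<^sup>2) * ennreal ((norm (J z))\<^sup>2)) = (\<Sum>z\<in>cells h M. ennreal (2 / h\<^sup>2 * (norm (J z))\<^sup>2))"
        by (intro sum.cong refl ennreal_mult[symmetric]) auto
      also have "\<dots> = ennreal (\<Sum>z\<in>cells h M. 2 / h\<^sup>2 * (norm (J z))\<^sup>2)" by (rule sum_ennreal) auto
      finally have s: "(\<Sum>z\<in>cells h M. ennreal (2 / h\<^sup>2) * ennreal ((norm (J z))\<^sup>2))
          = ennreal (\<Sum>z\<in>cells h M. 2 / h\<^sup>2 * (norm (J z))\<^sup>2)" .
      have "ennreal (\<epsilon> * (norm (L2_class (jac \<phi>)))\<^sup>2) = ennreal \<epsilon> * (energy 1 \<phi> + energy 2 \<phi>)"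
        unfolding norm_jac_class[OF \<phi>, symmetric] using assms by (simp add: ennreal_mult)
      then show ?thesis
        unfolding s h(2) using assms by (subst ennreal_plus) (auto intro!: sum_nonneg)
    qed
    finally have main: "(norm ?u)\<^sup>2 \<le> \<epsilon> * (norm (L2_class (jac \<phi>)))\<^sup>2 + (\<Sum>z\<in>cells h M. 2 / h\<^sup>2 * (norm (J z))\<^sup>2)"
      using assms by (subst (asm) ennreal_le_iff) (auto intro!: add_nonneg_nonneg sum_nonneg)
    have "(\<Sum>z\<in>cells h M. 2 / h\<^sup>2 * (norm (J z))\<^sup>2) = (\<Sum>z\<in>cells h M. \<Sum>k\<in>UNIV. 2 / h\<^sup>2 * (?u \<bullet> e (z, k))\<^sup>2)"
      unfolding power2_norm_vec J by (simp add: sum_distrib_left)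
    also have "\<dots> = (\<Sum>i\<in>I. 2 / h\<^sup>2 * (?u \<bullet> e i)\<^sup>2)"
      unfolding I_def by (simp add: sum.cartesian_product)
    also have "\<dots> \<le> (\<Sum>g\<in>?G. (?u \<bullet> g)\<^sup>2)"
    proof (cases "I = {}")
      case False
      then have card: "real (card I) > 0" using finI by (simp add: card_gt_0_iff)
      have "real (card I) * (\<Sum>i\<in>I. 2 / h\<^sup>2 * (?u \<bullet> e i)\<^sup>2) = (\<Sum>i\<in>I. (?u \<bullet> (c *\<^sub>R e i))\<^sup>2)"
        by (simp add: power_mult_distrib c sum_distrib_left mult.assoc)
      also have "\<dots> \<le> real (card I) * (\<Sum>g\<in>?G. (?u \<bullet> g)\<^sup>2)"
        by (rule sum_le_card_image[OF finI]) simp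
      finally show ?thesis using mult_le_cancel_left_pos[OF card] by blast
    qed simp
    finally show "(norm ?u)\<^sup>2 \<le> \<epsilon> * (norm (L2_class (jac \<phi>)))\<^sup>2 + (\<Sum>g\<in>?G. (?u \<bullet> g)\<^sup>2)"
      using main by linarith
  qed
  then show ?thesis using finI by blast
qed

lemma V_sequence:
  assumes "u \<in> V_space \<Omega>"
  obtains \<phi> where "\<And>n. \<phi> n \<in> fields \<Omega>" "(\<lambda>n. L2_class (\<phi> n)) \<longlonglongrightarrow> u" "(\<lambda>n. L2_class (jac (\<phi> n))) \<longlonglongrightarrow> grad \<Omega> u"
proof -
  have "(u, grad \<Omega> u) \<in> closure (field_graph \<Omega>)" using V_graph[OF assms] by (simp add: energy_graph_def)
  then obtain p where p: "\<And>n. p n \<in> field_graph \<Omega>" "p \<longlonglongrightarrow> (u, grad \<Omega> u)" unfolding closure_sequential by blast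
  have "\<forall>n. \<exists>\<phi>. \<phi> \<in> fields \<Omega> \<and> p n = (L2_class \<phi>, L2_class (jac \<phi>))" using p(1) unfolding field_graph_def by blast
  then obtain \<phi> where \<phi>: "\<And>n. \<phi> n \<in> fields \<Omega>" "\<And>n. p n = (L2_class (\<phi> n), L2_class (jac (\<phi> n)))" by metis
  have "(\<lambda>n. L2_class (\<phi> n)) \<longlonglongrightarrow> u" "(\<lambda>n. L2_class (jac (\<phi> n))) \<longlonglongrightarrow> grad \<Omega> u"
    using tendsto_fst[OF p(2)] tendsto_snd[OF p(2)] by (simp_all add: \<phi>(2))
  then show ?thesis using that \<phi>(1) by blast
qed

text \<open>Fatou's lemma along a subsequence that converges almost everywhere for both factors.\<close>

lemma product_bound:
  assumes u: "u \<in> V_space \<Omega>" and w: "w \<in> V_space \<Omega>"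
  shows "(\<integral>\<^sup>+x. ennreal ((norm (L2_fun u x) * norm (L2_fun w x))\<^sup>2) \<partial>lborel)
      \<le> ennreal ((2 * M * norm (grad \<Omega> u) * norm (grad \<Omega> w))\<^sup>2)"
proof -
  obtain \<phi> where \<phi>: "\<And>n. \<phi> n \<in> fields \<Omega>" "(\<lambda>n. L2_class (\<phi> n)) \<longlonglongrightarrow> u" "(\<lambda>n. L2_class (jac (\<phi> n))) \<longlonglongrightarrow> grad \<Omega> u"
    using V_sequence[OF u] by blast
  obtain \<psi> where \<psi>: "\<And>n. \<psi> n \<in> fields \<Omega>" "(\<lambda>n. L2_class (\<psi> n)) \<longlonglongrightarrow> w" "(\<lambda>n. L2_class (jac (\<psi> n))) \<longlonglongrightarrow> grad \<Omega> w"
    using V_sequence[OF w] by blast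
  obtain r where r: "strict_mono r" "AE x in lborel. (\<lambda>n. L2_fun (L2_class (\<phi> (r n))) x) \<longlonglongrightarrow> L2_fun u x"
    using L2_subseq_AE[OF \<phi>(2)] by blast
  have "(\<lambda>n. L2_class (\<psi> (r n))) \<longlonglongrightarrow> w" using LIMSEQ_subseq_LIMSEQ[OF \<psi>(2) r(1)] by (simp add: o_def)
  then obtain s where s: "strict_mono s" "AE x in lborel. (\<lambda>n. L2_fun (L2_class (\<psi> (r (s n)))) x) \<longlonglongrightarrow> L2_fun w x"
    using L2_subseq_AE by blast
  define q where "q n = r (s n)" for n
  have q: "strict_mono q" using strict_mono_compose[OF r(1) s(1)] by (simp add: q_def[abs_def] o_def)
  let ?f = "\<lambda>n x. ennreal ((norm (L2_fun (L2_class (\<phi> (q n))) x) * norm (L2_fun (L2_class (\<psi> (q n))) x))\<^sup>2)"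
  let ?B = "\<lambda>n. ennreal ((2 * M * norm (L2_class (jac (\<phi> (q n)))) * norm (L2_class (jac (\<psi> (q n)))))\<^sup>2)"
  have bound: "(\<integral>\<^sup>+x. ?f n x \<partial>lborel) \<le> ?B n" for n
  proof -
    have t: "\<phi> (q n) \<in> test_functions \<Omega>" "\<psi> (q n) \<in> test_functions \<Omega>" using fields_test \<phi>(1) \<psi>(1) by auto
    have "(\<integral>\<^sup>+x. ?f n x \<partial>lborel) = (\<integral>\<^sup>+x. ennreal ((norm (\<phi> (q n) x))\<^sup>2) * ennreal ((norm (\<psi> (q n) x))\<^sup>2) \<partial>lborel)"
    proof (rule nn_integral_cong_AE)
      show "AE x in lborel. ?f n x = ennreal ((norm (\<phi> (q n) x))\<^sup>2) * ennreal ((norm (\<psi> (q n) x))\<^sup>2)"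
        using L2_fun_L2_class[OF test_functions_square_int[OF t(1)]] L2_fun_L2_class[OF test_functions_square_int[OF t(2)]]
        by eventually_elim (simp add: power_mult_distrib ennreal_mult)
    qed
    also have "\<dots> \<le> ennreal (4 * M\<^sup>2) * (energy 1 (\<phi> (q n)) * energy 2 (\<psi> (q n)))"
      using M by (intro smooth_product_bound test_smooth t test_in_square) (auto intro: t)
    also have "\<dots> \<le> ennreal (4 * M\<^sup>2) * (ennreal ((norm (L2_class (jac (\<phi> (q n)))))\<^sup>2) * ennreal ((norm (L2_class (jac (\<psi> (q n)))))\<^sup>2))"
      unfolding norm_jac_class[OF t(1)] norm_jac_class[OF t(2)] by (intro mult_left_mono mult_mono) auto
    also have "\<dots> = ?B n"
      by (simp add: ennreal_mult[symmetric] power_mult_distrib mult.assoc)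
    finally show ?thesis .
  qed
  have "(\<integral>\<^sup>+x. ennreal ((norm (L2_fun u x) * norm (L2_fun w x))\<^sup>2) \<partial>lborel) = (\<integral>\<^sup>+x. liminf (\<lambda>n. ?f n x) \<partial>lborel)"
  proof (rule nn_integral_cong_AE)
    show "AE x in lborel. ennreal ((norm (L2_fun u x) * norm (L2_fun w x))\<^sup>2) = liminf (\<lambda>n. ?f n x)"
      using r(2) s(2)
    proof eventually_elim
      case (elim x)
      have "(\<lambda>n. L2_fun (L2_class (\<phi> (q n))) x) \<longlonglongrightarrow> L2_fun u x"
        using LIMSEQ_subseq_LIMSEQ[OF elim(1) s(1)] by (simp add: o_def q_def)
      then have "(\<lambda>n. ?f n x) \<longlonglongrightarrow> ennreal ((norm (L2_fun u x) * norm (L2_fun w x))\<^sup>2)"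
        using elim(2) unfolding q_def by (intro tendsto_ennrealI tendsto_intros)
      from lim_imp_Liminf[OF sequentially_bot this] show ?case by simp
    qed
  qed
  also have "\<dots> \<le> liminf (\<lambda>n. \<integral>\<^sup>+x. ?f n x \<partial>lborel)" by (rule nn_integral_liminf) measurable
  also have "\<dots> \<le> liminf ?B" by (intro Liminf_mono always_eventually allI bound)
  also have "liminf ?B = ennreal ((2 * M * norm (grad \<Omega> u) * norm (grad \<Omega> w))\<^sup>2)"
  proof (rule lim_imp_Liminf[OF sequentially_bot])
    show "?B \<longlonglongrightarrow> ennreal ((2 * M * norm (grad \<Omega> u) * norm (grad \<Omega> w))\<^sup>2)"
      using LIMSEQ_subseq_LIMSEQ[OF \<phi>(3) q] LIMSEQ_subseq_LIMSEQ[OF \<psi>(3) q]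
      unfolding o_def by (intro tendsto_ennrealI tendsto_intros)
  qed
  finally show ?thesis .
qed

section \<open>The inertial form\<close>

definition form :: "(real^2, real^2^2) L2 \<Rightarrow> (real^2, real^2) L2 \<Rightarrow> (real^2, real^2) L2 \<Rightarrow> real^2 \<Rightarrow> real" where
  "form G u w x = (L2_fun G x *v L2_fun u x) \<bullet> L2_fun w x"

lemma measurable_form_L2 [measurable]: "form G u w \<in> borel_measurable borel"
  unfolding form_def[abs_def] by measurable

text \<open>By \<open>product_bound\<close> the product of the two outer factors is itself square integrable, and the
  Cauchy-Schwarz inequality pairs it with \<open>G\<close>.\<close>

lemma form_integrable:
  assumes "u \<in> V_space \<Omega>" "w \<in> V_space \<Omega>"
  shows "integrable lborel (form G u w)"
    "\<bar>LINT x|lborel. form G u w x\<bar> \<le> 2 * M * norm (grad \<Omega> u) * norm G * norm (grad \<Omega> w)"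
proof -
  let ?p = "\<lambda>x. norm (L2_fun u x) * norm (L2_fun w x)"
  have p: "square_int ?p"
  proof (rule square_intI)
    show "?p \<in> borel_measurable borel" by measurable
    show "(\<integral>\<^sup>+x. ennreal ((norm (?p x))\<^sup>2) \<partial>lborel) < \<infinity>"
      using le_less_trans[OF product_bound[OF assms] ennreal_less_top] by simp
  qed
  have "ennreal ((norm (L2_class ?p))\<^sup>2) \<le> ennreal ((2 * M * norm (grad \<Omega> u) * norm (grad \<Omega> w))\<^sup>2)"
    using product_bound[OF assms] by (simp add: nn_norm_L2_class[OF p, symmetric])
  then have np: "norm (L2_class ?p) \<le> 2 * M * norm (grad \<Omega> u) * norm (grad \<Omega> w)"
    by (rule ennreal_square_leD) (use M in simp)
  have le: "AE x in lborel. \<bar>form G u w x\<bar> \<le> norm (L2_fun G x) * ?p x"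
    by (simp add: form_def abs_form_le)
  note * = integral_le_product[OF square_int_norm p measurable_form_L2 le]
  show "integrable lborel (form G u w)" by (rule *(1))
  have "\<bar>LINT x|lborel. form G u w x\<bar> \<le> norm G * norm (L2_class ?p)"
    using *(2) by (simp add: norm_class_norm)
  also have "\<dots> \<le> norm G * (2 * M * norm (grad \<Omega> u) * norm (grad \<Omega> w))"
    by (rule mult_left_mono[OF np norm_ge_zero])
  finally show "\<bar>LINT x|lborel. form G u w x\<bar> \<le> 2 * M * norm (grad \<Omega> u) * norm G * norm (grad \<Omega> w)"
    by (simp add: mult_ac)
qed

lemma trilinear_form:
  assumes "w \<in> V_space \<Omega>"
  shows "trilinear \<Omega> u v w = (LINT x|lborel. form (grad \<Omega> v) u w x)"
proof -
  have [measurable]: "\<Omega> \<in> sets borel" using open_domain by simp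
  have "AE x in lborel. indicator \<Omega> x *\<^sub>R form (grad \<Omega> v) u w x = form (grad \<Omega> v) u w x"
    using V_L2_on[OF assms] unfolding L2_on_def mem_Collect_eq
    by eventually_elim (auto simp: form_def split: split_indicator)
  then show ?thesis
    unfolding trilinear_def set_lebesgue_integral_def form_def[symmetric]
    by (intro integral_cong_AE) measurable
qed

lemma subspace_V: "subspace (V_space \<Omega>)"
  and grad_add: "u \<in> V_space \<Omega> \<Longrightarrow> v \<in> V_space \<Omega> \<Longrightarrow> grad \<Omega> (u + v) = grad \<Omega> u + grad \<Omega> v"
  and grad_scaleR: "u \<in> V_space \<Omega> \<Longrightarrow> grad \<Omega> (c *\<^sub>R u) = c *\<^sub>R grad \<Omega> u"
proof -
  have add: "u + v \<in> V_space \<Omega> \<and> grad \<Omega> (u + v) = grad \<Omega> u + grad \<Omega> v"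
    if "u \<in> V_space \<Omega>" "v \<in> V_space \<Omega>" for u v
    using subspace_add[OF subspace_energy_graph V_graph[OF that(1)] V_graph[OF that(2)]]
    by (intro graph_V) simp
  have scale: "c *\<^sub>R u \<in> V_space \<Omega> \<and> grad \<Omega> (c *\<^sub>R u) = c *\<^sub>R grad \<Omega> u" if "u \<in> V_space \<Omega>" for c u
    using subspace_scale[OF subspace_energy_graph V_graph[OF that], of c]
    by (intro graph_V) simp
  have "0 \<in> V_space \<Omega>"
    using graph_V[of 0 0] subspace_0[OF subspace_energy_graph[of \<Omega>]] by (simp add: zero_prod_def)
  then show "subspace (V_space \<Omega>)" using add scale by (intro subspaceI) auto
  show "u \<in> V_space \<Omega> \<Longrightarrow> v \<in> V_space \<Omega> \<Longrightarrow> grad \<Omega> (u + v) = grad \<Omega> u + grad \<Omega> v" using add by blast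
  show "u \<in> V_space \<Omega> \<Longrightarrow> grad \<Omega> (c *\<^sub>R u) = c *\<^sub>R grad \<Omega> u" using scale by blast
qed

lemma integral_form_add:
  assumes "integrable lborel (form G1 u1 w1)" "integrable lborel (form G2 u2 w2)"
    and "AE x in lborel. form G u w x = form G1 u1 w1 x + form G2 u2 w2 x"
  shows "(LINT x|lborel. form G u w x) = (LINT x|lborel. form G1 u1 w1 x) + (LINT x|lborel. form G2 u2 w2 x)"
proof -
  have "(LINT x|lborel. form G u w x) = (LINT x|lborel. form G1 u1 w1 x + form G2 u2 w2 x)"
    by (rule integral_cong_AE) (use assms(3) in simp_all)
  then show ?thesis using assms(1,2) by simp
qed

lemma integral_form_scale:
  assumes "AE x in lborel. form G u w x = c * form G1 u1 w1 x"
  shows "(LINT x|lborel. form G u w x) = c * (LINT x|lborel. form G1 u1 w1 x)"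
proof -
  have "(LINT x|lborel. form G u w x) = (LINT x|lborel. c * form G1 u1 w1 x)"
    by (rule integral_cong_AE) (use assms in simp_all)
  then show ?thesis by simp
qed

lemma grad_field:
  assumes "\<phi> \<in> fields \<Omega>"
  shows "L2_class \<phi> \<in> V_space \<Omega>" "grad \<Omega> (L2_class \<phi>) = L2_class (jac \<phi>)"
proof -
  have "(L2_class \<phi>, L2_class (jac \<phi>)) \<in> energy_graph \<Omega>"
    unfolding energy_graph_def field_graph_def using assms by (intro subsetD[OF closure_subset]) blast
  then show "L2_class \<phi> \<in> V_space \<Omega>" "grad \<Omega> (L2_class \<phi>) = L2_class (jac \<phi>)" using graph_V by blast+
qed

lemma measurable_jac: "smooth \<phi> \<Longrightarrow> jac \<phi> \<in> borel_measurable borel"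
  by (intro borel_measurable_continuous_onI continuous_jac)

lemma trilinear_field:
  assumes "\<phi> \<in> fields \<Omega>" "\<psi> \<in> fields \<Omega>" "\<eta> \<in> fields \<Omega>"
  shows "integrable lborel (\<lambda>x. (jac \<psi> x *v \<phi> x) \<bullet> \<eta> x)"
    "trilinear \<Omega> (L2_class \<phi>) (L2_class \<psi>) (L2_class \<eta>) = (LINT x|lborel. (jac \<psi> x *v \<phi> x) \<bullet> \<eta> x)"
proof -
  have t: "\<phi> \<in> test_functions \<Omega>" "\<psi> \<in> test_functions \<Omega>" "\<eta> \<in> test_functions \<Omega>"
    using assms fields_test by auto
  note [measurable] = measurable_jac[OF test_smooth[OF t(2)]] measurable_smooth[OF test_smooth[OF t(1)]]
    measurable_smooth[OF test_smooth[OF t(3)]]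
  let ?F = "form (L2_class (jac \<psi>)) (L2_class \<phi>) (L2_class \<eta>)"
  have m: "(\<lambda>x. (jac \<psi> x *v \<phi> x) \<bullet> \<eta> x) \<in> borel_measurable borel" by measurable
  have AE: "AE x in lborel. ?F x = (jac \<psi> x *v \<phi> x) \<bullet> \<eta> x"
    using L2_fun_L2_class[OF square_int_jac[OF t(2)]] L2_fun_L2_class[OF test_functions_square_int[OF t(1)]]
      L2_fun_L2_class[OF test_functions_square_int[OF t(3)]]
    by eventually_elim (simp add: form_def)
  have "integrable lborel ?F" by (rule form_integrable(1)[OF grad_field(1)[OF assms(1)] grad_field(1)[OF assms(3)]])
  then show "integrable lborel (\<lambda>x. (jac \<psi> x *v \<phi> x) \<bullet> \<eta> x)"
    by (rule integrable_cong_AE_imp) (use m AE in auto)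
  have "trilinear \<Omega> (L2_class \<phi>) (L2_class \<psi>) (L2_class \<eta>) = (LINT x|lborel. ?F x)"
    by (simp add: trilinear_form[OF grad_field(1)[OF assms(3)]] grad_field(2)[OF assms(2)])
  also have "\<dots> = (LINT x|lborel. (jac \<psi> x *v \<phi> x) \<bullet> \<eta> x)"
    by (rule integral_cong_AE) (use m AE in auto)
  finally show "trilinear \<Omega> (L2_class \<phi>) (L2_class \<psi>) (L2_class \<eta>) = (LINT x|lborel. (jac \<psi> x *v \<phi> x) \<bullet> \<eta> x)" .
qed

text \<open>The sum of the two forms is the integral of \<open>\<phi> \<cdot> \<nabla>(\<psi> \<cdot> \<eta>)\<close>, which is minus the integral of
  \<open>div \<phi> (\<psi> \<cdot> \<eta>)\<close>.\<close>

lemma trilinear_skew: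
  assumes "\<phi> \<in> fields \<Omega>" "\<psi> \<in> fields \<Omega>" "\<eta> \<in> fields \<Omega>"
  shows "trilinear \<Omega> (L2_class \<phi>) (L2_class \<psi>) (L2_class \<eta>) = - trilinear \<Omega> (L2_class \<phi>) (L2_class \<eta>) (L2_class \<psi>)"
proof -
  have t: "\<phi> \<in> test_functions \<Omega>" "\<psi> \<in> test_functions \<Omega>" "\<eta> \<in> test_functions \<Omega>"
    using assms fields_test by auto
  have sm: "smooth (\<lambda>x. \<psi> x $ i * \<eta> x $ i)" for i
    by (intro smooth_mult test_smooth[OF test_nth[OF t(2)]] test_smooth[OF test_nth[OF t(3)]])
  have pd: "pdiff j (\<lambda>x. \<psi> x $ i * \<eta> x $ i) x = \<psi> x $ i * jac \<eta> x $ i $ j + jac \<psi> x $ i $ j * \<eta> x $ i" for i j x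
    using pdiff_mult[OF test_smooth[OF test_nth[OF t(2)]] test_smooth[OF test_nth[OF t(3)]], of j i i x]
    by (simp add: pdiff_nth test_smooth[OF t(2)] test_smooth[OF t(3)] jac_nth)
  have "trilinear \<Omega> (L2_class \<phi>) (L2_class \<psi>) (L2_class \<eta>) + trilinear \<Omega> (L2_class \<phi>) (L2_class \<eta>) (L2_class \<psi>)
      = (LINT x|lborel. (jac \<psi> x *v \<phi> x) \<bullet> \<eta> x + (jac \<eta> x *v \<phi> x) \<bullet> \<psi> x)"
    unfolding trilinear_field(2)[OF assms] trilinear_field(2)[OF assms(1,3,2)]
    by (rule Bochner_Integration.integral_add[symmetric, OF trilinear_field(1)[OF assms] trilinear_field(1)[OF assms(1,3,2)]])
  also have "\<dots> = (LINT x|lborel. (\<Sum>i\<in>UNIV. \<Sum>j\<in>UNIV. \<phi> x $ j * pdiff j (\<lambda>x. \<psi> x $ i * \<eta> x $ i) x))"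
    unfolding form_expand pd by (simp add: UNIV_2 algebra_simps)
  also have "\<dots> = (\<Sum>i\<in>UNIV. \<Sum>j\<in>UNIV. LINT x|lborel. \<phi> x $ j * pdiff j (\<lambda>x. \<psi> x $ i * \<eta> x $ i) x)"
    by (subst Bochner_Integration.integral_sum, intro Bochner_Integration.integrable_sum test_integrable_mult[OF test_nth[OF t(1)] continuous_pdiff[OF sm]],
        intro sum.cong refl, rule Bochner_Integration.integral_sum, rule test_integrable_mult[OF test_nth[OF t(1)] continuous_pdiff[OF sm]])
  also have "\<dots> = (\<Sum>i\<in>UNIV. \<Sum>j\<in>UNIV. - (LINT x|lborel. pdiff j \<phi> x $ j * (\<psi> x $ i * \<eta> x $ i)))"
    using test_integration_by_parts[OF test_nth[OF t(1)] sm] by (simp add: pdiff_nth[OF test_smooth[OF t(1)]])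
  also have "\<dots> = - (\<Sum>i\<in>UNIV. LINT x|lborel. (\<Sum>j\<in>UNIV. pdiff j \<phi> x $ j * (\<psi> x $ i * \<eta> x $ i)))"
  proof -
    have "integrable lborel (\<lambda>x. pdiff j \<phi> x $ j * (\<psi> x $ i * \<eta> x $ i))" for i j
      by (rule test_integrable_mult[OF test_nth[OF test_pdiff[OF t(1)]] smooth_continuous[OF sm]])
    then show ?thesis by (simp add: sum_negf)
  qed
  also have "\<dots> = 0"
  proof -
    have "(\<Sum>j\<in>UNIV. pdiff j \<phi> x $ j * (\<psi> x $ i * \<eta> x $ i)) = 0" for x i
    proof (cases "x \<in> \<Omega>")
      case True
      then have "pdiff 1 \<phi> x $ 1 + pdiff 2 \<phi> x $ 2 = 0" using assms(1) by (simp add: fields_def divergence_eq)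
      then show ?thesis unfolding sum_distrib_right[symmetric] by (simp add: UNIV_2)
    next
      case False
      then show ?thesis using test_zero[OF t(2)] by simp
    qed
    then show ?thesis by simp
  qed
  finally show ?thesis by simp
qed

text \<open>The entries of the gradient of a smooth field are test functions, so the definition of weak gradients
  applies to them.\<close>

lemma grad_adjoint:
  assumes "\<phi> \<in> fields \<Omega>"
  shows "\<exists>g. \<forall>u\<in>V_space \<Omega>. grad \<Omega> u \<bullet> grad \<Omega> (L2_class \<phi>) = u \<bullet> g"
proof -
  have t: "(\<lambda>x. pdiff j \<phi> x $ i) \<in> test_functions \<Omega>" for i j
    by (rule test_nth[OF test_pdiff[OF fields_test[OF assms]]])
  let ?a = "\<lambda>i j. L2_class (\<lambda>x. pdiff j (\<lambda>x. pdiff j \<phi> x $ i) x *\<^sub>R axis i 1) :: (real^2, real^2) L2"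
  let ?c = "\<lambda>i j x. pdiff j \<phi> x $ i *\<^sub>R axis i (axis j 1) :: real^2^2"
  have sq: "square_int (?c i j)" for i j by (rule test_functions_square_int[OF test_scaleR_const[OF t]])
  have "jac \<phi> x = (\<Sum>i\<in>UNIV. \<Sum>j\<in>UNIV. ?c i j x)" for x
    by (simp add: vec_eq_iff forall_2 UNIV_2 jac_nth axis_def)
  then have "jac \<phi> = (\<lambda>x. \<Sum>i\<in>UNIV. \<Sum>j\<in>UNIV. ?c i j x)" by (rule ext)
  then have jac: "L2_class (jac \<phi>) = (\<Sum>i\<in>UNIV. \<Sum>j\<in>UNIV. L2_class (?c i j))"
    by (simp add: L2_class_sum square_int_sum sq)
  have "grad \<Omega> u \<bullet> grad \<Omega> (L2_class \<phi>) = u \<bullet> (\<Sum>i\<in>UNIV. \<Sum>j\<in>UNIV. - ?a i j)" if "u \<in> V_space \<Omega>" for u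
  proof -
    have "u \<bullet> ?a i j = - (grad \<Omega> u \<bullet> L2_class (?c i j))" for i j
      using energy_graph_weak_grad(2)[OF V_graph[OF that]] t unfolding is_weak_grad_iff by blast
    then show ?thesis unfolding grad_field(2)[OF assms] jac by (simp add: inner_sum_right)
  qed
  then show ?thesis by blast
qed

lemma trilinear_regular:
  assumes "\<phi> \<in> fields \<Omega>"
  shows "\<exists>C. \<forall>u\<in>V_space \<Omega>. \<forall>w\<in>V_space \<Omega>. \<bar>trilinear \<Omega> u (L2_class \<phi>) w\<bar> \<le> C * norm u * norm w"
proof -
  have t: "\<phi> \<in> test_functions \<Omega>" by (rule fields_test[OF assms])
  obtain C1 where C1: "\<And>x. norm (pdiff 1 \<phi> x) \<le> C1" by (rule test_bounded[OF test_pdiff[OF t]]) blast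
  obtain C2 where C2: "\<And>x. norm (pdiff 2 \<phi> x) \<le> C2" by (rule test_bounded[OF test_pdiff[OF t]]) blast
  define C where "C = C1 + C2"
  have jacC: "norm (jac \<phi> x) \<le> C" for x
  proof -
    have "norm (jac \<phi> x) \<le> norm (pdiff 1 \<phi> x) + norm (pdiff 2 \<phi> x)"
      by (rule power2_le_imp_le) (simp_all add: norm_jac power2_sum)
    then show ?thesis using C1[of x] C2[of x] by (simp add: C_def)
  qed
  have C0: "0 \<le> C" using order_trans[OF norm_ge_zero jacC] .
  have "\<bar>trilinear \<Omega> u (L2_class \<phi>) w\<bar> \<le> C * norm u * norm w" if w: "w \<in> V_space \<Omega>" for u w
  proof -
    have sq: "square_int (\<lambda>x. C * norm (L2_fun u x))"
      using square_int_scaleR[OF square_int_norm[of u], of C] by simp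
    have "L2_class (\<lambda>x. C * norm (L2_fun u x)) = C *\<^sub>R L2_class (\<lambda>x. norm (L2_fun u x))"
      using L2_class_scaleR[OF square_int_norm[of u], of C] by simp
    then have nC: "norm (L2_class (\<lambda>x. C * norm (L2_fun u x))) = C * norm u"
      using C0 by (simp add: norm_class_norm)
    have "AE x in lborel. \<bar>form (L2_class (jac \<phi>)) u w x\<bar> \<le> C * norm (L2_fun u x) * norm (L2_fun w x)"
      using L2_fun_L2_class[OF square_int_jac[OF t]]
    proof eventually_elim
      case (elim x)
      have "\<bar>form (L2_class (jac \<phi>)) u w x\<bar> \<le> norm (jac \<phi> x) * (norm (L2_fun u x) * norm (L2_fun w x))"
        unfolding form_def elim by (rule abs_form_le)
      also have "\<dots> \<le> C * (norm (L2_fun u x) * norm (L2_fun w x))"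
        by (rule mult_right_mono[OF jacC]) simp
      finally show ?case by (simp add: mult.assoc)
    qed
    from integral_le_product(2)[OF sq square_int_norm measurable_form_L2 this]
    show ?thesis unfolding trilinear_form[OF w] grad_field(2)[OF assms] norm_class_norm nC .
  qed
  then show ?thesis by blast
qed

lemma V_dense:
  assumes "v \<in> V_space \<Omega>" "\<epsilon> > 0"
  shows "\<exists>\<phi>\<in>Dsol \<Omega>. norm (grad \<Omega> (v - \<phi>)) < \<epsilon>"
proof -
  obtain \<phi> where \<phi>: "\<And>n. \<phi> n \<in> fields \<Omega>" "(\<lambda>n. L2_class (jac (\<phi> n))) \<longlonglongrightarrow> grad \<Omega> v"
    by (rule V_sequence[OF assms(1)]) blast
  obtain n where n: "dist (L2_class (jac (\<phi> n))) (grad \<Omega> v) < \<epsilon>"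
    using metric_LIMSEQ_D[OF \<phi>(2) assms(2)] by blast
  note f = grad_field[OF \<phi>(1)[of n]]
  have "grad \<Omega> (v - L2_class (\<phi> n)) = grad \<Omega> v - L2_class (jac (\<phi> n))"
    using grad_add[OF assms(1) subspace_scale[OF subspace_V f(1), of "-1"]] grad_scaleR[OF f(1), of "-1"]
    by (simp add: f(2))
  then have "norm (grad \<Omega> (v - L2_class (\<phi> n))) < \<epsilon>" using n by (simp add: dist_norm norm_minus_commute)
  then show ?thesis using \<phi>(1)[of n] unfolding Dsol_eq by blast
qed

lemma V_subset_H: "V_space \<Omega> \<subseteq> H_space \<Omega>"
proof
  fix u assume u: "u \<in> V_space \<Omega>"
  obtain \<phi> where \<phi>: "\<And>n. \<phi> n \<in> fields \<Omega>" "(\<lambda>n. L2_class (\<phi> n)) \<longlonglongrightarrow> u"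
    by (rule V_sequence[OF u]) blast
  then show "u \<in> H_space \<Omega>"
    unfolding H_space_def closure_sequential Dsol_eq by (intro exI[of _ "\<lambda>n. L2_class (\<phi> n)"]) simp
qed

end

section \<open>The attractor of the Euler scheme\<close>

lemma smooth_bounded_domain_in_square:
  assumes "smooth_bounded_domain \<Omega>"
  obtains M where "plane_domain \<Omega> M"
proof -
  have "open \<Omega>" "bounded \<Omega>" using assms by (auto simp: smooth_bounded_domain_def)
  then obtain B where B: "\<forall>x\<in>\<Omega>. norm x \<le> B" unfolding bounded_iff by blast
  have "plane_domain \<Omega> (\<bar>B\<bar> + 1)"
  proof
    fix x :: "real^2" and i assume "x \<in> \<Omega>"
    then have "\<bar>x $ i\<bar> \<le> B" using B component_le_norm_cart[of x i] by force
    then show "\<bar>x $ i\<bar> < \<bar>B\<bar> + 1" by linarith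
  qed (use \<open>open \<Omega>\<close> in auto)
  then show ?thesis by (rule that)
qed

context plane_domain
begin

lemma energy_space_V: "energy_space (V_space \<Omega>) (Dsol \<Omega>) (grad \<Omega>) (trilinear \<Omega>) (2 * M) (2 * M)"
proof
  note add = subspace_add[OF subspace_V] and scale = subspace_scale[OF subspace_V]
  note int = form_integrable(1)
  show "subspace (V_space \<Omega>)" by (rule subspace_V)
  show "grad \<Omega> (u + v) = grad \<Omega> u + grad \<Omega> v" if "u \<in> V_space \<Omega>" "v \<in> V_space \<Omega>" for u v
    by (rule grad_add[OF that])
  show "grad \<Omega> (c *\<^sub>R u) = c *\<^sub>R grad \<Omega> u" if "u \<in> V_space \<Omega>" for c u
    by (rule grad_scaleR[OF that])
  show "closed ((\<lambda>u. (u, grad \<Omega> u)) ` V_space \<Omega>)"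
    unfolding V_space_graph[OF open_domain] energy_graph_def by (rule closed_closure)
  show "0 < 2 * M" using M by simp
  show "norm u \<le> 2 * M * norm (grad \<Omega> u)" if "u \<in> V_space \<Omega>" for u by (rule poincare[OF that])
  show "\<exists>G. finite G \<and> (\<forall>u\<in>V_space \<Omega>. (norm u)\<^sup>2 \<le> \<epsilon> * (norm (grad \<Omega> u))\<^sup>2 + (\<Sum>g\<in>G. (u \<bullet> g)\<^sup>2))"
    if "\<epsilon> > 0" for \<epsilon> by (rule friedrichs[OF that])
  show "Dsol \<Omega> \<subseteq> V_space \<Omega>" unfolding Dsol_eq using grad_field(1) by blast
  show "\<exists>\<phi>\<in>Dsol \<Omega>. norm (grad \<Omega> (v - \<phi>)) < \<epsilon>" if "v \<in> V_space \<Omega>" "\<epsilon> > 0" for v \<epsilon>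
    by (rule V_dense[OF that])
  show "trilinear \<Omega> (u + u') v w = trilinear \<Omega> u v w + trilinear \<Omega> u' v w"
    if V: "u \<in> V_space \<Omega>" "u' \<in> V_space \<Omega>" "v \<in> V_space \<Omega>" "w \<in> V_space \<Omega>" for u u' v w
    unfolding trilinear_form[OF V(4)]
  proof (rule integral_form_add[OF int[OF V(1,4)] int[OF V(2,4)]])
    show "AE x in lborel. form (grad \<Omega> v) (u + u') w x = form (grad \<Omega> v) u w x + form (grad \<Omega> v) u' w x"
      using L2_fun_add[of u u'] by eventually_elim (simp add: form_def matrix_vector_right_distrib inner_add_left)
  qed
  show "trilinear \<Omega> u (v + v') w = trilinear \<Omega> u v w + trilinear \<Omega> u v' w"
    if V: "u \<in> V_space \<Omega>" "v \<in> V_space \<Omega>" "v' \<in> V_space \<Omega>" "w \<in> V_space \<Omega>" for u v v' w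
    unfolding trilinear_form[OF V(4)] grad_add[OF V(2,3)]
  proof (rule integral_form_add[OF int[OF V(1,4)] int[OF V(1,4)]])
    show "AE x in lborel. form (grad \<Omega> v + grad \<Omega> v') u w x = form (grad \<Omega> v) u w x + form (grad \<Omega> v') u w x"
      using L2_fun_add[of "grad \<Omega> v" "grad \<Omega> v'"]
      by eventually_elim (simp add: form_def matrix_vector_mult_add_rdistrib inner_add_left)
  qed
  show "trilinear \<Omega> u v (w + w') = trilinear \<Omega> u v w + trilinear \<Omega> u v w'"
    if V: "u \<in> V_space \<Omega>" "v \<in> V_space \<Omega>" "w \<in> V_space \<Omega>" "w' \<in> V_space \<Omega>" for u v w w'
    unfolding trilinear_form[OF V(3)] trilinear_form[OF V(4)] trilinear_form[OF add[OF V(3,4)]]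
  proof (rule integral_form_add[OF int[OF V(1,3)] int[OF V(1,4)]])
    show "AE x in lborel. form (grad \<Omega> v) u (w + w') x = form (grad \<Omega> v) u w x + form (grad \<Omega> v) u w' x"
      using L2_fun_add[of w w'] by eventually_elim (simp add: form_def inner_add_right)
  qed
  show "trilinear \<Omega> (c *\<^sub>R u) v w = c * trilinear \<Omega> u v w"
    if V: "u \<in> V_space \<Omega>" "v \<in> V_space \<Omega>" "w \<in> V_space \<Omega>" for c u v w
    unfolding trilinear_form[OF V(3)]
  proof (rule integral_form_scale)
    show "AE x in lborel. form (grad \<Omega> v) (c *\<^sub>R u) w x = c * form (grad \<Omega> v) u w x"
      using L2_fun_scaleR[of c u] by eventually_elim (simp add: form_def matrix_vector_mult_scaleR)
  qed
  show "trilinear \<Omega> u (c *\<^sub>R v) w = c * trilinear \<Omega> u v w"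
    if V: "u \<in> V_space \<Omega>" "v \<in> V_space \<Omega>" "w \<in> V_space \<Omega>" for c u v w
    unfolding trilinear_form[OF V(3)] grad_scaleR[OF V(2)]
  proof (rule integral_form_scale)
    show "AE x in lborel. form (c *\<^sub>R grad \<Omega> v) u w x = c * form (grad \<Omega> v) u w x"
      using L2_fun_scaleR[of c "grad \<Omega> v"]
      by eventually_elim (simp add: form_def scaleR_matrix_vector_assoc[symmetric])
  qed
  show "trilinear \<Omega> u v (c *\<^sub>R w) = c * trilinear \<Omega> u v w"
    if V: "u \<in> V_space \<Omega>" "v \<in> V_space \<Omega>" "w \<in> V_space \<Omega>" for c u v w
    unfolding trilinear_form[OF V(3)] trilinear_form[OF scale[OF V(3)]]
  proof (rule integral_form_scale)
    show "AE x in lborel. form (grad \<Omega> v) u (c *\<^sub>R w) x = c * form (grad \<Omega> v) u w x"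
      using L2_fun_scaleR[of c w] by eventually_elim (simp add: form_def)
  qed
  show "\<bar>trilinear \<Omega> u v w\<bar> \<le> 2 * M * norm (grad \<Omega> u) * norm (grad \<Omega> v) * norm (grad \<Omega> w)"
    if V: "u \<in> V_space \<Omega>" "v \<in> V_space \<Omega>" "w \<in> V_space \<Omega>" for u v w
    unfolding trilinear_form[OF V(3)] by (rule form_integrable(2)[OF V(1,3)])
  show "trilinear \<Omega> u v w = - trilinear \<Omega> u w v" if "u \<in> Dsol \<Omega>" "v \<in> Dsol \<Omega>" "w \<in> Dsol \<Omega>" for u v w
    using that trilinear_skew unfolding Dsol_eq by blast
  show "\<exists>g. \<forall>u\<in>V_space \<Omega>. grad \<Omega> u \<bullet> grad \<Omega> \<phi> = u \<bullet> g" if "\<phi> \<in> Dsol \<Omega>" for \<phi>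
    using that grad_adjoint unfolding Dsol_eq by blast
  show "\<exists>C. \<forall>u\<in>V_space \<Omega>. \<forall>w\<in>V_space \<Omega>. \<bar>trilinear \<Omega> u \<phi> w\<bar> \<le> C * norm u * norm w" if "\<phi> \<in> Dsol \<Omega>" for \<phi>
    using that trilinear_regular unfolding Dsol_eq by blast
qed

lemma euler_map_attractor:
  assumes "\<nu> > 0" "k > 0"
  shows "\<exists>A. global_attractor (H_space \<Omega>) (euler_map \<Omega> \<nu> f k) A"
proof -
  interpret energy_space "V_space \<Omega>" "Dsol \<Omega>" "grad \<Omega>" "trilinear \<Omega>" "2 * M" "2 * M"
    by (rule energy_space_V)
  have "euler_step \<Omega> \<nu> f k w = solutions (k * \<nu>) k (w + k *\<^sub>R f)" for w
    by (simp add: euler_step_def solutions_def residual_def inner_add_left)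
  then have "euler_map \<Omega> \<nu> f k = euler (k * \<nu>) k f"
    by (simp add: fun_eq_iff euler_map_def euler_def)
  then show ?thesis using euler_attractor[OF _ V_subset_H, of "k * \<nu>" k f] assms by simp
qed

end

theorem proposition3p11:
  fixes \<Omega> :: "(real^2) set" and \<nu> :: real and f :: "(real^2, real^2) L2"
  assumes "smooth_bounded_domain \<Omega>" and "\<nu> > 0" and "f \<in> H_space \<Omega>"
  shows "\<exists>\<kappa>\<^sub>1>0. \<forall>k. 0 < k \<and> k \<le> \<kappa>\<^sub>1 \<longrightarrow>
           (\<exists>!A. global_attractor (H_space \<Omega>) (euler_map \<Omega> \<nu> f k) A)"
proof -
  obtain M where "plane_domain \<Omega> M" using smooth_bounded_domain_in_square[OF assms(1)] by blast
  then have "\<exists>A. global_attractor (H_space \<Omega>) (euler_map \<Omega> \<nu> f k) A" if "0 < k" for k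
    using plane_domain.euler_map_attractor[OF _ assms(2) that] by blast
  then have "\<exists>!A. global_attractor (H_space \<Omega>) (euler_map \<Omega> \<nu> f k) A" if "0 < k" for k
    using that global_attractor_unique by (intro ex_ex1I) blast+
  \<comment> \<open>The attractor exists for every \<open>k > 0\<close>, so any positive witness serves.\<close>
  then show ?thesis by (intro exI[of _ 1]) simp
qed

end
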